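(* Let $\Pi=\Pi_{2,0}+P$ be a coupling Poisson tensor on a fiber bundle $\pi:E\to B$, $(\gamma,\sigma,P)$ its (integrable) geometric data, and $(\mathcal A^\gamma,\bar\partial^\gamma,\rho^\gamma)$ the associated objects. Then there is an isomorphism (of vector spaces) $$\operatorname{Poiss}(E,\Pi)\cong Z^1_{\bar\partial^\gamma}\oplus\ker\rho^\gamma.$$
   Context: Everything is smooth. For a Poisson tensor $\Pi$ on $E$ ($[\Pi,\Pi]=0$), $\Pi^\sharp:T^*E\to TE$ is given by $\langle\beta,\Pi^\sharp\alpha\rangle=\Pi(\alpha,\beta)$; $\operatorname{Poiss}(E,\Pi)=\{Z\in\mathfrak X(E):L_Z\Pi=0\}$, $\operatorname{Ham}(E,\Pi)=\{\Pi^\sharp dF:F\in C^\infty(E)\}$, $\operatorname{Casim}(E,\Pi)=\{F:\Pi^\sharp dF=0\}$. Let $\pi:E\to B$ be a fiber bundle (surjective submersion), $\mathbb V=\ker d\pi$, $\mathbb V^0\subset T^*E$ its annihilator. $\Pi$ is coupling if $TE=\mathbb H\oplus\mathbb V$ with $\mathbb H:=\Pi^\sharp(\mathbb V^0)$. Then $\Pi=\Pi_{2,0}+P$ with $\Pi_{2,0}\in\Gamma(\wedge^2\mathbb H)$ and $P=\Pi_{0,2}\in\Gamma(\wedge^2\mathbb V)$ a vertical Poisson tensor, and $\Pi_{2,0}^\sharp|_{\mathbb V^0}:\mathbb V^0\to\mathbb H$ is an isomorphism. The geometric data $(\gamma,\sigma,P)$ of $\Pi$: $\gamma$ is the projection $TE\to\mathbb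 V$ along $\mathbb H$, with horizontal lifts $\operatorname{hor}^\gamma(u)\in\Gamma(\mathbb H)$ of $u\in\mathfrak X(B)$; $\sigma\in\Omega^{2,0}_B(E)$ is the coupling form, defined by $(\pi^*\sigma)^\flat|_{\mathbb H}=-(\Pi_{2,0}^\sharp|_{\mathbb V^0})^{-1}$, where $(\pi^*\sigma)^\flat X=\mathbf i_X\pi^*\sigma$. "Integrable" means that $[P,P]=0$, $L_{\operatorname{hor}^\gamma(u)}P=0$, $[\operatorname{hor}^\gamma(u),\operatorname{hor}^\gamma(v)]-\operatorname{hor}^\gamma([u,v])=-P^\sharp d\sigma(u,v)$ and $\partial^\gamma_{1,0}\sigma=0$; this holds automatically for the data of a coupling Poisson tensor. $\Omega^{p,0}_B(E)=\Omega^p(B)\otimes_{C^\infty(B)}C^\infty(E)$; for $\eta\in\Omega^{p,0}_B(E)$, $(\pi^*\eta)(X_1,\dots,X_p)(e)=\eta(d_e\pi X_1,\dots,d_e\pi X_p)$. The covariant exterior derivative is $$(\partial^\gamma_{1,0}\eta)(u_0,\dots,u_p)=\sum_i(-1)^iL_{\operatorname{hor}^\gamma(u_i)}\eta(u_0,\dots,\hat u_i,\dots,u_p)+\sum_{i<j}(-1)^{i+j}\eta([u_i,u_j],u_0,\dots,\hat u_i,\dots,\hat u_j,\dots,u_p).$$ Let $\mathcal C^p=\Omega^p(B)\otimes_{C^\infty(B)}\operatorname{Casim}(E,P)$; $\bar\partial^\gamma:=\partial^\gamma_{1,0}|_{\mathcal C^*}$ maps $\mathcal C^p$ to $\mathcal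 C^{p+1}$ and squares to zero; $Z^p_{\bar\partial^\gamma}$ and $H^p_{\bar\partial^\gamma}$ are its cocycles and cohomology. $\operatorname{Poiss}_V(E,P)=\{Y\in\Gamma(\mathbb V):L_YP=0\}$, $\mathcal A^\gamma=\{Y\in\operatorname{Poiss}_V(E,P):[\operatorname{hor}^\gamma(u),Y]\in\operatorname{Ham}(E,P)\ \forall u\in\mathfrak X(B)\}$. For $Y\in\mathcal A^\gamma$ there is $\beta_Y\in\Omega^{1,0}_B(E)$ with $[\operatorname{hor}^\gamma(u),Y]=-P^\sharp d(\beta_Y(u))$ for all $u$. Put $\tau_Y=\partial^\gamma_{1,0}\beta_Y+L_Y\sigma$ with $(L_Y\sigma)(u_1,u_2)=L_Y(\sigma(u_1,u_2))$. Then $\tau_Y\in\mathcal C^2$ is $\bar\partial^\gamma$-closed with class independent of the choice of $\beta_Y$, and $\rho^\gamma:\mathcal A^\gamma\to H^2_{\bar\partial^\gamma}$ is $\rho^\gamma(Y)=[\tau_Y]$. *)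

theory Defs
  imports "HOL-Analysis.Analysis" "HOL-Library.Function_Algebras"
begin

section \<open>Pointwise real vector space structure on functions\<close>

instantiation "fun" :: (type, real_vector) real_vector
begin

definition scaleR_fun :: "real \<Rightarrow> ('a \<Rightarrow> 'b) \<Rightarrow> 'a \<Rightarrow> 'b"
  where "scaleR_fun c f = (\<lambda>x. c *\<^sub>R f x)"

instance
  by standard (simp_all add: scaleR_fun_def fun_eq_iff scaleR_add_right scaleR_add_left)

end

text \<open>Isomorphism of linear subspaces of possibly different real vector spaces.\<close>

definition vs_isomorphic :: "'a::real_vector set \<Rightarrow> 'b::real_vector set \<Rightarrow> bool"
  where "vs_isomorphic S T \<longleftrightarrow> subspace S \<and> subspace T \<and>
    (\<exists>\<Phi>. bij_betw \<Phi> S T \<and>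
         (\<forall>x\<in>S. \<forall>y\<in>S. \<Phi> (x + y) = \<Phi> x + \<Phi> y) \<and>
         (\<forall>c. \<forall>x\<in>S. \<Phi> (c *\<^sub>R x) = c *\<^sub>R \<Phi> x))"


section \<open>Smooth manifolds\<close>

primrec C_k_on :: "nat \<Rightarrow> 'a::euclidean_space set \<Rightarrow> ('a \<Rightarrow> 'b::real_normed_vector) \<Rightarrow> bool"
  where
    "C_k_on 0 W g \<longleftrightarrow> continuous_on W g"
  | "C_k_on (Suc k) W g \<longleftrightarrow>
      (\<forall>x\<in>W. g differentiable (at x)) \<and>
      (\<forall>v. C_k_on k W (\<lambda>x. frechet_derivative g (at x) v))"

text \<open>A function on an arbitrary subset of a Euclidean space is smooth if near each point it
  extends to a smooth function on an open set. On a (relatively) open subset of a linear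
  subspace this is ordinary smoothness.\<close>

definition smooth_on :: "'a::euclidean_space set \<Rightarrow> ('a \<Rightarrow> 'b::real_normed_vector) \<Rightarrow> bool"
  where "smooth_on S f \<longleftrightarrow>
    (\<forall>x\<in>S. \<exists>W g. open W \<and> x \<in> W \<and> (\<forall>k. C_k_on k W g) \<and> (\<forall>y\<in>S \<inter> W. g y = f y))"

text \<open>A manifold is a whole Hausdorff, second countable type together with an atlas of charts
  \<open>(U, \<phi>)\<close>; only the values of \<open>\<phi>\<close> on \<open>U\<close> matter. The charts take values in open subsets of
  one linear subspace of a Euclidean space, so that every dimension, including 0, is covered.\<close>

type_synonym ('e, 'm) atlas = "('e set \<times> ('e \<Rightarrow> 'm)) set"

definition smooth_manifold ::
    "('e::{t2_space, second_countable_topology}, 'm::euclidean_space) atlas \<Rightarrow> bool"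
  where "smooth_manifold M \<longleftrightarrow>
    \<Union> (fst ` M) = UNIV \<and>
    (\<exists>V. subspace V \<and>
      (\<forall>(U, \<phi>)\<in>M. open U \<and> openin (top_of_set V) (\<phi> ` U) \<and>
                  homeomorphism U (\<phi> ` U) \<phi> (inv_into U \<phi>))) \<and>
    (\<forall>(U, \<phi>)\<in>M. \<forall>(W, \<psi>)\<in>M. smooth_on (\<phi> ` (U \<inter> W)) (\<psi> \<circ> inv_into U \<phi>))"

definition Cinf :: "('e, 'm::euclidean_space) atlas \<Rightarrow> ('e \<Rightarrow> real) set"
  where "Cinf M = {f. \<forall>(U, \<phi>)\<in>M. smooth_on (\<phi> ` U) (f \<circ> inv_into U \<phi>)}"

definition smooth_map ::
    "('e::topological_space, 'm::euclidean_space) atlas \<Rightarrow>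
     ('b::topological_space, 'n::euclidean_space) atlas \<Rightarrow> ('e \<Rightarrow> 'b) \<Rightarrow> bool"
  where "smooth_map M N \<pi> \<longleftrightarrow> continuous_on UNIV \<pi> \<and>
    (\<forall>(U, \<phi>)\<in>M. \<forall>(W, \<psi>)\<in>N. smooth_on (\<phi> ` (U \<inter> \<pi> -` W)) (\<psi> \<circ> \<pi> \<circ> inv_into U \<phi>))"


section \<open>Tangent and cotangent spaces, vector fields, forms\<close>

text \<open>Tangent vectors at a point are derivations of the algebra of smooth functions there, and
  cotangent vectors are linear functionals on the tangent space. Both are made extensional by
  the value 0 outside their domain. Tensor fields are smooth sections.\<close>

type_synonym 'e tvec = "('e \<Rightarrow> real) \<Rightarrow> real"
type_synonym 'e covec = "'e tvec \<Rightarrow> real"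
type_synonym 'e vfield = "'e \<Rightarrow> 'e tvec"
type_synonym 'e bivec = "'e \<Rightarrow> 'e covec \<Rightarrow> 'e covec \<Rightarrow> real"

definition tangent_space :: "('e, 'm::euclidean_space) atlas \<Rightarrow> 'e \<Rightarrow> 'e tvec set"
  where "tangent_space M p = {v.
    (\<forall>f\<in>Cinf M. \<forall>g\<in>Cinf M. v (f + g) = v f + v g) \<and>
    (\<forall>c. \<forall>f\<in>Cinf M. v (c *\<^sub>R f) = c * v f) \<and>
    (\<forall>f\<in>Cinf M. \<forall>g\<in>Cinf M. v (f * g) = f p * v g + g p * v f) \<and>
    (\<forall>f. f \<notin> Cinf M \<longrightarrow> v f = 0)}"

definition cotangent_space :: "('e, 'm::euclidean_space) atlas \<Rightarrow> 'e \<Rightarrow> 'e covec set"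
  where "cotangent_space M p = {\<alpha>.
    (\<forall>v\<in>tangent_space M p. \<forall>w\<in>tangent_space M p. \<alpha> (v + w) = \<alpha> v + \<alpha> w) \<and>
    (\<forall>c. \<forall>v\<in>tangent_space M p. \<alpha> (c *\<^sub>R v) = c * \<alpha> v) \<and>
    (\<forall>v. v \<notin> tangent_space M p \<longrightarrow> \<alpha> v = 0)}"

definition differential :: "('e, 'm::euclidean_space) atlas \<Rightarrow> ('e \<Rightarrow> real) \<Rightarrow> 'e \<Rightarrow> 'e covec"
  where "differential M f p = (\<lambda>v. if v \<in> tangent_space M p then v f else 0)"

definition lie_fun :: "'e vfield \<Rightarrow> ('e \<Rightarrow> real) \<Rightarrow> 'e \<Rightarrow> real"
  where "lie_fun X f = (\<lambda>p. X p f)"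

definition vfields :: "('e, 'm::euclidean_space) atlas \<Rightarrow> 'e vfield set"
  where "vfields M = {X. (\<forall>p. X p \<in> tangent_space M p) \<and> (\<forall>f\<in>Cinf M. lie_fun X f \<in> Cinf M)}"

definition lie_bracket :: "'e vfield \<Rightarrow> 'e vfield \<Rightarrow> 'e vfield"
  where "lie_bracket X Y = (\<lambda>p f. X p (lie_fun Y f) - Y p (lie_fun X f))"

definition fun_times_vfield :: "('e \<Rightarrow> real) \<Rightarrow> 'e vfield \<Rightarrow> 'e vfield"
  where "fun_times_vfield f X = (\<lambda>p. f p *\<^sub>R X p)"

definition one_forms :: "('e, 'm::euclidean_space) atlas \<Rightarrow> ('e \<Rightarrow> 'e covec) set"
  where "one_forms M = {\<alpha>. (\<forall>p. \<alpha> p \<in> cotangent_space M p) \<and>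
    (\<forall>X\<in>vfields M. (\<lambda>p. \<alpha> p (X p)) \<in> Cinf M)}"

text \<open>\<open>\<And>\<^sup>2T\<^sub>p\<close> is identified with the alternating bilinear forms on \<open>T\<^sub>p\<^sup>*\<close>.\<close>

definition bivectors_at ::
    "('e, 'm::euclidean_space) atlas \<Rightarrow> 'e \<Rightarrow> ('e covec \<Rightarrow> 'e covec \<Rightarrow> real) set"
  where "bivectors_at M p = {Q.
    (\<forall>\<alpha>\<in>cotangent_space M p. \<forall>\<beta>\<in>cotangent_space M p. \<forall>\<theta>\<in>cotangent_space M p.
        Q (\<alpha> + \<beta>) \<theta> = Q \<alpha> \<theta> + Q \<beta> \<theta> \<and> Q \<theta> (\<alpha> + \<beta>) = Q \<theta> \<alpha> + Q \<theta> \<beta>) \<and>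
    (\<forall>c. \<forall>\<alpha>\<in>cotangent_space M p. \<forall>\<beta>\<in>cotangent_space M p.
        Q (c *\<^sub>R \<alpha>) \<beta> = c * Q \<alpha> \<beta> \<and> Q \<alpha> (c *\<^sub>R \<beta>) = c * Q \<alpha> \<beta>) \<and>
    (\<forall>\<alpha>\<in>cotangent_space M p. Q \<alpha> \<alpha> = 0) \<and>
    (\<forall>\<alpha> \<beta>. \<alpha> \<notin> cotangent_space M p \<or> \<beta> \<notin> cotangent_space M p \<longrightarrow> Q \<alpha> \<beta> = 0)}"

definition bivector_fields :: "('e, 'm::euclidean_space) atlas \<Rightarrow> 'e bivec set"
  where "bivector_fields M = {Q. (\<forall>p. Q p \<in> bivectors_at M p) \<and>
    (\<forall>\<alpha>\<in>one_forms M. \<forall>\<beta>\<in>one_forms M. (\<lambda>p. Q p (\<alpha> p) (\<beta> p)) \<in> Cinf M)}"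


section \<open>Poisson geometry\<close>

text \<open>The tangent vector \<open>Q\<^sup>\<sharp>\<alpha>\<close> is given by its action on functions,
  \<open>(Q\<^sup>\<sharp>\<alpha>) f = \<langle>df, Q\<^sup>\<sharp>\<alpha>\<rangle> = Q(\<alpha>, df)\<close>.\<close>

definition sharp ::
    "('e, 'm::euclidean_space) atlas \<Rightarrow> 'e bivec \<Rightarrow> 'e \<Rightarrow> 'e covec \<Rightarrow> 'e tvec"
  where "sharp M Q p \<alpha> = (\<lambda>f. if f \<in> Cinf M then Q p \<alpha> (differential M f p) else 0)"

definition sharp_d :: "('e, 'm::euclidean_space) atlas \<Rightarrow> 'e bivec \<Rightarrow> ('e \<Rightarrow> real) \<Rightarrow> 'e vfield"
  where "sharp_d M Q f = (\<lambda>p. sharp M Q p (differential M f p))"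

definition bivec_d ::
    "('e, 'm::euclidean_space) atlas \<Rightarrow> 'e bivec \<Rightarrow> ('e \<Rightarrow> real) \<Rightarrow> ('e \<Rightarrow> real) \<Rightarrow> 'e \<Rightarrow> real"
  where "bivec_d M Q f g = (\<lambda>p. Q p (differential M f p) (differential M g p))"

text \<open>Multivector fields are determined by their values on exact 1-forms, since differentials
  of smooth functions span every cotangent space. The Schouten bracket of two bivector fields
  and the Lie derivative of a bivector field are given by these values, i.e. as
  \<open>[Q,R](df,dg,dh)\<close> (up to the overall sign convention) and \<open>(L\<^sub>Z Q)(df,dg)\<close>, the latter
  using \<open>L\<^sub>Z df = d(Z f)\<close>.\<close>

definition schouten ::
    "('e, 'm::euclidean_space) atlas \<Rightarrow> 'e bivec \<Rightarrow> 'e bivec \<Rightarrow>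
     ('e \<Rightarrow> real) \<Rightarrow> ('e \<Rightarrow> real) \<Rightarrow> ('e \<Rightarrow> real) \<Rightarrow> 'e \<Rightarrow> real"
  where "schouten M Q R f g h =
      bivec_d M Q (bivec_d M R f g) h + bivec_d M R (bivec_d M Q f g) h
    + bivec_d M Q (bivec_d M R g h) f + bivec_d M R (bivec_d M Q g h) f
    + bivec_d M Q (bivec_d M R h f) g + bivec_d M R (bivec_d M Q h f) g"

definition lie_bivec ::
    "('e, 'm::euclidean_space) atlas \<Rightarrow> 'e vfield \<Rightarrow> 'e bivec \<Rightarrow>
     ('e \<Rightarrow> real) \<Rightarrow> ('e \<Rightarrow> real) \<Rightarrow> 'e \<Rightarrow> real"
  where "lie_bivec M Z Q f g =
    lie_fun Z (bivec_d M Q f g) - bivec_d M Q (lie_fun Z f) g - bivec_d M Q f (lie_fun Z g)"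

definition poisson_tensor :: "('e, 'm::euclidean_space) atlas \<Rightarrow> 'e bivec \<Rightarrow> bool"
  where "poisson_tensor M Q \<longleftrightarrow> Q \<in> bivector_fields M \<and>
    (\<forall>f\<in>Cinf M. \<forall>g\<in>Cinf M. \<forall>h\<in>Cinf M. schouten M Q Q f g h = 0)"

definition Poiss :: "('e, 'm::euclidean_space) atlas \<Rightarrow> 'e bivec \<Rightarrow> 'e vfield set"
  where "Poiss M Q = {Z\<in>vfields M. \<forall>f\<in>Cinf M. \<forall>g\<in>Cinf M. lie_bivec M Z Q f g = 0}"

definition Ham :: "('e, 'm::euclidean_space) atlas \<Rightarrow> 'e bivec \<Rightarrow> 'e vfield set"
  where "Ham M Q = sharp_d M Q ` Cinf M"

definition Casim :: "('e, 'm::euclidean_space) atlas \<Rightarrow> 'e bivec \<Rightarrow> ('e \<Rightarrow> real) set"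
  where "Casim M Q = {F\<in>Cinf M. sharp_d M Q F = 0}"


section \<open>Fiber bundles and coupling Poisson tensors\<close>

text \<open>The differential \<open>d\<^sub>e\<pi>\<close>, applied to tangent vectors at \<open>e\<close>; as a formula it does not
  depend on \<open>e\<close>.\<close>

definition push ::
    "('b, 'n::euclidean_space) atlas \<Rightarrow> ('e \<Rightarrow> 'b) \<Rightarrow> 'e tvec \<Rightarrow> 'b tvec"
  where "push N \<pi> v = (\<lambda>g. if g \<in> Cinf N then v (g \<circ> \<pi>) else 0)"

definition fiber_bundle ::
    "('e::{t2_space, second_countable_topology}, 'm::euclidean_space) atlas \<Rightarrow>
     ('b::{t2_space, second_countable_topology}, 'n::euclidean_space) atlas \<Rightarrow>
     ('e \<Rightarrow> 'b) \<Rightarrow> bool"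
  where "fiber_bundle M N \<pi> \<longleftrightarrow>
    smooth_manifold M \<and> smooth_manifold N \<and> smooth_map M N \<pi> \<and> surj \<pi> \<and>
    (\<forall>e. push N \<pi> ` tangent_space M e = tangent_space N (\<pi> e))"

definition vertical ::
    "('e, 'm::euclidean_space) atlas \<Rightarrow> ('b, 'n::euclidean_space) atlas \<Rightarrow> ('e \<Rightarrow> 'b) \<Rightarrow>
     'e \<Rightarrow> 'e tvec set"
  where "vertical M N \<pi> e = {v\<in>tangent_space M e. push N \<pi> v = 0}"

definition annihilator ::
    "('e, 'm::euclidean_space) atlas \<Rightarrow> 'e \<Rightarrow> 'e tvec set \<Rightarrow> 'e covec set"
  where "annihilator M e W = {\<alpha>\<in>cotangent_space M e. \<forall>w\<in>W. \<alpha> w = 0}"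

definition horizontal ::
    "('e, 'm::euclidean_space) atlas \<Rightarrow> ('b, 'n::euclidean_space) atlas \<Rightarrow> ('e \<Rightarrow> 'b) \<Rightarrow>
     'e bivec \<Rightarrow> 'e \<Rightarrow> 'e tvec set"
  where "horizontal M N \<pi> Q e = sharp M Q e ` annihilator M e (vertical M N \<pi> e)"

definition coupling ::
    "('e, 'm::euclidean_space) atlas \<Rightarrow> ('b, 'n::euclidean_space) atlas \<Rightarrow> ('e \<Rightarrow> 'b) \<Rightarrow>
     'e bivec \<Rightarrow> bool"
  where "coupling M N \<pi> Q \<longleftrightarrow> (\<forall>e.
    tangent_space M e = {h + v |h v. h \<in> horizontal M N \<pi> Q e \<and> v \<in> vertical M N \<pi> e} \<and>
    horizontal M N \<pi> Q e \<inter> vertical M N \<pi> e = {0})"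

text \<open>For a subspace \<open>W\<close> of the tangent space, \<open>\<And>\<^sup>2W\<close> consists of the bivectors whose
  contraction with every covector annihilating \<open>W\<close> vanishes.\<close>

definition wedge2 ::
    "('e, 'm::euclidean_space) atlas \<Rightarrow> 'e \<Rightarrow> 'e tvec set \<Rightarrow> ('e covec \<Rightarrow> 'e covec \<Rightarrow> real) set"
  where "wedge2 M e W = {Q\<in>bivectors_at M e.
    \<forall>\<alpha>\<in>annihilator M e W. \<forall>\<beta>\<in>cotangent_space M e. Q \<alpha> \<beta> = 0}"


section \<open>Horizontal forms\<close>

text \<open>For a \<open>C\<^sup>\<infinity>(B)\<close>-submodule \<open>A\<close> of \<open>C\<^sup>\<infinity>(E)\<close>, the module \<open>\<Omega>\<^sup>p(B) \<otimes> A\<close> over \<open>C\<^sup>\<infinity>(B)\<close> is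
  identified with the alternating \<open>C\<^sup>\<infinity>(B)\<close>-multilinear maps from \<open>p\<close>-tuples of vector fields
  on \<open>B\<close> to \<open>A\<close>, by \<open>(\<omega> \<otimes> f)(u\<^sub>1,\<dots>,u\<^sub>p) = (\<omega>(u\<^sub>1,\<dots>,u\<^sub>p) \<circ> \<pi>) f\<close>; this is a bijection because
  the vector fields on \<open>B\<close> form a finitely generated projective module. Tuples are lists, and
  the maps have value 0 on all other lists.\<close>

type_synonym ('b, 'e) hform = "'b vfield list \<Rightarrow> 'e \<Rightarrow> real"

definition hforms ::
    "('b, 'n::euclidean_space) atlas \<Rightarrow> ('e \<Rightarrow> 'b) \<Rightarrow> nat \<Rightarrow> ('e \<Rightarrow> real) set \<Rightarrow>
     ('b, 'e) hform set"
  where "hforms N \<pi> p A = {\<eta>.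
    (\<forall>us. length us = p \<and> set us \<subseteq> vfields N \<longrightarrow>
      \<eta> us \<in> A \<and>
      (\<forall>i<p. \<forall>u\<in>vfields N. \<forall>v\<in>vfields N. \<eta> (us[i := u + v]) = \<eta> (us[i := u]) + \<eta> (us[i := v])) \<and>
      (\<forall>i<p. \<forall>f\<in>Cinf N. \<forall>u\<in>vfields N.
        \<eta> (us[i := fun_times_vfield f u]) = (f \<circ> \<pi>) * \<eta> (us[i := u])) \<and>
      (\<forall>i<p. \<forall>j<p. i \<noteq> j \<and> us ! i = us ! j \<longrightarrow> \<eta> us = 0)) \<and>
    (\<forall>us. \<not> (length us = p \<and> set us \<subseteq> vfields N) \<longrightarrow> \<eta> us = 0)}"

text \<open>\<open>(\<pi>\<^sup>*\<eta>)(X\<^sub>1,\<dots>,X\<^sub>p)(e) = \<eta>(d\<^sub>e\<pi> X\<^sub>1,\<dots>,d\<^sub>e\<pi> X\<^sub>p)\<close>, where tangent vectors of \<open>B\<close> at \<open>\<pi>(e)\<close> are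
  inserted into \<open>\<eta>\<close> by extending them to vector fields; by \<open>C\<^sup>\<infinity>(B)\<close>-multilinearity the choice of
  the extensions does not matter.\<close>

definition pull_back ::
    "('b, 'n::euclidean_space) atlas \<Rightarrow> ('e \<Rightarrow> 'b) \<Rightarrow> ('b, 'e) hform \<Rightarrow> 'e \<Rightarrow> 'e tvec list \<Rightarrow> real"
  where "pull_back N \<pi> \<eta> e Xs =
    \<eta> (map (\<lambda>X. SOME u. u \<in> vfields N \<and> u (\<pi> e) = push N \<pi> X) Xs) e"

definition hor_lift ::
    "('e, 'm::euclidean_space) atlas \<Rightarrow> ('b, 'n::euclidean_space) atlas \<Rightarrow> ('e \<Rightarrow> 'b) \<Rightarrow>
     ('e \<Rightarrow> 'e tvec \<Rightarrow> 'e tvec) \<Rightarrow> 'b vfield \<Rightarrow> 'e vfield"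
  where "hor_lift M N \<pi> \<gamma> u =
    (\<lambda>e. THE h. h \<in> tangent_space M e \<and> \<gamma> e h = 0 \<and> push N \<pi> h = u (\<pi> e))"

definition remove_nth :: "nat \<Rightarrow> 'a list \<Rightarrow> 'a list"
  where "remove_nth i xs = take i xs @ drop (Suc i) xs"

definition cov_ext_deriv ::
    "('e, 'm::euclidean_space) atlas \<Rightarrow> ('b, 'n::euclidean_space) atlas \<Rightarrow> ('e \<Rightarrow> 'b) \<Rightarrow>
     ('e \<Rightarrow> 'e tvec \<Rightarrow> 'e tvec) \<Rightarrow> ('b, 'e) hform \<Rightarrow> ('b, 'e) hform"
  where "cov_ext_deriv M N \<pi> \<gamma> \<eta> us =
    (if set us \<subseteq> vfields N then
       (\<Sum>i<length us. (-1) ^ i *\<^sub>R lie_fun (hor_lift M N \<pi> \<gamma> (us ! i)) (\<eta> (remove_nth i us)))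
     + (\<Sum>(i, j) | i < j \<and> j < length us.
         (-1) ^ (i + j) *\<^sub>R \<eta> (lie_bracket (us ! i) (us ! j) # remove_nth i (remove_nth j us)))
     else 0)"


section \<open>Geometric data of a coupling tensor\<close>

text \<open>The parameters are the coupling tensor \<open>Q\<close>, its components in \<open>Q = Q20 + P\<close>, the
  projection \<open>\<gamma>\<close> onto the vertical bundle along the horizontal one, and the coupling form \<open>\<sigma>\<close>.
  The values of \<open>\<gamma> e\<close> outside the tangent space at \<open>e\<close> are irrelevant.\<close>

definition geometric_data ::
    "('e, 'm::euclidean_space) atlas \<Rightarrow> ('b, 'n::euclidean_space) atlas \<Rightarrow> ('e \<Rightarrow> 'b) \<Rightarrow>
     'e bivec \<Rightarrow> 'e bivec \<Rightarrow> ('e \<Rightarrow> 'e tvec \<Rightarrow> 'e tvec) \<Rightarrow> ('b, 'e) hform \<Rightarrow> 'e bivec \<Rightarrow> bool"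
  where "geometric_data M N \<pi> Q Q20 \<gamma> \<sigma> P \<longleftrightarrow>
    Q = Q20 + P \<and>
    Q20 \<in> bivector_fields M \<and> (\<forall>e. Q20 e \<in> wedge2 M e (horizontal M N \<pi> Q e)) \<and>
    P \<in> bivector_fields M \<and> (\<forall>e. P e \<in> wedge2 M e (vertical M N \<pi> e)) \<and>
    (\<forall>e. \<forall>h\<in>horizontal M N \<pi> Q e. \<forall>v\<in>vertical M N \<pi> e. \<gamma> e (h + v) = v) \<and>
    \<sigma> \<in> hforms N \<pi> 2 (Cinf M) \<and>
    (\<forall>e. \<forall>X\<in>horizontal M N \<pi> Q e. \<forall>Y\<in>tangent_space M e.
       pull_back N \<pi> \<sigma> e [X, Y] =
       - inv_into (annihilator M e (vertical M N \<pi> e)) (sharp M Q20 e) X Y)"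


section \<open>The Casimir-valued complex and the map \<open>\<rho>\<close>\<close>

definition casimir_cochains ::
    "('e, 'm::euclidean_space) atlas \<Rightarrow> ('b, 'n::euclidean_space) atlas \<Rightarrow> ('e \<Rightarrow> 'b) \<Rightarrow>
     'e bivec \<Rightarrow> nat \<Rightarrow> ('b, 'e) hform set"
  where "casimir_cochains M N \<pi> P p = hforms N \<pi> p (Casim M P)"

definition casimir_cocycles ::
    "('e, 'm::euclidean_space) atlas \<Rightarrow> ('b, 'n::euclidean_space) atlas \<Rightarrow> ('e \<Rightarrow> 'b) \<Rightarrow>
     ('e \<Rightarrow> 'e tvec \<Rightarrow> 'e tvec) \<Rightarrow> 'e bivec \<Rightarrow> nat \<Rightarrow> ('b, 'e) hform set"
  where "casimir_cocycles M N \<pi> \<gamma> P p =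
    {\<eta>\<in>casimir_cochains M N \<pi> P p. cov_ext_deriv M N \<pi> \<gamma> \<eta> = 0}"

definition casimir_coboundaries ::
    "('e, 'm::euclidean_space) atlas \<Rightarrow> ('b, 'n::euclidean_space) atlas \<Rightarrow> ('e \<Rightarrow> 'b) \<Rightarrow>
     ('e \<Rightarrow> 'e tvec \<Rightarrow> 'e tvec) \<Rightarrow> 'e bivec \<Rightarrow> nat \<Rightarrow> ('b, 'e) hform set"
  where "casimir_coboundaries M N \<pi> \<gamma> P p =
    (case p of 0 \<Rightarrow> {0} | Suc q \<Rightarrow> cov_ext_deriv M N \<pi> \<gamma> ` casimir_cochains M N \<pi> P q)"

text \<open>Cohomology classes are cosets of the space of coboundaries.\<close>

definition casimir_class ::
    "('e, 'm::euclidean_space) atlas \<Rightarrow> ('b, 'n::euclidean_space) atlas \<Rightarrow> ('e \<Rightarrow> 'b) \<Rightarrow>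
     ('e \<Rightarrow> 'e tvec \<Rightarrow> 'e tvec) \<Rightarrow> 'e bivec \<Rightarrow> nat \<Rightarrow> ('b, 'e) hform \<Rightarrow> ('b, 'e) hform set"
  where "casimir_class M N \<pi> \<gamma> P p \<eta> = (\<lambda>\<zeta>. \<eta> + \<zeta>) ` casimir_coboundaries M N \<pi> \<gamma> P p"

definition Poiss_V ::
    "('e, 'm::euclidean_space) atlas \<Rightarrow> ('b, 'n::euclidean_space) atlas \<Rightarrow> ('e \<Rightarrow> 'b) \<Rightarrow>
     'e bivec \<Rightarrow> 'e vfield set"
  where "Poiss_V M N \<pi> P = {Y\<in>Poiss M P. \<forall>e. Y e \<in> vertical M N \<pi> e}"

definition A_gamma ::
    "('e, 'm::euclidean_space) atlas \<Rightarrow> ('b, 'n::euclidean_space) atlas \<Rightarrow> ('e \<Rightarrow> 'b) \<Rightarrow>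
     ('e \<Rightarrow> 'e tvec \<Rightarrow> 'e tvec) \<Rightarrow> 'e bivec \<Rightarrow> 'e vfield set"
  where "A_gamma M N \<pi> \<gamma> P = {Y\<in>Poiss_V M N \<pi> P.
    \<forall>u\<in>vfields N. lie_bracket (hor_lift M N \<pi> \<gamma> u) Y \<in> Ham M P}"

definition admissible_beta ::
    "('e, 'm::euclidean_space) atlas \<Rightarrow> ('b, 'n::euclidean_space) atlas \<Rightarrow> ('e \<Rightarrow> 'b) \<Rightarrow>
     ('e \<Rightarrow> 'e tvec \<Rightarrow> 'e tvec) \<Rightarrow> 'e bivec \<Rightarrow> 'e vfield \<Rightarrow> ('b, 'e) hform set"
  where "admissible_beta M N \<pi> \<gamma> P Y = {\<beta>\<in>hforms N \<pi> 1 (Cinf M).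
    \<forall>u\<in>vfields N. lie_bracket (hor_lift M N \<pi> \<gamma> u) Y = - sharp_d M P (\<beta> [u])}"

definition tau ::
    "('e, 'm::euclidean_space) atlas \<Rightarrow> ('b, 'n::euclidean_space) atlas \<Rightarrow> ('e \<Rightarrow> 'b) \<Rightarrow>
     ('e \<Rightarrow> 'e tvec \<Rightarrow> 'e tvec) \<Rightarrow> ('b, 'e) hform \<Rightarrow> 'e vfield \<Rightarrow> ('b, 'e) hform \<Rightarrow> ('b, 'e) hform"
  where "tau M N \<pi> \<gamma> \<sigma> Y \<beta> = cov_ext_deriv M N \<pi> \<gamma> \<beta> + (\<lambda>us. lie_fun Y (\<sigma> us))"

text \<open>The class \<open>[\<tau>\<^sub>Y]\<close> does not depend on the admissible \<open>\<beta>\<close>, so all the cosets in the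
  following union coincide.\<close>

definition rho ::
    "('e, 'm::euclidean_space) atlas \<Rightarrow> ('b, 'n::euclidean_space) atlas \<Rightarrow> ('e \<Rightarrow> 'b) \<Rightarrow>
     ('e \<Rightarrow> 'e tvec \<Rightarrow> 'e tvec) \<Rightarrow> ('b, 'e) hform \<Rightarrow> 'e bivec \<Rightarrow> 'e vfield \<Rightarrow> ('b, 'e) hform set"
  where "rho M N \<pi> \<gamma> \<sigma> P Y =
    (\<Union>\<beta>\<in>admissible_beta M N \<pi> \<gamma> P Y. casimir_class M N \<pi> \<gamma> P 2 (tau M N \<pi> \<gamma> \<sigma> Y \<beta>))"

definition ker_rho ::
    "('e, 'm::euclidean_space) atlas \<Rightarrow> ('b, 'n::euclidean_space) atlas \<Rightarrow> ('e \<Rightarrow> 'b) \<Rightarrow>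
     ('e \<Rightarrow> 'e tvec \<Rightarrow> 'e tvec) \<Rightarrow> ('b, 'e) hform \<Rightarrow> 'e bivec \<Rightarrow> 'e vfield set"
  where "ker_rho M N \<pi> \<gamma> \<sigma> P =
    {Y\<in>A_gamma M N \<pi> \<gamma> P. rho M N \<pi> \<gamma> \<sigma> P Y = casimir_class M N \<pi> \<gamma> P 2 0}"

end

theory Submission
  imports Defs
begin

text \<open>
  An infinitesimal automorphism \<open>Z\<close> of the coupling tensor \<open>Q\<close> has a horizontal and a vertical part.
  Since \<open>Q\<^sup>\<sharp>\<close> maps the annihilator \<open>V\<^sup>0\<close> of the vertical bundle isomorphically onto the horizontal
  bundle, \<open>Z = Y - Q\<^sup>\<sharp>(\<pi>\<^sup>*\<beta>)\<close> for exactly one pair of a vertical field \<open>Y\<close> and a horizontal 1-form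
  \<open>\<beta>\<close> (\<open>inj_on_field_of\<close>, \<open>field_of_surj\<close>). The condition \<open>L\<^sub>Z Q = 0\<close> is tested on a coframe adapted to
  the splitting of the tangent bundle. \<open>V\<^sup>0\<close> is spanned by the forms \<open>\<alpha>\<^sub>u = - \<pi>\<^sup>*\<sigma>(u, \<cdot>)\<close>, for which
  \<open>Q\<^sup>\<sharp>\<alpha>\<^sub>u = hor u\<close>; the annihilator of the horizontal bundle is spanned by the vertical parts \<open>\<nu>\<^sub>f\<close> of
  differentials \<open>df\<close>, for which \<open>Q\<^sup>\<sharp>\<nu>\<^sub>f = P\<^sup>\<sharp>df\<close>. On this coframe

  \<^item> \<open>(L\<^sub>Z Q)(\<alpha>\<^sub>u, \<alpha>\<^sub>v) = - (\<partial>\<beta> + L\<^sub>Y \<sigma>)(u, v)\<close>,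
  \<^item> \<open>(L\<^sub>Z Q)(\<alpha>\<^sub>u, \<nu>\<^sub>f) = - ([hor u, Y] + P\<^sup>\<sharp>d(\<beta>(u))) f\<close>,
  \<^item> \<open>(L\<^sub>Z Q)(\<nu>\<^sub>f, \<nu>\<^sub>g) = (L\<^sub>Y P)(df, dg)\<close>.

  Hence (\<open>field_of_Poiss_iff\<close>) the automorphisms correspond to the pairs \<open>(\<beta>, Y)\<close> in which \<open>Y\<close> is a
  vertical Poisson field of \<open>P\<close>, \<open>\<beta>\<close> is admissible for \<open>Y\<close>, and the cocycle \<open>\<tau>\<close> formed from \<open>\<beta>\<close> and
  \<open>Y\<close> vanishes. Project these pairs to \<open>Y\<close>. The kernel consists of the \<open>\<beta>\<close> with Casimir values and
  \<open>\<partial>\<beta> = 0\<close>, that is of the 1-cocycles (\<open>cocycles_eq\<close>). The image is the kernel of \<open>\<rho>\<close>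
  (\<open>ker_rho_eq\<close>): if the class of \<open>\<tau>\<close> vanishes, then \<open>\<tau> = - \<partial>\<zeta>\<close> for some Casimir-valued \<open>\<zeta>\<close>, and
  replacing \<open>\<beta>\<close> by \<open>\<beta> + \<zeta>\<close> keeps it admissible and makes \<open>\<tau>\<close> zero. A surjective linear map splits,
  which gives the isomorphism (\<open>vs_isomorphic_split\<close>).

  The computation of the three blocks rests on the formula
  \<open>(L\<^sub>Z Q)(\<alpha>, \<beta>) = \<beta>([Z, Q\<^sup>\<sharp>\<alpha>]) - \<alpha>([Z, Q\<^sup>\<sharp>\<beta>]) - Z(Q(\<alpha>, \<beta>))\<close>, which makes sense for all 1-forms without a
  Lie derivative of forms, and on \<open>(L\<^sub>Z Q)(\<mu>, \<nu>) = d\<alpha>(Q\<^sup>\<sharp>\<mu>, Q\<^sup>\<sharp>\<nu>)\<close> for \<open>Z = Q\<^sup>\<sharp>\<alpha>\<close>, which is where the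
  Jacobi identity of \<open>Q\<close> enters (\<open>lie_bivec_form_sharp_form\<close>). Smoothness of horizontal lifts and
  of all forms involved comes from one principle: a \<open>C\<^sup>\<infinity>(B)\<close>-linear map from vector fields on \<open>B\<close> to
  smooth functions on \<open>E\<close> is a smooth 1-form on \<open>E\<close> (\<open>pullback_form_one_form\<close>). It is a consequence of
  the existence of local frames for derivations (\<open>local_frame\<close>), which needs bump functions and
  Hadamard's lemma.
\<close>

section \<open>Functions of class \<open>C\<^sup>k\<close> on open sets of Euclidean spaces\<close>

lemma C_k_on_cong:
  fixes W :: "'a::euclidean_space set" and f g :: "'a \<Rightarrow> 'b::real_normed_vector"
  assumes "open W" "\<And>x. x \<in> W \<Longrightarrow> f x = g x" "C_k_on k W f"
  shows "C_k_on k W g"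
  using assms(2,3)
proof (induction k arbitrary: f g)
  case 0
  then show ?case by (metis C_k_on.simps(1) continuous_on_cong)
next
  case (Suc k)
  have d: "(g has_derivative frechet_derivative f (at x)) (at x)" if "x \<in> W" for x
    using Suc.prems that assms(1)
    by (metis C_k_on.simps(2) frechet_derivative_works has_derivative_transform_within_open)
  have e: "frechet_derivative g (at x) = frechet_derivative f (at x)" if "x \<in> W" for x
    using d[OF that] by (metis frechet_derivative_at)
  show ?case
    using Suc.prems(2) d e
    by (auto simp: differentiable_def intro: Suc.IH[of "\<lambda>x. frechet_derivative f (at x) v" for v])
qed

lemma C_k_on_subset: "C_k_on k W f \<Longrightarrow> W' \<subseteq> W \<Longrightarrow> C_k_on k W' f"
  by (induction k arbitrary: f) (auto intro: continuous_on_subset)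

lemma C_k_on_local:
  fixes f :: "'a::euclidean_space \<Rightarrow> 'b::real_normed_vector"
  assumes "\<And>x. x \<in> W \<Longrightarrow> \<exists>W'. open W' \<and> x \<in> W' \<and> C_k_on k W' f"
  shows "C_k_on k W f"
  using assms
proof (induction k arbitrary: f)
  case 0
  then show ?case
    by (metis C_k_on.simps(1) continuous_on_eq_continuous_at continuous_at_imp_continuous_on)
next
  case (Suc k)
  then show ?case by (auto; meson)
qed

lemma C_k_on_Suc_has_derivative:
  assumes "C_k_on (Suc k) W g" "x \<in> W"
  shows "(g has_derivative frechet_derivative g (at x)) (at x)"
  using assms by (simp add: frechet_derivative_works)

text \<open>
  The way in which smoothness is proved below: exhibit the derivative and show that each
  directional derivative is one degree less smooth.
\<close>

lemma C_k_on_SucI: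
  fixes W :: "'a::euclidean_space set" and g :: "'a \<Rightarrow> 'b::real_normed_vector"
  assumes "open W" "\<And>x. x \<in> W \<Longrightarrow> (g has_derivative g' x) (at x)"
    and "\<And>v. C_k_on k W (\<lambda>x. g' x v)"
  shows "C_k_on (Suc k) W g"
proof -
  have e: "frechet_derivative g (at x) = g' x" if "x \<in> W" for x
    using assms(2)[OF that] by (metis frechet_derivative_at)
  show ?thesis
    using assms(2) e
    by (auto simp: differentiable_def intro: C_k_on_cong[OF assms(1) _ assms(3)])
qed

lemma C_k_on_SucD:
  fixes W :: "'a::euclidean_space set" and g :: "'a \<Rightarrow> 'b::real_normed_vector"
  assumes "C_k_on (Suc k) W g"
  shows "C_k_on k W g"
  using assms
proof (induction k arbitrary: g)
  case 0
  then show ?case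
    by (auto intro: continuous_at_imp_continuous_on differentiable_imp_continuous_within)
qed auto

lemma C_k_on_const: "C_k_on k W (\<lambda>x. c)"
  by (induction k arbitrary: c) (auto simp: frechet_derivative_const)

lemma C_k_on_linear:
  assumes "bounded_linear L"
  shows "C_k_on k W L"
proof (cases k)
  case 0
  then show ?thesis using assms by (simp add: linear_continuous_on)
next
  case (Suc j)
  have "frechet_derivative L (at x) = L" for x
    using assms by (metis bounded_linear_imp_has_derivative frechet_derivative_at)
  then show ?thesis
    using Suc assms by (auto intro: C_k_on_const bounded_linear_imp_differentiable)
qed

lemma C_k_on_add:
  fixes W :: "'a::euclidean_space set" and f g :: "'a \<Rightarrow> 'b::real_normed_vector"
  assumes "open W" "C_k_on k W f" "C_k_on k W g"
  shows "C_k_on k W (\<lambda>x. f x + g x)"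
  using assms(2,3)
proof (induction k arbitrary: f g)
  case 0
  then show ?case by (simp add: continuous_on_add)
next
  case (Suc k)
  show ?case
  proof (rule C_k_on_SucI[OF assms(1)])
    show "((\<lambda>x. f x + g x) has_derivative
        (\<lambda>v. frechet_derivative f (at x) v + frechet_derivative g (at x) v)) (at x)"
      if "x \<in> W" for x
      using Suc.prems that by (intro has_derivative_add C_k_on_Suc_has_derivative)
    show "C_k_on k W (\<lambda>x. frechet_derivative f (at x) v + frechet_derivative g (at x) v)" for v
      using Suc.prems by (intro Suc.IH) auto
  qed
qed

lemma C_k_on_sum:
  fixes W :: "'a::euclidean_space set" and f :: "'i \<Rightarrow> 'a \<Rightarrow> 'b::real_normed_vector"
  assumes "open W" "\<And>i. i \<in> I \<Longrightarrow> C_k_on k W (f i)"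
  shows "C_k_on k W (\<lambda>x. \<Sum>i\<in>I. f i x)"
  using assms(2)
  by (induction I rule: infinite_finite_induct) (auto intro: C_k_on_const C_k_on_add assms(1))

lemma C_k_on_bilinear:
  fixes W :: "'a::euclidean_space set"
    and f :: "'a \<Rightarrow> 'b::real_normed_vector" and g :: "'a \<Rightarrow> 'c::real_normed_vector"
    and B :: "'b \<Rightarrow> 'c \<Rightarrow> 'd::real_normed_vector"
  assumes "open W" "bounded_bilinear B" "C_k_on k W f" "C_k_on k W g"
  shows "C_k_on k W (\<lambda>x. B (f x) (g x))"
  using assms(3,4)
proof (induction k arbitrary: f g)
  case 0
  then show ?case
    using assms(2) by (simp add: bounded_bilinear.continuous_on)
next
  case (Suc k)
  show ?case
  proof (rule C_k_on_SucI[OF assms(1)])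
    show "((\<lambda>x. B (f x) (g x)) has_derivative
        (\<lambda>v. B (f x) (frechet_derivative g (at x) v) + B (frechet_derivative f (at x) v) (g x))) (at x)"
      if "x \<in> W" for x
      using Suc.prems that assms(2)
      by (intro bounded_bilinear.FDERIV C_k_on_Suc_has_derivative)
    show "C_k_on k W (\<lambda>x. B (f x) (frechet_derivative g (at x) v) + B (frechet_derivative f (at x) v) (g x))"
      for v
      using Suc.prems C_k_on_SucD[OF Suc.prems(1)] C_k_on_SucD[OF Suc.prems(2)]
      by (intro C_k_on_add Suc.IH assms(1)) auto
  qed
qed

lemmas C_k_on_mult = C_k_on_bilinear[OF _ bounded_bilinear_mult]
lemmas C_k_on_inner = C_k_on_bilinear[OF _ bounded_bilinear_inner]

lemma linear_eq_sum_Basis: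
  fixes L :: "'a::euclidean_space \<Rightarrow> 'b::real_vector"
  assumes "linear L"
  shows "L w = (\<Sum>b\<in>Basis. (w \<bullet> b) *\<^sub>R L b)"
proof -
  have "L (\<Sum>b\<in>Basis. (w \<bullet> b) *\<^sub>R b) = (\<Sum>b\<in>Basis. (w \<bullet> b) *\<^sub>R L b)"
    using linear_sum[OF assms, of "\<lambda>b. (w \<bullet> b) *\<^sub>R b" Basis]
    by (simp only: linear_scale[OF assms])
  then show ?thesis by (simp only: euclidean_representation)
qed

text \<open>
  The direction in which the outer derivative is taken varies with the point, whereas the inductive
  definition only speaks of fixed directions; it is therefore expanded in the standard basis.
\<close>

lemma C_k_on_compose:
  fixes W :: "'a::euclidean_space set" and W' :: "'b::euclidean_space set"
    and f :: "'a \<Rightarrow> 'b" and g :: "'b \<Rightarrow> 'c::real_normed_vector"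
  assumes "open W" "open W'" "C_k_on k W f" "C_k_on k W' g" "f ` W \<subseteq> W'"
  shows "C_k_on k W (\<lambda>x. g (f x))"
  using assms(3,4)
proof (induction k arbitrary: g)
  case 0
  then show ?case using assms(5) by (simp add: continuous_on_compose2)
next
  case (Suc k)
  show ?case
  proof (rule C_k_on_SucI[OF assms(1)])
    show "((\<lambda>x. g (f x)) has_derivative
        (\<lambda>v. \<Sum>b\<in>Basis. (frechet_derivative f (at x) v \<bullet> b) *\<^sub>R frechet_derivative g (at (f x)) b)) (at x)"
      if "x \<in> W" for x
    proof -
      have df: "(f has_derivative frechet_derivative f (at x)) (at x)"
        and dg: "(g has_derivative frechet_derivative g (at (f x))) (at (f x))"
        using Suc.prems that assms(5) by (auto intro!: C_k_on_Suc_has_derivative)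
      show ?thesis
        using has_derivative_compose[OF df dg]
        by (simp only: linear_eq_sum_Basis[OF has_derivative_linear[OF dg], symmetric])
    qed
    show "C_k_on k W (\<lambda>x. \<Sum>b\<in>Basis. (frechet_derivative f (at x) v \<bullet> b) *\<^sub>R
        frechet_derivative g (at (f x)) b)" for v
      using Suc.prems assms(1) C_k_on_SucD[OF Suc.prems(1)]
      by (intro C_k_on_sum C_k_on_bilinear[OF _ bounded_bilinear_scaleR] C_k_on_inner C_k_on_const
          Suc.IH) auto
  qed
qed

lemma C_k_on_SucI_real:
  fixes g :: "real \<Rightarrow> real"
  assumes "open W" "\<And>x. x \<in> W \<Longrightarrow> (g has_real_derivative g' x) (at x)" "C_k_on k W g'"
  shows "C_k_on (Suc k) W g"
  using assms
  by (intro C_k_on_SucI[where g' = "\<lambda>x v. g' x * v"] C_k_on_mult C_k_on_const)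
    (auto simp: has_field_derivative_def)

lemma C_k_on_inverse: "C_k_on k (- {0}) (inverse :: real \<Rightarrow> real)"
proof (induction k)
  case 0
  then show ?case by (auto intro: continuous_on_inverse continuous_on_id)
next
  case (Suc k)
  have "C_k_on k (- {0}) (\<lambda>x::real. - 1 * (inverse x * inverse x))"
    by (intro C_k_on_mult C_k_on_const Suc) auto
  then show ?case
    by (intro C_k_on_SucI_real[where g' = "\<lambda>x. - 1 * (inverse x * inverse x)"])
      (auto intro!: derivative_eq_intros simp: field_simps)
qed

section \<open>Bump functions\<close>

text \<open>
  The family \<open>exp(- 1/t) / t\<^sup>m\<close> rather than the single function \<open>exp(- 1/t)\<close>: it is closed under
  differentiation up to linear combinations, so that smoothness at 0 is an induction.
\<close>

definition flat :: "nat \<Rightarrow> real \<Rightarrow> real"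
  where "flat m t = (if t > 0 then exp (- (1 / t)) / t ^ m else 0)"

lemma flat_tendsto_0: "(flat m \<longlongrightarrow> 0) (at 0)"
proof -
  have "((\<lambda>x::real. (1 / x) ^ m / exp (1 / x)) \<longlongrightarrow> 0) (at_right 0)"
    using filterlim_compose[OF tendsto_power_div_exp_0 filterlim_inverse_at_top_right]
    by (simp add: inverse_eq_divide)
  moreover have "(1 / x) ^ m / exp (1 / x) = flat m x" if "x > 0" for x :: real
    using that by (simp add: flat_def exp_minus power_one_over inverse_eq_divide)
  ultimately have r: "(flat m \<longlongrightarrow> 0) (at_right 0)"
    by (auto intro: Lim_transform_eventually simp: eventually_at_filter)
  have "(flat m \<longlongrightarrow> 0) (at_left 0)"
    by (rule Lim_transform_eventually[OF tendsto_const])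
      (auto simp: eventually_at_filter flat_def)
  with r show ?thesis by (simp add: filterlim_split_at)
qed

lemma flat_has_derivative:
  "(flat m has_real_derivative flat (m + 2) t - m * flat (m + 1) t) (at t)"
proof -
  consider "t > 0" | "t < 0" | "t = 0" by linarith
  then show ?thesis
  proof cases
    case 1
    have "((\<lambda>t. exp (- (1 / t)) / t ^ m) has_real_derivative
        (exp (- (1 / t)) * (1 / t\<^sup>2) * t ^ m - exp (- (1 / t)) * (real m * t ^ (m - 1))) /
        (t ^ m * t ^ m)) (at t)"
      using 1 by (auto intro!: derivative_eq_intros simp: power2_eq_square)
    also have "(exp (- (1 / t)) * (1 / t\<^sup>2) * t ^ m - exp (- (1 / t)) * (real m * t ^ (m - 1))) /
        (t ^ m * t ^ m) = flat (m + 2) t - m * flat (m + 1) t"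
      using 1 by (cases m) (simp_all add: flat_def divide_simps, simp_all add: algebra_simps power2_eq_square)
    finally have "((\<lambda>t. exp (- (1 / t)) / t ^ m) has_real_derivative flat (m + 2) t - m * flat (m + 1) t) (at t)" .
    then show ?thesis
      by (rule has_field_derivative_transform_within_open[where S = "{0<..}"])
        (use 1 in \<open>auto simp: flat_def\<close>)
  next
    case 2
    have "(flat m has_real_derivative 0) (at t)"
      by (rule has_field_derivative_transform_within_open[where S = "{..<0}" and f = "\<lambda>_. 0"])
        (use 2 in \<open>auto simp: flat_def\<close>)
    with 2 show ?thesis by (simp add: flat_def)
  next
    case 3
    have "((\<lambda>y. (flat m y - flat m 0) / (y - 0)) \<longlongrightarrow> 0) (at 0)"
      by (rule Lim_transform_eventually[OF flat_tendsto_0[of "Suc m"]])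
        (auto simp: eventually_at_filter flat_def)
    with 3 show ?thesis by (simp add: has_field_derivative_iff flat_def)
  qed
qed

lemma C_k_on_flat: "C_k_on k UNIV (flat m)"
proof (induction k arbitrary: m)
  case 0
  then show ?case
    by (auto intro: continuous_at_imp_continuous_on DERIV_isCont flat_has_derivative)
next
  case (Suc k)
  have "C_k_on k UNIV (\<lambda>t. flat (m + 2) t + (- real m) * flat (m + 1) t)"
    by (intro C_k_on_add C_k_on_mult C_k_on_const Suc) auto
  then show ?case
    using flat_has_derivative
    by (intro C_k_on_SucI_real[where g' = "\<lambda>t. flat (m + 2) t + (- real m) * flat (m + 1) t"]) auto
qed

definition bump :: "'a::euclidean_space \<Rightarrow> real \<Rightarrow> 'a \<Rightarrow> real"
  where "bump a r x = flat 0 (r\<^sup>2 - (x - a) \<bullet> (x - a))"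

lemma C_k_on_bump: "C_k_on k W (bump a r)"
proof -
  have eq: "bump a r = (\<lambda>x. flat 0 (r\<^sup>2 + (- 1) * ((x + (- a)) \<bullet> (x + (- a)))))"
    by (auto simp: bump_def)
  have "C_k_on k UNIV (bump a r)"
    unfolding eq
    by (intro C_k_on_compose[OF _ _ _ C_k_on_flat] C_k_on_add C_k_on_mult C_k_on_const C_k_on_inner
        C_k_on_linear[OF bounded_linear_ident]) auto
  then show ?thesis by (rule C_k_on_subset) simp
qed

lemma bump_nonzero_iff:
  assumes "r > 0"
  shows "bump a r x \<noteq> 0 \<longleftrightarrow> x \<in> ball a r"
proof -
  have "bump a r x \<noteq> 0 \<longleftrightarrow> (norm (x - a))\<^sup>2 < r\<^sup>2"
    by (simp add: bump_def flat_def power2_norm_eq_inner)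
  also have "\<dots> \<longleftrightarrow> norm (x - a) < r"
    using assms power2_less_imp_less[of "norm (x - a)" r] power_strict_mono[of "norm (x - a)" r 2]
    by auto
  finally show ?thesis by (simp add: dist_norm norm_minus_commute)
qed

text \<open>
  Cutting off with a bump function extends a function from a neighbourhood of the closed ball to the
  whole space; outside the ball the product vanishes, whatever the values of \<open>G\<close> are there.
\<close>

lemma C_k_on_bump_mult:
  fixes G :: "'a::euclidean_space \<Rightarrow> real"
  assumes "open W" "C_k_on k W G" "cball a r \<subseteq> W" "r > 0"
  shows "C_k_on k UNIV (\<lambda>x. bump a r x * G x)"
proof (rule C_k_on_local)
  fix x :: 'a
  show "\<exists>W'. open W' \<and> x \<in> W' \<and> C_k_on k W' (\<lambda>x. bump a r x * G x)"
  proof (cases "x \<in> W")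
    case True
    then show ?thesis using assms by (blast intro: C_k_on_mult C_k_on_bump)
  next
    case False
    have "bump a r y * G y = 0" if "y \<in> - cball a r" for y
      using that bump_nonzero_iff[OF assms(4), of a y] by auto
    then have "C_k_on k (- cball a r) (\<lambda>x. bump a r x * G x)"
      by (intro C_k_on_cong[OF _ _ C_k_on_const[of _ _ 0]]) auto
    with False assms(3) show ?thesis by blast
  qed
qed

section \<open>Hadamard's lemma\<close>

text \<open>
  The factor \<open>t\<^sup>m\<close> makes the class of these integrals closed under differentiation in \<open>x\<close>: the chain
  rule produces one further factor \<open>t\<close>, and the directional derivative of \<open>g\<close> takes the place of \<open>g\<close>.
\<close>

lemma C_k_on_segment_integral:
  fixes g :: "'a::euclidean_space \<Rightarrow> real"
  assumes W: "open W" "convex W" "a \<in> W" and g: "\<And>k. C_k_on k W g"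
  shows "C_k_on k W (\<lambda>x. integral {0..1} (\<lambda>t. t ^ m * g (a + t *\<^sub>R (x - a))))"
  using g
proof (induction k arbitrary: g m)
  have inW: "a + t *\<^sub>R (x - a) \<in> W" if "x \<in> W" "t \<in> {0..1}" for x t
    using convexD_alt[OF W(2,3) that(1), of t] that(2) by (simp add: algebra_simps)
  have cont: "continuous_on (W \<times> {0..1}) (\<lambda>(x, t). t ^ m * g (a + t *\<^sub>R (x - a)))"
    if "C_k_on 0 W g" for m and g :: "'a \<Rightarrow> real"
  proof -
    have "continuous_on W g" using that by simp
    then have "continuous_on (W \<times> {0..1}) (\<lambda>p. g (a + snd p *\<^sub>R (fst p - a)))"
      by (rule continuous_on_compose2) (auto intro!: continuous_intros inW)
    then show ?thesis
      unfolding split_beta by (intro continuous_on_mult continuous_on_power continuous_on_snd continuous_on_id)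
  qed
  have cont1: "continuous_on {0..1} (\<lambda>t. t ^ m * g (a + t *\<^sub>R (x - a)))"
    if "C_k_on 0 W g" "x \<in> W" for m x and g :: "'a \<Rightarrow> real"
  proof -
    have "continuous_on {0..1} ((\<lambda>(x, t). t ^ m * g (a + t *\<^sub>R (x - a))) \<circ> (\<lambda>t. (x, t)))"
      by (rule continuous_on_compose)
        (auto intro!: continuous_intros continuous_on_subset[OF cont[OF that(1)]] simp: that)
    then show ?thesis by (simp add: o_def)
  qed
  { case 0
    have c: "continuous_on (W \<times> cbox 0 1) (\<lambda>(x, t). t ^ m * g (a + t *\<^sub>R (x - a)))"
      using cont[OF 0[of 0]] by simp
    show ?case
      using integral_continuous_on_param[OF c] by simp
  next
    case (Suc k)
    define D where "D = (\<lambda>x t. Blinfun (\<lambda>v. t ^ Suc m * frechet_derivative g (at (a + t *\<^sub>R (x - a))) v))"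
    have gd: "(g has_derivative frechet_derivative g (at y)) (at y)" if "y \<in> W" for y
      using Suc.prems[of 1] that by (metis C_k_on_Suc_has_derivative One_nat_def)
    have Dbl: "blinfun_apply (D x t) =
        (\<lambda>v. t ^ Suc m * frechet_derivative g (at (a + t *\<^sub>R (x - a))) v)"
      if "x \<in> W" "t \<in> {0..1}" for x t
      unfolding D_def using inW[OF that]
      by (intro bounded_linear_Blinfun_apply bounded_linear_const_mult
          has_derivative_bounded_linear[OF gd])
    have smd: "C_k_on j W (\<lambda>x. frechet_derivative g (at x) v)" for j v
      using Suc.prems[of "Suc j"] by simp
    have Dcont: "continuous_on (W \<times> cbox 0 1) (\<lambda>(x, t). D x t)"
    proof (rule continuous_on_blinfun_componentwise)
      fix i :: 'a
      have "continuous_on (W \<times> {0..1})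
          (\<lambda>(x, t). t ^ Suc m * frechet_derivative g (at (a + t *\<^sub>R (x - a))) i)"
        by (rule cont[OF smd])
      then have "continuous_on (W \<times> cbox 0 1)
          (\<lambda>(x, t). t ^ Suc m * frechet_derivative g (at (a + t *\<^sub>R (x - a))) i)"
        by simp
      then show "continuous_on (W \<times> cbox 0 1) (\<lambda>p. blinfun_apply (case p of (x, t) \<Rightarrow> D x t) i)"
        by (rule continuous_on_eq) (auto simp: Dbl)
    qed
    show ?case
    proof (rule C_k_on_SucI[OF W(1)])
      fix x assume x: "x \<in> W"
      have "((\<lambda>x. integral (cbox 0 1) (\<lambda>t. t ^ m * g (a + t *\<^sub>R (x - a)))) has_derivative
          integral (cbox 0 1) (D x)) (at x within W)"
      proof (rule leibniz_rule[OF _ _ Dcont x W(2)])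
        fix x and t :: real assume xt: "x \<in> W" "t \<in> cbox 0 1"
        have "((\<lambda>x. a + t *\<^sub>R (x - a)) has_derivative (\<lambda>v. t *\<^sub>R v)) (at x)"
          by (rule has_derivative_eq_rhs, (rule derivative_intros)+, simp)
        from has_derivative_compose[OF this gd] xt
        have "((\<lambda>x. g (a + t *\<^sub>R (x - a))) has_derivative
            (\<lambda>v. frechet_derivative g (at (a + t *\<^sub>R (x - a))) (t *\<^sub>R v))) (at x)"
          using inW by simp
        from has_derivative_mult_right[OF this, of "t ^ m"]
        have "((\<lambda>x. t ^ m * g (a + t *\<^sub>R (x - a))) has_derivative blinfun_apply (D x t)) (at x)"
          using xt linear_scale[OF has_derivative_linear[OF gd], of "a + t *\<^sub>R (x - a)" t] inW
          by (simp add: Dbl mult_ac)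
        then show "((\<lambda>x. t ^ m * g (a + t *\<^sub>R (x - a))) has_derivative blinfun_apply (D x t))
            (at x within W)"
          by (rule has_derivative_at_withinI)
      next
        fix x assume "x \<in> W"
        then show "(\<lambda>t. t ^ m * g (a + t *\<^sub>R (x - a))) integrable_on cbox 0 1"
          using cont1[OF Suc.prems[of 0]] by (simp add: integrable_continuous_real)
      qed
      then have L: "((\<lambda>x. integral {0..1} (\<lambda>t. t ^ m * g (a + t *\<^sub>R (x - a)))) has_derivative
          integral (cbox 0 1) (D x)) (at x)"
        by (simp add: at_within_open[OF x W(1)])
      have cx: "continuous_on (cbox 0 1) (D x)"
      proof -
        have "continuous_on (cbox 0 1) ((\<lambda>(x, t). D x t) \<circ> (\<lambda>t. (x, t)))"
          by (rule continuous_on_compose)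
            (auto intro!: continuous_intros continuous_on_subset[OF Dcont] simp: x)
        then show ?thesis by (simp add: o_def)
      qed
      have "blinfun_apply (integral (cbox 0 1) (D x)) v =
          integral {0..1} (\<lambda>t. t ^ Suc m * frechet_derivative g (at (a + t *\<^sub>R (x - a))) v)" for v
      proof -
        have "integral (cbox 0 1) ((\<lambda>B. blinfun_apply B v) \<circ> D x) =
            blinfun_apply (integral (cbox 0 1) (D x)) v"
          by (rule integral_linear[OF integrable_continuous[OF cx] blinfun.bounded_linear_left])
        moreover have "integral (cbox 0 1) ((\<lambda>B. blinfun_apply B v) \<circ> D x) =
          integral {0..1} (\<lambda>t. t ^ Suc m * frechet_derivative g (at (a + t *\<^sub>R (x - a))) v)"
          using x by (auto simp: Dbl intro!: integral_cong)
        ultimately show ?thesis by simp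
      qed
      then show "((\<lambda>x. integral {0..1} (\<lambda>t. t ^ m * g (a + t *\<^sub>R (x - a)))) has_derivative
          (\<lambda>v. integral {0..1} (\<lambda>t. t ^ Suc m * frechet_derivative g (at (a + t *\<^sub>R (x - a))) v)))
          (at x)"
        using L by presburger
    next
      fix v
      show "C_k_on k W
          (\<lambda>x. integral {0..1} (\<lambda>t. t ^ Suc m * frechet_derivative g (at (a + t *\<^sub>R (x - a))) v))"
        using smd by (rule Suc.IH)
    qed
  }
qed

text \<open>
  The fundamental theorem of calculus along the segment from \<open>a\<close> to \<open>x\<close>; the coefficients are the
  integrals of the partial derivatives.
\<close>

lemma hadamard:
  fixes g :: "'a::euclidean_space \<Rightarrow> real"
  assumes W: "open W" "convex W" "a \<in> W" and g: "\<And>k. C_k_on k W g"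
  obtains h where "\<And>b k. C_k_on k W (h b)"
    and "\<And>x. x \<in> W \<Longrightarrow> g x = g a + (\<Sum>b\<in>Basis. h b x * ((x - a) \<bullet> b))"
    and "\<And>b. h b a = frechet_derivative g (at a) b"
proof
  let ?h = "\<lambda>b x. integral {0..1} (\<lambda>t. t ^ 0 * frechet_derivative g (at (a + t *\<^sub>R (x - a))) b)"
  have smd: "C_k_on j W (\<lambda>x. frechet_derivative g (at x) v)" for j v
    using g[of "Suc j"] by simp
  show "C_k_on k W (?h b)" for b k
    by (rule C_k_on_segment_integral[OF W smd])
  show "?h b a = frechet_derivative g (at a) b" for b
    by simp
  fix x assume x: "x \<in> W"
  have inW: "a + t *\<^sub>R (x - a) \<in> W" if "t \<in> {0..1}" for t
    using convexD_alt[OF W(2,3) x, of t] that by (simp add: algebra_simps)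
  have gd: "(g has_derivative frechet_derivative g (at y)) (at y)" if "y \<in> W" for y
    using g[of 1] that by (metis C_k_on_Suc_has_derivative One_nat_def)
  have exp: "frechet_derivative g (at y) w = (\<Sum>b\<in>Basis. frechet_derivative g (at y) b * (w \<bullet> b))"
    if "y \<in> W" for y w
    using linear_eq_sum_Basis[OF has_derivative_linear[OF gd[OF that]], of w]
    by (simp add: mult.commute)
  have int: "(\<lambda>t. frechet_derivative g (at (a + t *\<^sub>R (x - a))) b) integrable_on {0..1}" for b
  proof -
    have "continuous_on W (\<lambda>x. frechet_derivative g (at x) b)"
      using smd[of 0] by simp
    then have "continuous_on {0..1} (\<lambda>t. frechet_derivative g (at (a + t *\<^sub>R (x - a))) b)"
      by (rule continuous_on_compose2) (auto intro!: continuous_intros inW)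
    then show ?thesis by (rule integrable_continuous_real)
  qed
  have "((\<lambda>t. frechet_derivative g (at (a + t *\<^sub>R (x - a))) (x - a)) has_integral
      g (a + 1 *\<^sub>R (x - a)) - g (a + 0 *\<^sub>R (x - a))) {0..1}"
  proof (rule fundamental_theorem_of_calculus)
    fix t :: real assume t: "t \<in> {0..1}"
    have "((\<lambda>t. a + t *\<^sub>R (x - a)) has_derivative (\<lambda>s. s *\<^sub>R (x - a))) (at t)"
      by (rule has_derivative_eq_rhs, (rule derivative_intros)+, simp)
    from has_derivative_compose[OF this gd[OF inW[OF t]]]
    show "((\<lambda>t. g (a + t *\<^sub>R (x - a))) has_vector_derivative
        frechet_derivative g (at (a + t *\<^sub>R (x - a))) (x - a)) (at t within {0..1})"
      using linear_scale[OF has_derivative_linear[OF gd[OF inW[OF t]]]]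
      by (auto simp: has_vector_derivative_def intro: has_derivative_at_withinI)
  qed simp
  then have "g x - g a = integral {0..1} (\<lambda>t. frechet_derivative g (at (a + t *\<^sub>R (x - a))) (x - a))"
    by (simp add: integral_unique)
  also have "\<dots> = integral {0..1} (\<lambda>t. \<Sum>b\<in>Basis. frechet_derivative g (at (a + t *\<^sub>R (x - a))) b * ((x - a) \<bullet> b))"
    using exp inW by (intro integral_cong) blast
  also have "\<dots> = (\<Sum>b\<in>Basis. ?h b x * ((x - a) \<bullet> b))"
    using int by (subst integral_sum) (auto intro!: integrable_on_mult_left)
  finally show "g x = g a + (\<Sum>b\<in>Basis. ?h b x * ((x - a) \<bullet> b))" by simp
qed

section \<open>Smooth functions\<close>

lemma scaleR_fun_apply [simp]: "(c *\<^sub>R f) x = c *\<^sub>R f x"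
  by (simp add: scaleR_fun_def)

lemma sum_fun_apply: "(\<Sum>i\<in>I. f i) x = (\<Sum>i\<in>I. f i x)"
  by (induction I rule: infinite_finite_induct) auto

lemma smooth_onE:
  assumes "smooth_on S f" "x \<in> S"
  obtains W g where "open W" "x \<in> W" "\<And>k. C_k_on k W g" "\<And>y. y \<in> S \<Longrightarrow> y \<in> W \<Longrightarrow> g y = f y"
  using bspec[OF assms(1)[unfolded smooth_on_def] assms(2)]
  by (elim exE conjE) (rule that, assumption, assumption, erule spec, simp)

lemma smooth_on_local:
  assumes "\<And>x. x \<in> S \<Longrightarrow> \<exists>W. open W \<and> x \<in> W \<and> smooth_on (S \<inter> W) f"
  shows "smooth_on S f"
  unfolding smooth_on_def
proof
  fix x assume "x \<in> S"
  with assms obtain W where W: "open W" "x \<in> W" "smooth_on (S \<inter> W) f" by blast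
  have "x \<in> S \<inter> W" using \<open>x \<in> S\<close> W(2) by blast
  from smooth_onE[OF W(3) this] obtain W' g where "open W'" "x \<in> W'" "\<And>k. C_k_on k W' g"
    "\<And>y. y \<in> S \<inter> W \<Longrightarrow> y \<in> W' \<Longrightarrow> g y = f y"
    by metis
  with W show "\<exists>W g. open W \<and> x \<in> W \<and> (\<forall>k. C_k_on k W g) \<and> (\<forall>y\<in>S \<inter> W. g y = f y)"
    by (intro exI[of _ "W' \<inter> W"] exI[of _ g]) (auto intro: C_k_on_subset)
qed

lemma smooth_on_cong: "smooth_on S f \<Longrightarrow> (\<And>x. x \<in> S \<Longrightarrow> f x = g x) \<Longrightarrow> smooth_on S g"
  unfolding smooth_on_def by fastforce

lemma smooth_on_subset:
  assumes "smooth_on S f" "T \<subseteq> S"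
  shows "smooth_on T f"
  unfolding smooth_on_def
proof
  fix x assume "x \<in> T"
  then have "x \<in> S" using assms(2) by blast
  from smooth_onE[OF assms(1) this] obtain W g where "open W" "x \<in> W" "\<And>k. C_k_on k W g"
    "\<And>y. y \<in> S \<Longrightarrow> y \<in> W \<Longrightarrow> g y = f y"
    by metis
  then show "\<exists>W g. open W \<and> x \<in> W \<and> (\<forall>k. C_k_on k W g) \<and> (\<forall>y\<in>T \<inter> W. g y = f y)"
    using assms(2) by (intro exI[of _ W] exI[of _ g]) auto
qed

lemma smooth_on_if_C_k_on:
  assumes "open W" "\<And>k. C_k_on k W f" "S \<subseteq> W"
  shows "smooth_on S f"
  unfolding smooth_on_def using assms by (intro ballI exI[of _ W] exI[of _ f]) auto

lemma C_k_on_if_smooth_on: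
  fixes f :: "'a::euclidean_space \<Rightarrow> 'b::real_normed_vector"
  assumes "open S" "smooth_on S f"
  shows "C_k_on k S f"
proof (rule C_k_on_local)
  fix x assume "x \<in> S"
  from smooth_onE[OF assms(2) this] obtain W g where W: "open W" "x \<in> W" "\<And>k. C_k_on k W g"
    "\<And>y. y \<in> S \<Longrightarrow> y \<in> W \<Longrightarrow> g y = f y"
    by metis
  have "C_k_on k (S \<inter> W) f"
    by (rule C_k_on_cong[of _ g]) (use W assms(1) in \<open>auto intro: C_k_on_subset\<close>)
  with W assms(1) \<open>x \<in> S\<close> show "\<exists>W'. open W' \<and> x \<in> W' \<and> C_k_on k W' f"
    by (intro exI[of _ "S \<inter> W"]) auto
qed

lemma smooth_on_compose:
  fixes f :: "'a::euclidean_space \<Rightarrow> 'b::euclidean_space" and g :: "'b \<Rightarrow> 'c::real_normed_vector"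
  assumes "smooth_on S f" "smooth_on T g" "f ` S \<subseteq> T"
  shows "smooth_on S (\<lambda>x. g (f x))"
  unfolding smooth_on_def
proof
  fix x assume x: "x \<in> S"
  obtain W F where F: "open W" "x \<in> W" "\<And>k. C_k_on k W F" "\<And>y. y \<in> S \<Longrightarrow> y \<in> W \<Longrightarrow> F y = f y"
    using smooth_onE[OF assms(1) x] by metis
  obtain W' G where G: "open W'" "f x \<in> W'" "\<And>k. C_k_on k W' G"
    "\<And>y. y \<in> T \<Longrightarrow> y \<in> W' \<Longrightarrow> G y = g y"
    using smooth_onE[OF assms(2), of "f x"] assms(3) x by (metis image_subset_iff)
  let ?W = "W \<inter> F -` W'"
  have "continuous_on W F" using F(3)[of 0] by simp
  then have o: "open ?W" using F(1) G(1) by (simp add: continuous_open_preimage Int_commute)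
  have "C_k_on k ?W (\<lambda>y. G (F y))" for k
    by (rule C_k_on_compose[OF o G(1) C_k_on_subset[OF F(3)] G(3)]) auto
  moreover have "G (F y) = g (f y)" if "y \<in> S \<inter> ?W" for y
    using that F(4) G(4) assms(3) by auto
  ultimately show "\<exists>W h. open W \<and> x \<in> W \<and> (\<forall>k. C_k_on k W h) \<and> (\<forall>y\<in>S \<inter> W. h y = g (f y))"
    using o F(2,4) x G(2) by (intro exI[of _ ?W] exI[of _ "\<lambda>y. G (F y)"]) auto
qed

lemma smooth_on_combine:
  fixes f :: "'a::euclidean_space \<Rightarrow> 'b::real_normed_vector" and g :: "'a \<Rightarrow> 'c::real_normed_vector"
    and h :: "'b \<Rightarrow> 'c \<Rightarrow> 'd::real_normed_vector"
  assumes "\<And>W F G k. open W \<Longrightarrow> C_k_on k W F \<Longrightarrow> C_k_on k W G \<Longrightarrow> C_k_on k (W :: 'a set) (\<lambda>x. h (F x) (G x))"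
    and "smooth_on S f" "smooth_on S g"
  shows "smooth_on S (\<lambda>x. h (f x) (g x))"
  unfolding smooth_on_def
proof
  fix x assume x: "x \<in> S"
  obtain W F where F: "open W" "x \<in> W" "\<And>k. C_k_on k W F" "\<And>y. y \<in> S \<Longrightarrow> y \<in> W \<Longrightarrow> F y = f y"
    using smooth_onE[OF assms(2) x] by metis
  obtain W' G where G: "open W'" "x \<in> W'" "\<And>k. C_k_on k W' G" "\<And>y. y \<in> S \<Longrightarrow> y \<in> W' \<Longrightarrow> G y = g y"
    using smooth_onE[OF assms(3) x] by metis
  have o: "open (W \<inter> W')" using F(1) G(1) by auto
  have "C_k_on k (W \<inter> W') (\<lambda>x. h (F x) (G x))" for k
    by (rule assms(1)[OF o C_k_on_subset[OF F(3)] C_k_on_subset[OF G(3)]]) auto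
  then show "\<exists>W k. open W \<and> x \<in> W \<and> (\<forall>j. C_k_on j W k) \<and> (\<forall>y\<in>S \<inter> W. k y = h (f y) (g y))"
    using o F(2,4) G(2,4)
    by (intro exI[of _ "W \<inter> W'"] exI[of _ "\<lambda>x. h (F x) (G x)"]) auto
qed

lemma Cinf_iff: "f \<in> Cinf M \<longleftrightarrow> (\<forall>(U, \<phi>)\<in>M. smooth_on (\<phi> ` U) (\<lambda>y. f (inv_into U \<phi> y)))"
  by (simp add: Cinf_def o_def)

lemma Cinf_const [simp]: "(\<lambda>_. c) \<in> Cinf M"
  by (auto simp: Cinf_iff intro: smooth_on_if_C_k_on[OF open_UNIV] C_k_on_const)

lemma Cinf_add [simp]: "f \<in> Cinf M \<Longrightarrow> g \<in> Cinf M \<Longrightarrow> f + g \<in> Cinf M"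
  unfolding Cinf_iff plus_fun_def by (fast intro: smooth_on_combine[OF C_k_on_add])

lemma Cinf_mult [simp]: "f \<in> Cinf M \<Longrightarrow> g \<in> Cinf M \<Longrightarrow> f * g \<in> Cinf M"
  unfolding Cinf_iff times_fun_def by (fast intro: smooth_on_combine[OF C_k_on_mult])

lemma Cinf_zero [simp]: "0 \<in> Cinf M"
  unfolding zero_fun_def by simp

lemma Cinf_scaleR [simp]:
  assumes "f \<in> Cinf M" shows "c *\<^sub>R f \<in> Cinf M"
proof -
  have "(\<lambda>_. c) * f \<in> Cinf M" using assms by (intro Cinf_mult Cinf_const)
  then show ?thesis by (simp add: times_fun_def scaleR_fun_def)
qed

lemma Cinf_uminus [simp]: "f \<in> Cinf M \<Longrightarrow> - f \<in> Cinf M"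
  using Cinf_scaleR[of f M "-1"] by simp

lemma Cinf_diff [simp]: "f \<in> Cinf M \<Longrightarrow> g \<in> Cinf M \<Longrightarrow> f - g \<in> Cinf M"
  using Cinf_add[of f M "- g"] by simp

lemma Cinf_sum: "(\<And>i. i \<in> I \<Longrightarrow> f i \<in> Cinf M) \<Longrightarrow> (\<Sum>i\<in>I. f i) \<in> Cinf M"
  by (induction I rule: infinite_finite_induct) auto

text \<open>
  A division by \<open>\<kappa>\<close> near \<open>p\<close>. In this form, no chart has to be mentioned when smoothness is checked
  with a frame that only spans where \<open>\<kappa>\<close> does not vanish.
\<close>

lemma Cinf_local:
  assumes "\<And>p. \<exists>\<kappa>\<in>Cinf M. \<kappa> p \<noteq> 0 \<and> \<kappa> * f \<in> Cinf M"
  shows "f \<in> Cinf M"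
  unfolding Cinf_iff
proof safe
  fix U \<phi> assume c: "(U, \<phi>) \<in> M"
  show "smooth_on (\<phi> ` U) (\<lambda>y. f (inv_into U \<phi> y))"
  proof (rule smooth_on_local)
    fix y assume y: "y \<in> \<phi> ` U"
    obtain \<kappa> where \<kappa>: "\<kappa> \<in> Cinf M" "\<kappa> (inv_into U \<phi> y) \<noteq> 0" "\<kappa> * f \<in> Cinf M"
      using assms by blast
    have s1: "smooth_on (\<phi> ` U) (\<lambda>y. \<kappa> (inv_into U \<phi> y))"
      and s2: "smooth_on (\<phi> ` U) (\<lambda>y. \<kappa> (inv_into U \<phi> y) * f (inv_into U \<phi> y))"
      using \<kappa>(1,3) c by (auto simp: Cinf_iff)
    obtain W g where W: "open W" "y \<in> W" "\<And>k. C_k_on k W g"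
      "\<And>z. z \<in> \<phi> ` U \<Longrightarrow> z \<in> W \<Longrightarrow> g z = \<kappa> (inv_into U \<phi> z)"
      using smooth_onE[OF s1 y] by metis
    let ?W = "W \<inter> g -` (- {0})"
    have "continuous_on W g" using W(3)[of 0] by simp
    then have o: "open ?W" using W(1) by (intro continuous_open_preimage) auto
    have nz: "\<kappa> (inv_into U \<phi> z) \<noteq> 0" if "z \<in> \<phi> ` U \<inter> ?W" for z
      using that W(4) by auto
    have inv: "smooth_on (- {0}) (inverse :: real \<Rightarrow> real)"
      by (rule smooth_on_if_C_k_on[OF _ C_k_on_inverse]) auto
    have s1': "smooth_on (\<phi> ` U \<inter> ?W) (\<lambda>y. \<kappa> (inv_into U \<phi> y))"
      by (rule smooth_on_subset[OF s1]) blast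
    have "smooth_on (\<phi> ` U \<inter> ?W) (\<lambda>y. inverse (\<kappa> (inv_into U \<phi> y)))"
      by (rule smooth_on_compose[OF s1' inv], rule image_subsetI, drule nz, simp)
    from smooth_on_combine[OF C_k_on_mult this smooth_on_subset[OF s2]]
    have "smooth_on (\<phi> ` U \<inter> ?W)
        (\<lambda>y. inverse (\<kappa> (inv_into U \<phi> y)) * (\<kappa> (inv_into U \<phi> y) * f (inv_into U \<phi> y)))"
      by auto
    then have "smooth_on (\<phi> ` U \<inter> ?W) (\<lambda>y. f (inv_into U \<phi> y))"
      by (rule smooth_on_cong) (simp add: nz)
    moreover have "y \<in> ?W" using W(2,4) y \<kappa>(2) by simp
    ultimately show "\<exists>W. open W \<and> y \<in> W \<and> smooth_on (\<phi> ` U \<inter> W) (\<lambda>y. f (inv_into U \<phi> y))"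
      using o by blast
  qed
qed

lemma Cinf_pullback:
  assumes M: "smooth_manifold M" and N: "smooth_manifold N" and \<pi>: "smooth_map M N \<pi>"
    and g: "g \<in> Cinf N"
  shows "g \<circ> \<pi> \<in> Cinf M"
  unfolding Cinf_iff
proof safe
  fix U \<phi> assume c: "(U, \<phi>) \<in> M"
  have hom: "homeomorphism U (\<phi> ` U) \<phi> (inv_into U \<phi>)"
    using M c unfolding smooth_manifold_def by blast
  show "smooth_on (\<phi> ` U) (\<lambda>y. (g \<circ> \<pi>) (inv_into U \<phi> y))"
  proof (rule smooth_on_local)
    fix y assume y: "y \<in> \<phi> ` U"
    define p where "p = inv_into U \<phi> y"
    have p: "p \<in> U" "\<phi> p = y" using y by (auto simp: p_def inv_into_into f_inv_into_f)
    have "\<pi> p \<in> \<Union> (fst ` N)" using N unfolding smooth_manifold_def by blast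
    then obtain W \<psi> where d: "(W, \<psi>) \<in> N" "\<pi> p \<in> W" by force
    have homN: "homeomorphism W (\<psi> ` W) \<psi> (inv_into W \<psi>)" and "open W"
      using N d unfolding smooth_manifold_def by blast+
    then have "open (\<pi> -` W)" using \<pi> unfolding smooth_map_def by (simp add: open_vimage)
    then have "openin (top_of_set U) (U \<inter> \<pi> -` W)" by auto
    then have "openin (top_of_set (\<phi> ` U)) (\<phi> ` (U \<inter> \<pi> -` W))"
      using homeomorphism_imp_open_map[OF hom] by blast
    then obtain T where T: "open T" "\<phi> ` (U \<inter> \<pi> -` W) = \<phi> ` U \<inter> T"
      unfolding openin_open by blast
    have s: "smooth_on (\<phi> ` U \<inter> T) (\<lambda>y. \<psi> (\<pi> (inv_into U \<phi> y)))"
      using \<pi> c d(1) T(2) unfolding smooth_map_def by (fastforce simp: o_def)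
    have inW: "\<pi> (inv_into U \<phi> z) \<in> W" if "z \<in> \<phi> ` U \<inter> T" for z
    proof -
      from that have "z \<in> \<phi> ` (U \<inter> \<pi> -` W)" unfolding T(2) .
      then obtain q where "q \<in> U" "\<pi> q \<in> W" "z = \<phi> q" by auto
      then show ?thesis using homeomorphism_apply1[OF hom] by simp
    qed
    have "smooth_on (\<psi> ` W) (\<lambda>z. g (inv_into W \<psi> z))" using g d(1) by (auto simp: Cinf_iff)
    from smooth_on_compose[OF s this]
    have "smooth_on (\<phi> ` U \<inter> T) (\<lambda>y. g (inv_into W \<psi> (\<psi> (\<pi> (inv_into U \<phi> y)))))"
      using inW by auto
    then have "smooth_on (\<phi> ` U \<inter> T) (\<lambda>y. (g \<circ> \<pi>) (inv_into U \<phi> y))"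
      by (rule smooth_on_cong) (use inW homeomorphism_apply1[OF homN] in simp)
    moreover have "y \<in> T" using T(2) p d(2) by blast
    ultimately show "\<exists>W. open W \<and> y \<in> W \<and> smooth_on (\<phi> ` U \<inter> W) (\<lambda>y. (g \<circ> \<pi>) (inv_into U \<phi> y))"
      using T(1) by blast
  qed
qed

text \<open>
  The only place where the Hausdorff property is used: the compact set carrying \<open>B\<close> is closed in the
  whole manifold, so that the extension by zero is smooth also at the boundary of the chart domain.
\<close>

lemma Cinf_extend:
  fixes M :: "('e::{t2_space, second_countable_topology}, 'm::euclidean_space) atlas"
  assumes M: "smooth_manifold M" and c: "(U, \<phi>) \<in> M"
    and K: "compact K" "K \<subseteq> \<phi> ` U"
    and B: "\<And>k. C_k_on k UNIV B" "\<And>y. y \<in> \<phi> ` U \<Longrightarrow> y \<notin> K \<Longrightarrow> B y = (0::real)"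
  shows "(\<lambda>q. if q \<in> U then B (\<phi> q) else 0) \<in> Cinf M"
  unfolding Cinf_iff
proof safe
  let ?f = "\<lambda>q. if q \<in> U then B (\<phi> q) else 0"
  have hom: "homeomorphism U (\<phi> ` U) \<phi> (inv_into U \<phi>)" and oU: "open U"
    using M c unfolding smooth_manifold_def by blast+
  let ?K = "inv_into U \<phi> ` K"
  have "compact ?K"
    using K hom by (meson compact_continuous_image continuous_on_subset homeomorphism_cont2)
  then have oK: "open (- ?K)" by (simp add: compact_imp_closed open_Compl)
  have f0: "?f q = 0" if "q \<notin> ?K" for q
  proof (cases "q \<in> U")
    case True
    with that have "\<phi> q \<notin> K" using homeomorphism_apply1[OF hom True] by force
    then show ?thesis using B(2) True by auto
  qed simp
  fix W \<psi> assume d: "(W, \<psi>) \<in> M"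
  have homW: "homeomorphism W (\<psi> ` W) \<psi> (inv_into W \<psi>)"
    using M d unfolding smooth_manifold_def by blast
  have opn: "\<exists>T. open T \<and> \<psi> ` (W \<inter> A) = \<psi> ` W \<inter> T" if "open A" for A
  proof -
    have "openin (top_of_set W) (W \<inter> A)" using that by auto
    then have "openin (top_of_set (\<psi> ` W)) (\<psi> ` (W \<inter> A))"
      using homeomorphism_imp_open_map[OF homW] by blast
    then show ?thesis unfolding openin_open by blast
  qed
  have invW: "inv_into W \<psi> z \<in> A" if "z \<in> \<psi> ` (W \<inter> A)" for z A
    using that homeomorphism_apply1[OF homW] by auto
  show "smooth_on (\<psi> ` W) (\<lambda>y. ?f (inv_into W \<psi> y))"
  proof (rule smooth_on_local)
    fix y assume "y \<in> \<psi> ` W"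
    then obtain q where q: "q \<in> W" "y = \<psi> q" by blast
    show "\<exists>T. open T \<and> y \<in> T \<and> smooth_on (\<psi> ` W \<inter> T) (\<lambda>y. ?f (inv_into W \<psi> y))"
    proof (cases "q \<in> U")
      case True
      obtain T where T: "open T" "\<psi> ` (W \<inter> U) = \<psi> ` W \<inter> T" using opn[OF oU] by metis
      have s: "smooth_on (\<psi> ` (W \<inter> U)) (\<lambda>y. \<phi> (inv_into W \<psi> y))"
      proof -
        have "\<forall>(U, \<phi>)\<in>M. \<forall>(W, \<psi>)\<in>M. smooth_on (\<phi> ` (U \<inter> W)) (\<psi> \<circ> inv_into U \<phi>)"
          using M unfolding smooth_manifold_def by (elim conjE)
        from bspec[OF bspec[OF this d, unfolded split_conv] c] show ?thesis by (simp add: o_def)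
      qed
      have "smooth_on UNIV B" by (rule smooth_on_if_C_k_on[OF _ B(1)]) auto
      from smooth_on_compose[OF s this]
      have "smooth_on (\<psi> ` (W \<inter> U)) (\<lambda>y. B (\<phi> (inv_into W \<psi> y)))" by simp
      then have "smooth_on (\<psi> ` (W \<inter> U)) (\<lambda>y. ?f (inv_into W \<psi> y))"
        by (rule smooth_on_cong) (use invW in auto)
      then show ?thesis using T q True by (intro exI[of _ T]) auto
    next
      case False
      then have "q \<in> - ?K" using K(2) by (auto simp: inv_into_into)
      obtain T where T: "open T" "\<psi> ` (W \<inter> - ?K) = \<psi> ` W \<inter> T" using opn[OF oK] by metis
      have "smooth_on (\<psi> ` (W \<inter> - ?K)) (\<lambda>_. 0 :: real)"
        by (rule smooth_on_if_C_k_on[OF open_UNIV C_k_on_const]) auto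
      then have "smooth_on (\<psi> ` (W \<inter> - ?K)) (\<lambda>y. ?f (inv_into W \<psi> y))"
        by (rule smooth_on_cong) (use invW[of _ "- ?K"] f0 in \<open>metis ComplD\<close>)
      then show ?thesis using T q \<open>q \<in> - ?K\<close> by (intro exI[of _ T]) auto
    qed
  qed
qed

section \<open>Tangent vectors\<close>

lemma tangent_add: "v \<in> tangent_space M p \<Longrightarrow> f \<in> Cinf M \<Longrightarrow> g \<in> Cinf M \<Longrightarrow> v (f + g) = v f + v g"
  and tangent_scaleR: "v \<in> tangent_space M p \<Longrightarrow> f \<in> Cinf M \<Longrightarrow> v (c *\<^sub>R f) = c * v f"
  and tangent_mult: "v \<in> tangent_space M p \<Longrightarrow> f \<in> Cinf M \<Longrightarrow> g \<in> Cinf M \<Longrightarrow>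
        v (f * g) = f p * v g + g p * v f"
  and tangent_notin: "v \<in> tangent_space M p \<Longrightarrow> f \<notin> Cinf M \<Longrightarrow> v f = 0"
  by (simp_all add: tangent_space_def)

lemma tangent_zero: "v \<in> tangent_space M p \<Longrightarrow> v 0 = 0"
  using tangent_scaleR[of v M p 0 0] by simp

lemma tangent_uminus: "v \<in> tangent_space M p \<Longrightarrow> f \<in> Cinf M \<Longrightarrow> v (- f) = - v f"
  using tangent_scaleR[of v M p f "-1"] by simp

lemma tangent_diff: "v \<in> tangent_space M p \<Longrightarrow> f \<in> Cinf M \<Longrightarrow> g \<in> Cinf M \<Longrightarrow> v (f - g) = v f - v g"
  using tangent_add[of v M p f "- g"] by (simp add: tangent_uminus)

lemma tangent_sum:
  "v \<in> tangent_space M p \<Longrightarrow> (\<And>i. i \<in> I \<Longrightarrow> f i \<in> Cinf M) \<Longrightarrow> v (\<Sum>i\<in>I. f i) = (\<Sum>i\<in>I. v (f i))"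
  by (induction I rule: infinite_finite_induct) (auto simp: tangent_zero tangent_add Cinf_sum)

lemma tangent_const:
  assumes "v \<in> tangent_space M p" shows "v (\<lambda>_. c) = 0"
proof -
  have "v ((\<lambda>_. 1) * (\<lambda>_. 1)) = 2 * v (\<lambda>_. 1)"
    using assms by (subst tangent_mult[OF assms]) auto
  then have "v (\<lambda>_. 1) = 0" by (simp add: times_fun_def)
  then show ?thesis
    using tangent_scaleR[OF assms, of "\<lambda>_. 1" c] by (simp add: scaleR_fun_def)
qed

lemma subspace_tangent_space: "subspace (tangent_space M p)"
  by (auto simp: subspace_def tangent_space_def algebra_simps)

lemma vfields_tangent: "X \<in> vfields M \<Longrightarrow> X p \<in> tangent_space M p"
  and vfields_Cinf: "X \<in> vfields M \<Longrightarrow> f \<in> Cinf M \<Longrightarrow> lie_fun X f \<in> Cinf M"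
  by (simp_all add: vfields_def)

lemma subspace_vfields: "subspace (vfields M)"
proof (rule subspaceI)
  show "0 \<in> vfields M"
    by (auto simp: vfields_def lie_fun_def subspace_0[OF subspace_tangent_space])
next
  fix X Y assume XY: "X \<in> vfields M" "Y \<in> vfields M"
  have "lie_fun (X + Y) f = lie_fun X f + lie_fun Y f" for f
    by (auto simp: lie_fun_def)
  then show "X + Y \<in> vfields M"
    using XY by (auto simp: vfields_def intro: subspace_add[OF subspace_tangent_space])
next
  fix c X assume X: "X \<in> vfields M"
  have "lie_fun (c *\<^sub>R X) f = c *\<^sub>R lie_fun X f" for f
    by (auto simp: lie_fun_def)
  then show "c *\<^sub>R X \<in> vfields M"
    using X by (auto simp: vfields_def intro: subspace_scale[OF subspace_tangent_space])
qed

lemma fun_times_vfield_vfields: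
  assumes "f \<in> Cinf M" "X \<in> vfields M" shows "fun_times_vfield f X \<in> vfields M"
proof -
  have "lie_fun (fun_times_vfield f X) g = f * lie_fun X g" for g
    by (auto simp: lie_fun_def fun_times_vfield_def)
  then show ?thesis
    using assms by (auto simp: vfields_def fun_times_vfield_def intro: subspace_scale[OF subspace_tangent_space])
qed

section \<open>Local frames\<close>

lemma exists_linear_projection:
  fixes V :: "'a::euclidean_space set"
  assumes "subspace V"
  obtains pr :: "'a \<Rightarrow> 'a" where "linear pr" "\<And>x. pr x \<in> V" "\<And>x. x \<in> V \<Longrightarrow> pr x = x"
proof -
  obtain B where B: "B \<subseteq> V" "independent B" "V \<subseteq> span B" by (rule basis_exists[of V]) blast
  have sB: "span B = V" using B assms by (simp add: span_minimal subset_antisym)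
  obtain g where g: "linear g" "\<forall>x\<in>B. g x = id x" "range g = span (id ` B)"
    using linear_independent_extend_subspace[OF B(2), of id] by blast
  have "g x = x" if "x \<in> V" for x
    using linear_eq_on[OF g(1) linear_id, of x B] that g(2) sB by auto
  with g sB show ?thesis by (intro that[of g]) auto
qed

text \<open>
  Near \<open>p\<close>, every derivation is a combination of coordinate derivatives. Everything is stated with
  globally defined objects, and \<open>\<kappa>\<close> measures where the frame is valid. The coordinates of a chart are
  made global by a bump function \<open>b\<close>. They are \<open>b\<close> and \<open>b c\<^sub>i\<close> for the chart coordinates \<open>c\<^sub>i\<close>; since
  \<open>v(b c\<^sub>i) = b v(c\<^sub>i) + c\<^sub>i v(b)\<close>, subtracting \<open>c\<^sub>i v(b)\<close> recovers \<open>b v(c\<^sub>i)\<close>, so that a bump function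
  without a plateau suffices.
  
  The charts take values in a linear subspace. Composing with a linear projection onto this subspace
  turns functions in the chart into functions on an open set of the full Euclidean space, where all
  standard basis vectors may be used as directions. They are linearly dependent on the manifold, but
  the expansion holds all the same.
\<close>

lemma local_frame:
  fixes M :: "('e::{t2_space, second_countable_topology}, 'm::euclidean_space) atlas"
  assumes M: "smooth_manifold M"
  obtains I :: "'m set" and \<kappa> x E where
    "finite I" "\<kappa> \<in> Cinf M" "\<kappa> p \<noteq> 0"
    "\<And>i. i \<in> I \<Longrightarrow> x i \<in> Cinf M" "\<And>i. i \<in> I \<Longrightarrow> E i \<in> vfields M"
    "\<And>q v. v \<in> tangent_space M q \<Longrightarrow> \<kappa> q *\<^sub>R v = (\<Sum>i\<in>I. v (x i) *\<^sub>R E i q)"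
proof -
  have "p \<in> \<Union> (fst ` M)" using M unfolding smooth_manifold_def by blast
  then obtain U \<phi> where c: "(U, \<phi>) \<in> M" "p \<in> U" by force
  obtain V where V: "subspace V" "openin (top_of_set V) (\<phi> ` U)"
    using M c(1) unfolding smooth_manifold_def by blast
  have hom: "homeomorphism U (\<phi> ` U) \<phi> (inv_into U \<phi>)"
    using M c unfolding smooth_manifold_def by blast
  have inv: "inv_into U \<phi> (\<phi> q) = q" if "q \<in> U" for q
    using homeomorphism_apply1[OF hom that] .
  obtain pr :: "'m \<Rightarrow> 'm" where pr: "linear pr" "\<And>y. pr y \<in> V" "\<And>y. y \<in> V \<Longrightarrow> pr y = y"
    using exists_linear_projection[OF V(1)] by blast
  obtain T where T: "open T" "\<phi> ` U = V \<inter> T" using V(2) unfolding openin_open by blast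
  \<comment> \<open>the domain in the full Euclidean space on which functions in the chart live\<close>
  define Om where "Om = pr -` T"
  have "continuous_on UNIV pr" using pr(1) by (simp add: linear_continuous_on linear_conv_bounded_linear)
  then have oO: "open Om" using T(1) by (simp add: Om_def open_vimage)
  have prO: "pr y \<in> \<phi> ` U" if "y \<in> Om" for y using that pr(2) T(2) by (auto simp: Om_def)
  have UO: "\<phi> q \<in> Om" "pr (\<phi> q) = \<phi> q" if "q \<in> U" for q
    using that T(2) pr(3) by (auto simp: Om_def)
  define ext :: "('m \<Rightarrow> real) \<Rightarrow> 'e \<Rightarrow> real" where "ext = (\<lambda>B q. if q \<in> U then B (\<phi> q) else 0)"
  \<comment> \<open>a function read in the chart, and its partial derivatives\<close>
  define F :: "('e \<Rightarrow> real) \<Rightarrow> 'm \<Rightarrow> real" where "F = (\<lambda>f y. f (inv_into U \<phi> (pr y)))"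
  define dif where "dif = (\<lambda>b f y. frechet_derivative (F f) (at y) b)"
  have Fs: "C_k_on k Om (F f)" if "f \<in> Cinf M" for f k
  proof -
    have s: "smooth_on (\<phi> ` U) (\<lambda>y. f (inv_into U \<phi> y))" using that c by (auto simp: Cinf_iff)
    have "smooth_on Om pr"
      using C_k_on_linear pr(1) by (intro smooth_on_if_C_k_on[OF oO]) (auto simp: linear_conv_bounded_linear)
    from smooth_on_compose[OF this s] prO show ?thesis
      unfolding F_def by (intro C_k_on_if_smooth_on[OF oO]) auto
  qed
  have Fd: "(F f has_derivative (\<lambda>b. dif b f y)) (at y)" if "f \<in> Cinf M" "y \<in> Om" for f y
    using C_k_on_Suc_has_derivative[of 0 Om "F f" y] Fs[OF that(1), of "Suc 0"] that(2)
    by (simp add: dif_def)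
  have difs: "C_k_on k Om (dif b f)" if "f \<in> Cinf M" for b f k
    using Fs[OF that, of "Suc k"] by (simp add: dif_def)
  have dif_eq: "dif b f y = D b" if "(F f has_derivative D) (at y)" for b f y D
    using frechet_derivative_at[OF that] by (simp add: dif_def)
  have dif_add: "dif b (f + g) y = dif b f y + dif b g y"
    if "f \<in> Cinf M" "g \<in> Cinf M" "y \<in> Om" for b f g y
  proof -
    have "F (f + g) = (\<lambda>y. F f y + F g y)" by (auto simp: F_def)
    then have "(F (f + g) has_derivative (\<lambda>b. dif b f y + dif b g y)) (at y)"
      using has_derivative_add[OF Fd[OF that(1,3)] Fd[OF that(2,3)]] by simp
    then show ?thesis by (rule dif_eq)
  qed
  have dif_scale: "dif b (a *\<^sub>R f) y = a * dif b f y"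
    if "f \<in> Cinf M" "y \<in> Om" for a b f y
  proof -
    have "F (a *\<^sub>R f) = (\<lambda>y. a * F f y)" by (auto simp: F_def)
    then have "(F (a *\<^sub>R f) has_derivative (\<lambda>b. a * dif b f y)) (at y)"
      using has_derivative_mult_right[OF Fd[OF that]] by simp
    then show ?thesis by (rule dif_eq)
  qed
  have dif_mult: "dif b (f * g) y = F f y * dif b g y + F g y * dif b f y"
    if "f \<in> Cinf M" "g \<in> Cinf M" "y \<in> Om" for b f g y
  proof -
    have "F (f * g) = (\<lambda>y. F f y * F g y)" by (auto simp: F_def)
    then have "(F (f * g) has_derivative (\<lambda>b. F f y * dif b g y + F g y * dif b f y)) (at y)"
      using has_derivative_mult[OF Fd[OF that(1,3)] Fd[OF that(2,3)]]
      by (simp add: mult.commute)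
    then show ?thesis by (rule dif_eq)
  qed
  have FU: "F f (\<phi> q) = f q" if "q \<in> U" for f q using that UO inv by (simp add: F_def)
  have extC: "ext B \<in> Cinf M"
    if "\<And>k. C_k_on k UNIV B" "cball a r \<subseteq> Om" "\<And>y. y \<notin> cball a r \<Longrightarrow> B y = 0" for B a r
  proof -
    have "compact (cball a r \<inter> V)" by (simp add: V(1) closed_subspace compact_Int_closed)
    moreover have "cball a r \<inter> V \<subseteq> \<phi> ` U" using that(2) T(2) pr(3) by (force simp: Om_def)
    moreover have "B y = 0" if "y \<in> \<phi> ` U" "y \<notin> cball a r \<inter> V" for y
      using that T(2) by (intro \<open>\<And>y. y \<notin> cball a r \<Longrightarrow> B y = 0\<close>) blast
    ultimately show ?thesis
      unfolding ext_def using that(1) by (intro Cinf_extend[OF M c(1)])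
  qed
  have bump0: "bump a r y = 0" if "r > 0" "y \<notin> cball a r" for a r and y :: 'm
    using bump_nonzero_iff[OF that(1), of a y] that(2) by auto
  \<comment> \<open>the coordinate derivatives with a coefficient that is supported in the chart\<close>
  define fld where "fld = (\<lambda>(B :: 'm \<Rightarrow> real) b q f. if q \<in> U \<and> f \<in> Cinf M then B (\<phi> q) * dif b f (\<phi> q) else 0)"
  have fldV: "fld (\<lambda>y. bump a r y * l y) b \<in> vfields M"
    if r: "r > 0" and W: "cball a r \<subseteq> Om" and l: "\<And>k. C_k_on k UNIV l" for a r l b
  proof -
    let ?B = "\<lambda>y. bump a r y * l y"
    have "fld ?B b q \<in> tangent_space M q" for q
      by (auto simp: tangent_space_def fld_def dif_add dif_scale dif_mult UO FU algebra_simps)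
    moreover have "lie_fun (fld ?B b) f \<in> Cinf M" if "f \<in> Cinf M" for f
    proof -
      have "lie_fun (fld ?B b) f = ext (\<lambda>y. bump a r y * (l y * dif b f y))"
        using that by (auto simp: lie_fun_def fld_def ext_def)
      also have "\<dots> \<in> Cinf M"
        by (rule extC[OF C_k_on_bump_mult[OF oO C_k_on_mult[OF oO C_k_on_subset[OF l] difs[OF that]] W r] W])
          (auto simp: bump0[OF r])
      finally show ?thesis .
    qed
    ultimately show ?thesis by (auto simp: vfields_def)
  qed
  define a where "a = \<phi> p"
  obtain r where r: "r > 0" "cball a r \<subseteq> Om"
    using oO UO(1)[OF c(2)] unfolding a_def by (meson open_contains_cball)
  define \<kappa> where "\<kappa> = ext (bump a r)"
  define cb where "cb = (\<lambda>b y. bump a r y * (y \<bullet> b))"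
  have cbs: "C_k_on k UNIV (\<lambda>y. y \<bullet> b)" for k and b :: 'm
    by (rule C_k_on_linear[OF bounded_linear_inner_left])
  have \<kappa>C: "\<kappa> \<in> Cinf M"
    unfolding \<kappa>_def by (rule extC[OF C_k_on_bump r(2)]) (auto simp: bump0 r(1))
  have xC: "ext (cb b) \<in> Cinf M" for b
    unfolding cb_def by (rule extC[OF C_k_on_mult[OF open_UNIV C_k_on_bump cbs] r(2)]) (auto simp: bump0 r(1))
  \<comment> \<open>the expansion of \<open>v f\<close>; Hadamard's lemma is applied on a ball around \<open>\<phi> q\<close>, hence the second bump function \<open>\<xi>\<close>\<close>
  have key: "\<kappa> q * v f = (\<Sum>b\<in>Basis. (v (ext (cb b)) - (\<phi> q \<bullet> b) * v \<kappa>) * dif b f (\<phi> q))"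
    if q: "q \<in> U" and v: "v \<in> tangent_space M q" and f: "f \<in> Cinf M" for q v f
  proof -
    obtain s where s: "s > 0" "ball (\<phi> q) s \<subseteq> Om"
      using oO UO(1)[OF q] by (meson open_contains_ball)
    obtain h where h: "\<And>b k. C_k_on k (ball (\<phi> q) s) (h b)"
      "\<And>y. y \<in> ball (\<phi> q) s \<Longrightarrow> F f y = F f (\<phi> q) + (\<Sum>b\<in>Basis. h b y * ((y - \<phi> q) \<bullet> b))"
      "\<And>b. h b (\<phi> q) = dif b f (\<phi> q)"
      using hadamard[of "ball (\<phi> q) s" "\<phi> q" "F f"] C_k_on_subset[OF Fs[OF f] s(2)] s(1)
      unfolding dif_def by (auto simp: convex_ball)
    define t where "t = s / 2"
    have t: "t > 0" "cball (\<phi> q) t \<subseteq> ball (\<phi> q) s" using s(1) by (auto simp: t_def)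
    then have tO: "cball (\<phi> q) t \<subseteq> Om" using s(2) by blast
    define \<xi> where "\<xi> = ext (bump (\<phi> q) t)"
    define H where "H = (\<lambda>b. ext (\<lambda>y. bump (\<phi> q) t y * h b y))"
    define X where "X = (\<lambda>b. ext (\<lambda>y. bump (\<phi> q) t y * ((y - \<phi> q) \<bullet> b)))"
    have ls: "C_k_on k UNIV (\<lambda>y. (y - \<phi> q) \<bullet> b)" for k and b :: 'm
      using C_k_on_add[OF open_UNIV cbs C_k_on_const, of k b "- (\<phi> q \<bullet> b)"]
      by (simp add: inner_diff_left)
    have \<xi>C: "\<xi> \<in> Cinf M"
      unfolding \<xi>_def by (rule extC[OF C_k_on_bump tO]) (auto simp: bump0 t(1))
    have HC: "H b \<in> Cinf M" for b
      unfolding H_def by (rule extC[OF C_k_on_bump_mult[OF open_ball h(1) t(2,1)] tO]) (auto simp: bump0 t(1))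
    have XC: "X b \<in> Cinf M" for b
      unfolding X_def by (rule extC[OF C_k_on_mult[OF open_UNIV C_k_on_bump ls] tO]) (auto simp: bump0 t(1))
    have X0: "X b q = 0" for b by (simp add: X_def ext_def)
    have \<xi>q: "\<xi> q \<noteq> 0" using bump_nonzero_iff[OF t(1), of "\<phi> q" "\<phi> q"] t(1) q by (simp add: \<xi>_def ext_def)
    have Hq: "H b q = \<xi> q * dif b f (\<phi> q)" for b using q h(3) by (simp add: H_def \<xi>_def ext_def)
    \<comment> \<open>Hadamard's expansion, made global by two factors \<open>\<xi>\<close>; all factors \<open>X b\<close> vanish at \<open>q\<close>\<close>
    have id1: "\<xi> * \<xi> * (f - (\<lambda>_. f q)) = (\<Sum>b\<in>Basis. H b * X b)"
    proof
      fix z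
      show "(\<xi> * \<xi> * (f - (\<lambda>_. f q))) z = (\<Sum>b\<in>Basis. H b * X b) z"
      proof (cases "z \<in> U \<and> \<phi> z \<in> ball (\<phi> q) s")
        case True
        then have "f z - f q = (\<Sum>b\<in>Basis. h b (\<phi> z) * ((\<phi> z - \<phi> q) \<bullet> b))"
          using h(2)[of "\<phi> z"] FU q by auto
        then show ?thesis
          using True by (simp add: sum_fun_apply \<xi>_def H_def X_def ext_def sum_distrib_left mult_ac)
      next
        case False
        then have "bump (\<phi> q) t (\<phi> z) = 0" if "z \<in> U"
          using t(2) that by (intro bump0[OF t(1)]) blast
        then have "\<xi> z = 0" "H b z = 0" for b by (auto simp: \<xi>_def H_def ext_def)
        then show ?thesis by (simp add: sum_fun_apply)
      qed
    qed
    \<comment> \<open>compares the coordinates cut off by \<open>\<xi>\<close> with those cut off by \<open>\<kappa>\<close>\<close>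
    have id2: "\<kappa> * X b = \<xi> * (ext (cb b) - (\<phi> q \<bullet> b) *\<^sub>R \<kappa>)" for b
      by (auto simp: \<kappa>_def \<xi>_def X_def cb_def ext_def algebra_simps inner_diff_left)
    have x0: "ext (cb b) q - (\<phi> q \<bullet> b) * \<kappa> q = 0" for b
      using q by (simp add: \<kappa>_def cb_def ext_def)
    have "v (\<xi> * \<xi> * (f - (\<lambda>_. f q))) = \<xi> q * \<xi> q * v f"
      using f \<xi>C by (simp add: tangent_mult[OF v] tangent_diff[OF v] tangent_const[OF v])
    moreover have "v (\<Sum>b\<in>Basis. H b * X b) = (\<Sum>b\<in>Basis. \<xi> q * dif b f (\<phi> q) * v (X b))"
      using HC XC by (simp add: tangent_sum[OF v] tangent_mult[OF v] X0 Hq)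
    ultimately have e1: "\<xi> q * v f = (\<Sum>b\<in>Basis. dif b f (\<phi> q) * v (X b))"
      using id1 \<xi>q by (simp add: sum_distrib_left mult.assoc flip: sum_distrib_left)
    have e2: "\<kappa> q * v (X b) = \<xi> q * (v (ext (cb b)) - (\<phi> q \<bullet> b) * v \<kappa>)" for b
    proof -
      have "v (\<kappa> * X b) = \<kappa> q * v (X b)"
        using \<kappa>C XC by (simp add: tangent_mult[OF v] X0)
      moreover have "v (\<xi> * (ext (cb b) - (\<phi> q \<bullet> b) *\<^sub>R \<kappa>)) = \<xi> q * (v (ext (cb b)) - (\<phi> q \<bullet> b) * v \<kappa>)"
        using \<kappa>C \<xi>C xC by (simp add: tangent_mult[OF v] tangent_diff[OF v] tangent_scaleR[OF v] x0)
      ultimately show ?thesis using id2 by simp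
    qed
    have "\<xi> q * (\<kappa> q * v f) = (\<Sum>b\<in>Basis. dif b f (\<phi> q) * (\<kappa> q * v (X b)))"
      using e1 by (simp add: sum_distrib_left mult_ac)
    also have "\<dots> = \<xi> q * (\<Sum>b\<in>Basis. (v (ext (cb b)) - (\<phi> q \<bullet> b) * v \<kappa>) * dif b f (\<phi> q))"
      by (simp add: e2 sum_distrib_left mult_ac)
    finally show ?thesis using \<xi>q by simp
  qed
  \<comment> \<open>the index 0 is not in \<open>Basis\<close> and carries the correction term with \<open>v(\<kappa>)\<close>\<close>
  define x where "x = (\<lambda>i. if i = 0 then \<kappa> else ext (cb i))"
  define E where "E = (\<lambda>i. if i = 0 then (\<Sum>b\<in>Basis. fld (\<lambda>y. bump a r y * - (y \<bullet> b)) b)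
    else fld (\<lambda>y. bump a r y * 1) i)"
  have "(\<kappa> * \<kappa>) q *\<^sub>R v = (\<Sum>i\<in>insert 0 Basis. v (x i) *\<^sub>R E i q)" if v: "v \<in> tangent_space M q" for q v
  proof
    fix f
    have "((\<Sum>i\<in>insert 0 Basis. v (x i) *\<^sub>R E i q)) f = v \<kappa> * E 0 q f + (\<Sum>b\<in>Basis. v (x b) * E b q f)"
      by (subst sum.insert) (auto simp: sum_fun_apply x_def)
    also have "\<dots> = (\<kappa> * \<kappa>) q * v f"
    proof (cases "q \<in> U \<and> f \<in> Cinf M")
      case True
      have "v \<kappa> * E 0 q f + (\<Sum>b\<in>Basis. v (x b) * E b q f) =
          v \<kappa> * (\<Sum>b\<in>Basis. \<kappa> q * - (\<phi> q \<bullet> b) * dif b f (\<phi> q)) +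
          (\<Sum>b\<in>Basis. v (ext (cb b)) * (\<kappa> q * dif b f (\<phi> q)))"
        using True by (auto simp: E_def x_def sum_fun_apply fld_def \<kappa>_def ext_def intro!: sum.cong)
      also have "\<dots> = \<kappa> q * (\<Sum>b\<in>Basis. (v (ext (cb b)) - (\<phi> q \<bullet> b) * v \<kappa>) * dif b f (\<phi> q))"
        by (simp add: sum_distrib_left sum.distrib[symmetric] algebra_simps)
      also have "\<dots> = (\<kappa> * \<kappa>) q * v f" using key[of q v f] True v by simp
      finally show ?thesis .
    next
      case False
      then have "(\<kappa> * \<kappa>) q * v f = 0" using tangent_notin[OF v] by (auto simp: \<kappa>_def ext_def)
      moreover have "E i q f = 0" for i
        using False by (auto simp: E_def sum_fun_apply fld_def)
      ultimately show ?thesis by simp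
    qed
    finally show "((\<kappa> * \<kappa>) q *\<^sub>R v) f = (\<Sum>i\<in>insert 0 Basis. v (x i) *\<^sub>R E i q) f" by simp
  qed
  moreover have "x i \<in> Cinf M" for i using \<kappa>C xC by (simp add: x_def)
  moreover have "E i \<in> vfields M" for i
  proof -
    have "fld (\<lambda>y. bump a r y * - (y \<bullet> b)) b \<in> vfields M" for b
      by (rule fldV[OF r C_k_on_linear[OF bounded_linear_minus[OF bounded_linear_inner_left]]])
    moreover have "fld (\<lambda>y. bump a r y * 1) i \<in> vfields M"
      by (rule fldV[OF r C_k_on_const])
    ultimately show ?thesis unfolding E_def by (simp only: subspace_sum[OF subspace_vfields] split: if_split) simp
  qed
  moreover have "(\<kappa> * \<kappa>) p \<noteq> 0"
    using bump_nonzero_iff[OF r(1), of a a] r(1) c(2) by (simp add: \<kappa>_def ext_def a_def)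
  moreover have "\<kappa> * \<kappa> \<in> Cinf M" using \<kappa>C by simp
  ultimately show thesis by (intro that[of "insert 0 Basis" "\<kappa> * \<kappa>" x E]) auto
qed

section \<open>Covectors, one-forms and bivector fields\<close>

lemma cotangent_add: "\<alpha> \<in> cotangent_space M p \<Longrightarrow> v \<in> tangent_space M p \<Longrightarrow> w \<in> tangent_space M p \<Longrightarrow>
    \<alpha> (v + w) = \<alpha> v + \<alpha> w"
  and cotangent_scaleR: "\<alpha> \<in> cotangent_space M p \<Longrightarrow> v \<in> tangent_space M p \<Longrightarrow> \<alpha> (c *\<^sub>R v) = c * \<alpha> v"
  and cotangent_notin: "\<alpha> \<in> cotangent_space M p \<Longrightarrow> v \<notin> tangent_space M p \<Longrightarrow> \<alpha> v = 0"
  by (simp_all add: cotangent_space_def)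

lemma cotangent_zero: "\<alpha> \<in> cotangent_space M p \<Longrightarrow> \<alpha> 0 = 0"
  using cotangent_scaleR[of \<alpha> M p 0 0] by (simp add: subspace_0[OF subspace_tangent_space])

lemma cotangent_uminus: "\<alpha> \<in> cotangent_space M p \<Longrightarrow> v \<in> tangent_space M p \<Longrightarrow> \<alpha> (- v) = - \<alpha> v"
  using cotangent_scaleR[of \<alpha> M p v "-1"] by simp

lemma cotangent_sum:
  assumes "\<alpha> \<in> cotangent_space M p" "\<And>i. i \<in> I \<Longrightarrow> v i \<in> tangent_space M p"
  shows "\<alpha> (\<Sum>i\<in>I. v i) = (\<Sum>i\<in>I. \<alpha> (v i))"
  using assms(2)
  by (induction I rule: infinite_finite_induct)
    (auto simp: cotangent_zero[OF assms(1)] cotangent_add[OF assms(1)] subspace_sum[OF subspace_tangent_space])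

lemma subspace_cotangent_space: "subspace (cotangent_space M p)"
  by (auto simp: subspace_def cotangent_space_def algebra_simps)

lemma cotangent_eqI:
  assumes "\<alpha> \<in> cotangent_space M p" "\<beta> \<in> cotangent_space M p"
    and "\<And>v. v \<in> tangent_space M p \<Longrightarrow> \<alpha> v = \<beta> v"
  shows "\<alpha> = \<beta>"
proof
  show "\<alpha> v = \<beta> v" for v
    by (metis assms cotangent_notin)
qed

lemma tangent_eqI:
  assumes "v \<in> tangent_space M p" "w \<in> tangent_space M p" "\<And>f. f \<in> Cinf M \<Longrightarrow> v f = w f"
  shows "v = w"
proof
  show "v f = w f" for f
    by (metis assms tangent_notin)
qed

lemma differential_apply: "v \<in> tangent_space M p \<Longrightarrow> differential M f p v = v f"
  by (simp add: differential_def)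

lemma differential_cotangent: "differential M f p \<in> cotangent_space M p"
  by (auto simp: cotangent_space_def differential_def subspace_add[OF subspace_tangent_space]
      subspace_scale[OF subspace_tangent_space])

lemma differential_add: "f \<in> Cinf M \<Longrightarrow> g \<in> Cinf M \<Longrightarrow>
    differential M (f + g) p = differential M f p + differential M g p"
  by (auto simp: differential_def tangent_add)

lemma differential_scaleR: "f \<in> Cinf M \<Longrightarrow> differential M (c *\<^sub>R f) p = c *\<^sub>R differential M f p"
  by (auto simp: differential_def tangent_scaleR)

lemma differential_mult: "f \<in> Cinf M \<Longrightarrow> g \<in> Cinf M \<Longrightarrow>
    differential M (f * g) p = f p *\<^sub>R differential M g p + g p *\<^sub>R differential M f p"
  by (auto simp: differential_def tangent_mult)

definition fun_times_form :: "('e \<Rightarrow> real) \<Rightarrow> ('e \<Rightarrow> 'e covec) \<Rightarrow> 'e \<Rightarrow> 'e covec"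
  where "fun_times_form f \<alpha> = (\<lambda>p. f p *\<^sub>R \<alpha> p)"

definition pair_form :: "('e \<Rightarrow> 'e covec) \<Rightarrow> 'e vfield \<Rightarrow> 'e \<Rightarrow> real"
  where "pair_form \<alpha> X = (\<lambda>p. \<alpha> p (X p))"

lemma one_forms_cotangent: "\<alpha> \<in> one_forms M \<Longrightarrow> \<alpha> p \<in> cotangent_space M p"
  and one_forms_Cinf: "\<alpha> \<in> one_forms M \<Longrightarrow> X \<in> vfields M \<Longrightarrow> pair_form \<alpha> X \<in> Cinf M"
  by (simp_all add: one_forms_def pair_form_def)

lemma differential_one_form: "f \<in> Cinf M \<Longrightarrow> differential M f \<in> one_forms M"
  using vfields_Cinf[of _ M f]
  by (auto simp: one_forms_def differential_cotangent differential_apply[OF vfields_tangent] lie_fun_def)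

lemma one_forms_add:
  assumes "\<alpha> \<in> one_forms M" "\<beta> \<in> one_forms M" shows "\<alpha> + \<beta> \<in> one_forms M"
proof -
  have "(\<lambda>p. (\<alpha> + \<beta>) p (X p)) = pair_form \<alpha> X + pair_form \<beta> X" for X
    by (auto simp: pair_form_def)
  then show ?thesis
    using assms one_forms_Cinf[OF assms(1)] one_forms_Cinf[OF assms(2)]
    by (auto simp: one_forms_def intro: subspace_add[OF subspace_cotangent_space])
qed

lemma fun_times_form_one_forms:
  assumes "f \<in> Cinf M" "\<alpha> \<in> one_forms M" shows "fun_times_form f \<alpha> \<in> one_forms M"
proof -
  have "(\<lambda>p. fun_times_form f \<alpha> p (X p)) = f * pair_form \<alpha> X" for X
    by (auto simp: pair_form_def fun_times_form_def)
  then show ?thesis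
    using assms one_forms_Cinf[OF assms(2)]
    by (auto simp: one_forms_def fun_times_form_def intro: subspace_scale[OF subspace_cotangent_space])
qed

lemma subspace_one_forms: "subspace (one_forms M)"
proof (rule subspaceI)
  have "(\<lambda>p. (0 :: 'a \<Rightarrow> 'a covec) p (X p)) = 0" for X by auto
  then show "0 \<in> one_forms M"
    by (simp add: one_forms_def subspace_0[OF subspace_cotangent_space])
next
  fix c :: real and \<alpha> :: "'a \<Rightarrow> 'a covec" assume "\<alpha> \<in> one_forms M"
  then have "fun_times_form (\<lambda>_. c) \<alpha> \<in> one_forms M"
    by (rule fun_times_form_one_forms[OF Cinf_const])
  then show "c *\<^sub>R \<alpha> \<in> one_forms M" by (simp add: fun_times_form_def scaleR_fun_def)
qed (rule one_forms_add)

context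
  fixes M :: "('e::{t2_space, second_countable_topology}, 'm::euclidean_space) atlas"
  assumes M: "smooth_manifold M"
begin

lemma extend_tangent:
  assumes "v \<in> tangent_space M p"
  shows "\<exists>X\<in>vfields M. X p = v"
proof -
  obtain I \<kappa> x E where fr: "finite (I :: 'm set)" "\<kappa> \<in> Cinf M" "\<kappa> p \<noteq> 0"
    "\<And>i. i \<in> I \<Longrightarrow> x i \<in> Cinf M" "\<And>i. i \<in> I \<Longrightarrow> E i \<in> vfields M"
    "\<And>q v. v \<in> tangent_space M q \<Longrightarrow> \<kappa> q *\<^sub>R v = (\<Sum>i\<in>I. v (x i) *\<^sub>R E i q)"
    using local_frame[OF M, of p] by blast
  let ?X = "(1 / \<kappa> p) *\<^sub>R (\<Sum>i\<in>I. v (x i) *\<^sub>R E i)"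
  have "?X \<in> vfields M"
    using fr(5) by (intro subspace_scale subspace_sum subspace_vfields)
  moreover
  have "?X p = (1 / \<kappa> p) *\<^sub>R (\<kappa> p *\<^sub>R v)"
    by (simp add: fr(6)[OF assms] sum_fun_apply)
  then have "?X p = v" using fr(3) by simp
  ultimately show ?thesis by blast
qed

lemma one_form_frame:
  obtains I :: "'m set" and \<kappa> x E where
    "finite I" "\<kappa> \<in> Cinf M" "\<kappa> p \<noteq> 0"
    "\<And>i. i \<in> I \<Longrightarrow> x i \<in> Cinf M" "\<And>i. i \<in> I \<Longrightarrow> E i \<in> vfields M"
    "\<And>q \<alpha>. \<alpha> \<in> cotangent_space M q \<Longrightarrow> \<kappa> q *\<^sub>R \<alpha> = (\<Sum>i\<in>I. \<alpha> (E i q) *\<^sub>R differential M (x i) q)"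
proof -
  obtain I \<kappa> x E where fr: "finite (I :: 'm set)" "\<kappa> \<in> Cinf M" "\<kappa> p \<noteq> 0"
    "\<And>i. i \<in> I \<Longrightarrow> x i \<in> Cinf M" "\<And>i. i \<in> I \<Longrightarrow> E i \<in> vfields M"
    "\<And>q v. v \<in> tangent_space M q \<Longrightarrow> \<kappa> q *\<^sub>R v = (\<Sum>i\<in>I. v (x i) *\<^sub>R E i q)"
    using local_frame[OF M, of p] by blast
  have "\<kappa> q *\<^sub>R \<alpha> = (\<Sum>i\<in>I. \<alpha> (E i q) *\<^sub>R differential M (x i) q)"
    if \<alpha>: "\<alpha> \<in> cotangent_space M q" for q \<alpha>
  proof (rule cotangent_eqI)
    show "\<kappa> q *\<^sub>R \<alpha> \<in> cotangent_space M q" using \<alpha> by (rule subspace_scale[OF subspace_cotangent_space])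
    show "(\<Sum>i\<in>I. \<alpha> (E i q) *\<^sub>R differential M (x i) q) \<in> cotangent_space M q"
      by (intro subspace_sum subspace_scale subspace_cotangent_space differential_cotangent)
    fix v assume v: "v \<in> tangent_space M q"
    have "(\<kappa> q *\<^sub>R \<alpha>) v = \<alpha> (\<kappa> q *\<^sub>R v)" using \<alpha> v by (simp add: cotangent_scaleR)
    also have "\<dots> = (\<Sum>i\<in>I. v (x i) * \<alpha> (E i q))"
      using fr(5) vfields_tangent[of _ M q]
      by (simp add: fr(6)[OF v] cotangent_sum[OF \<alpha>] cotangent_scaleR[OF \<alpha>] subspace_scale[OF subspace_tangent_space])
    also have "\<dots> = (\<Sum>i\<in>I. \<alpha> (E i q) *\<^sub>R differential M (x i) q) v"
      by (simp add: sum_fun_apply differential_apply[OF v] mult.commute)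
    finally show "(\<kappa> q *\<^sub>R \<alpha>) v = (\<Sum>i\<in>I. \<alpha> (E i q) *\<^sub>R differential M (x i) q) v" .
  qed
  with fr show thesis by (intro that[of I \<kappa> x E]) auto
qed

text \<open>
  Reduces statements about arbitrary covectors to statements about functions.
\<close>

lemma cotangent_is_differential:
  assumes \<alpha>: "\<alpha> \<in> cotangent_space M p"
  shows "\<exists>f\<in>Cinf M. \<alpha> = differential M f p"
proof -
  obtain I \<kappa> x E where fr: "finite (I :: 'm set)" "\<kappa> \<in> Cinf M" "\<kappa> p \<noteq> 0"
    "\<And>i. i \<in> I \<Longrightarrow> x i \<in> Cinf M" "\<And>i. i \<in> I \<Longrightarrow> E i \<in> vfields M"
    "\<And>q \<alpha>. \<alpha> \<in> cotangent_space M q \<Longrightarrow> \<kappa> q *\<^sub>R \<alpha> = (\<Sum>i\<in>I. \<alpha> (E i q) *\<^sub>R differential M (x i) q)"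
    using one_form_frame[of p] by blast
  define f where "f = (\<Sum>i\<in>I. (\<alpha> (E i p) / \<kappa> p) *\<^sub>R x i)"
  have f: "f \<in> Cinf M" using fr(4) by (auto simp: f_def intro: Cinf_sum)
  have "\<alpha> = differential M f p"
  proof (rule cotangent_eqI[OF \<alpha> differential_cotangent])
    fix v assume v: "v \<in> tangent_space M p"
    have "\<kappa> p * \<alpha> v = (\<Sum>i\<in>I. \<alpha> (E i p) * v (x i))"
      using fun_cong[OF fr(6)[OF \<alpha>], of v] by (simp add: sum_fun_apply differential_apply[OF v])
    moreover
    have "v f = (\<Sum>i\<in>I. \<alpha> (E i p) / \<kappa> p * v (x i))"
      using fr(4) by (simp add: f_def tangent_sum[OF v] tangent_scaleR[OF v])
    then have "\<kappa> p * v f = (\<Sum>i\<in>I. \<alpha> (E i p) * v (x i))"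
      using fr(3) by (simp add: sum_distrib_left)
    ultimately have "\<kappa> p * \<alpha> v = \<kappa> p * v f" by simp
    then show "\<alpha> v = differential M f p v"
      using fr(3) by (simp add: differential_apply[OF v])
  qed
  with f show ?thesis by blast
qed

text \<open>
  Multiplied by \<open>\<kappa>\<close>, a 1-form is a combination of the \<open>d(x i)\<close> with coefficients that are its values on the
  frame; at \<open>p\<close>, these only depend on the covector at \<open>p\<close>.
\<close>

lemma one_form_tensorial:
  fixes L :: "('e \<Rightarrow> 'e covec) \<Rightarrow> real"
  assumes add: "\<And>\<alpha> \<beta>. \<alpha> \<in> one_forms M \<Longrightarrow> \<beta> \<in> one_forms M \<Longrightarrow> L (\<alpha> + \<beta>) = L \<alpha> + L \<beta>"
    and mult: "\<And>f \<alpha>. f \<in> Cinf M \<Longrightarrow> \<alpha> \<in> one_forms M \<Longrightarrow> L (fun_times_form f \<alpha>) = f p * L \<alpha>"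
    and \<alpha>: "\<alpha> \<in> one_forms M" and \<beta>: "\<beta> \<in> one_forms M" and eq: "\<alpha> p = \<beta> p"
  shows "L \<alpha> = L \<beta>"
proof -
  obtain I \<kappa> x E where fr: "finite (I :: 'm set)" "\<kappa> \<in> Cinf M" "\<kappa> p \<noteq> 0"
    "\<And>i. i \<in> I \<Longrightarrow> x i \<in> Cinf M" "\<And>i. i \<in> I \<Longrightarrow> E i \<in> vfields M"
    "\<And>q \<alpha>. \<alpha> \<in> cotangent_space M q \<Longrightarrow> \<kappa> q *\<^sub>R \<alpha> = (\<Sum>i\<in>I. \<alpha> (E i q) *\<^sub>R differential M (x i) q)"
    using one_form_frame[of p] by blast
  have sum: "L (\<Sum>i\<in>J. \<theta> i) = (\<Sum>i\<in>J. L (\<theta> i))" if "finite J" "\<And>i. i \<in> J \<Longrightarrow> \<theta> i \<in> one_forms M"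
    for J :: "'m set" and \<theta>
    using that
  proof (induction J rule: finite_induct)
    case empty
    have "L (fun_times_form (\<lambda>_. 0) \<alpha>) = 0" by (subst mult[OF Cinf_const \<alpha>]) simp
    then show ?case by (simp add: fun_times_form_def zero_fun_def)
  next
    case (insert i J)
    then have "L (\<theta> i + (\<Sum>i\<in>J. \<theta> i)) = L (\<theta> i) + L (\<Sum>i\<in>J. \<theta> i)"
      by (intro add subspace_sum[OF subspace_one_forms]) auto
    moreover have "L (sum \<theta> J) = (\<Sum>i\<in>J. L (\<theta> i))" by (rule insert.IH) (simp add: insert.prems)
    ultimately show ?case by (simp only: sum.insert[OF insert.hyps])
  qed
  have exp: "\<kappa> p * L \<theta> = (\<Sum>i\<in>I. \<theta> p (E i p) * L (differential M (x i)))" if \<theta>: "\<theta> \<in> one_forms M" for \<theta>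
  proof -
    have "fun_times_form \<kappa> \<theta> = (\<Sum>i\<in>I. fun_times_form (pair_form \<theta> (E i)) (differential M (x i)))"
      using fr(6)[OF one_forms_cotangent[OF \<theta>]]
      by (auto simp: fun_times_form_def pair_form_def sum_fun_apply)
    then have "\<kappa> p * L \<theta> = L (\<Sum>i\<in>I. fun_times_form (pair_form \<theta> (E i)) (differential M (x i)))"
      using mult[OF fr(2) \<theta>] by simp
    also have "\<dots> = (\<Sum>i\<in>I. pair_form \<theta> (E i) p * L (differential M (x i)))"
      using fr(4,5) one_forms_Cinf[OF \<theta>]
      by (subst sum[OF fr(1)]) (auto simp: mult fun_times_form_one_forms differential_one_form)
    finally show ?thesis by (simp add: pair_form_def)
  qed
  have "\<kappa> p * L \<alpha> = \<kappa> p * L \<beta>" by (simp add: exp[OF \<alpha>] exp[OF \<beta>] eq)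
  with fr(3) show ?thesis by simp
qed

text \<open>
  Skew symmetry reduces the dependence on two arguments to the dependence on the second one.
\<close>

lemma one_form_bitensorial:
  fixes G :: "('e \<Rightarrow> 'e covec) \<Rightarrow> ('e \<Rightarrow> 'e covec) \<Rightarrow> real"
  assumes skew: "\<And>\<alpha> \<beta>. \<alpha> \<in> one_forms M \<Longrightarrow> \<beta> \<in> one_forms M \<Longrightarrow> G \<alpha> \<beta> = - G \<beta> \<alpha>"
    and add: "\<And>\<alpha> \<beta> \<theta>. \<alpha> \<in> one_forms M \<Longrightarrow> \<beta> \<in> one_forms M \<Longrightarrow> \<theta> \<in> one_forms M \<Longrightarrow>
      G \<theta> (\<alpha> + \<beta>) = G \<theta> \<alpha> + G \<theta> \<beta>"
    and mult: "\<And>f \<alpha> \<theta>. f \<in> Cinf M \<Longrightarrow> \<alpha> \<in> one_forms M \<Longrightarrow> \<theta> \<in> one_forms M \<Longrightarrow>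
      G \<theta> (fun_times_form f \<alpha>) = f p * G \<theta> \<alpha>"
    and forms: "\<alpha> \<in> one_forms M" "\<beta> \<in> one_forms M" "\<alpha>' \<in> one_forms M" "\<beta>' \<in> one_forms M"
    and eq: "\<alpha> p = \<alpha>' p" "\<beta> p = \<beta>' p"
  shows "G \<alpha> \<beta> = G \<alpha>' \<beta>'"
proof -
  have r: "G \<theta> \<mu> = G \<theta> \<nu>" if "\<theta> \<in> one_forms M" "\<mu> \<in> one_forms M" "\<nu> \<in> one_forms M" "\<mu> p = \<nu> p" for \<theta> \<mu> \<nu>
    by (rule one_form_tensorial[of "G \<theta>" p]) (use that in \<open>auto intro: add mult\<close>)
  have "G \<alpha> \<beta> = G \<alpha> \<beta>'" using r forms eq by blast
  also have "\<dots> = - G \<beta>' \<alpha>" by (rule skew[OF forms(1,4)])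
  also have "G \<beta>' \<alpha> = G \<beta>' \<alpha>'" using r forms eq by blast
  also have "- G \<beta>' \<alpha>' = G \<alpha>' \<beta>'" using skew[OF forms(4,3)] by simp
  finally show ?thesis .
qed

end

lemma bivector_at: "Q \<in> bivector_fields M \<Longrightarrow> Q p \<in> bivectors_at M p"
  by (simp add: bivector_fields_def)

lemma bivector_add_right: "Q \<in> bivectors_at M p \<Longrightarrow> \<alpha> \<in> cotangent_space M p \<Longrightarrow> \<beta> \<in> cotangent_space M p \<Longrightarrow>
    \<theta> \<in> cotangent_space M p \<Longrightarrow> Q \<theta> (\<alpha> + \<beta>) = Q \<theta> \<alpha> + Q \<theta> \<beta>"
  and bivector_add_left: "Q \<in> bivectors_at M p \<Longrightarrow> \<alpha> \<in> cotangent_space M p \<Longrightarrow> \<beta> \<in> cotangent_space M p \<Longrightarrow>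
    \<theta> \<in> cotangent_space M p \<Longrightarrow> Q (\<alpha> + \<beta>) \<theta> = Q \<alpha> \<theta> + Q \<beta> \<theta>"
  and bivector_scaleR_left: "Q \<in> bivectors_at M p \<Longrightarrow> \<alpha> \<in> cotangent_space M p \<Longrightarrow> \<beta> \<in> cotangent_space M p \<Longrightarrow>
    Q (c *\<^sub>R \<alpha>) \<beta> = c * Q \<alpha> \<beta>"
  and bivector_scaleR_right: "Q \<in> bivectors_at M p \<Longrightarrow> \<alpha> \<in> cotangent_space M p \<Longrightarrow> \<beta> \<in> cotangent_space M p \<Longrightarrow>
    Q \<alpha> (c *\<^sub>R \<beta>) = c * Q \<alpha> \<beta>"
  by (simp_all add: bivectors_at_def)

lemma bivector_skew:
  assumes Q: "Q \<in> bivectors_at M p"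
  shows "Q \<alpha> \<beta> = - Q \<beta> \<alpha>"
proof (cases "\<alpha> \<in> cotangent_space M p \<and> \<beta> \<in> cotangent_space M p")
  case True
  then have "\<alpha> + \<beta> \<in> cotangent_space M p" by (auto intro: subspace_add[OF subspace_cotangent_space])
  then have "Q (\<alpha> + \<beta>) (\<alpha> + \<beta>) = 0" "Q \<alpha> \<alpha> = 0" "Q \<beta> \<beta> = 0"
    using Q True by (simp_all add: bivectors_at_def)
  moreover have "Q (\<alpha> + \<beta>) (\<alpha> + \<beta>) = Q \<alpha> \<alpha> + Q \<alpha> \<beta> + (Q \<beta> \<alpha> + Q \<beta> \<beta>)"
    using True \<open>\<alpha> + \<beta> \<in> _\<close> by (simp add: bivector_add_left[OF Q] bivector_add_right[OF Q])
  ultimately show ?thesis by simp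
next
  case False
  then show ?thesis using Q by (auto simp: bivectors_at_def)
qed

lemma sharp_tangent:
  assumes Q: "Q p \<in> bivectors_at M p" and \<alpha>: "\<alpha> \<in> cotangent_space M p"
  shows "sharp M Q p \<alpha> \<in> tangent_space M p"
  using \<alpha> unfolding tangent_space_def sharp_def
  by (auto simp: differential_add differential_scaleR differential_mult differential_cotangent
      bivector_add_right[OF Q] bivector_scaleR_right[OF Q] subspace_scale[OF subspace_cotangent_space])

lemma sharp_add:
  assumes "Q p \<in> bivectors_at M p" "\<alpha> \<in> cotangent_space M p" "\<beta> \<in> cotangent_space M p"
  shows "sharp M Q p (\<alpha> + \<beta>) = sharp M Q p \<alpha> + sharp M Q p \<beta>"
  using assms by (auto simp: sharp_def differential_cotangent bivector_add_left)

lemma sharp_scaleR: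
  assumes "Q p \<in> bivectors_at M p" "\<alpha> \<in> cotangent_space M p"
  shows "sharp M Q p (c *\<^sub>R \<alpha>) = c *\<^sub>R sharp M Q p \<alpha>"
  using assms by (auto simp: sharp_def differential_cotangent bivector_scaleR_left)

text \<open>
  The vector \<open>Q\<^sup>\<sharp>\<alpha>\<close> is given by its action on functions, so this is the definition for exact \<open>\<beta>\<close>; and
  every covector is exact at a point.
\<close>

lemma pair_sharp:
  assumes M: "smooth_manifold M" and Q: "Q p \<in> bivectors_at M p"
    and \<alpha>: "\<alpha> \<in> cotangent_space M p" and \<beta>: "\<beta> \<in> cotangent_space M p"
  shows "\<beta> (sharp M Q p \<alpha>) = Q p \<alpha> \<beta>"
proof -
  obtain f where f: "f \<in> Cinf M" "\<beta> = differential M f p"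
    using cotangent_is_differential[OF M \<beta>] by blast
  then show ?thesis by (simp add: differential_apply[OF sharp_tangent[of Q p, OF Q \<alpha>]]) (simp add: sharp_def)
qed

definition sharp_form :: "('e, 'm::euclidean_space) atlas \<Rightarrow> 'e bivec \<Rightarrow> ('e \<Rightarrow> 'e covec) \<Rightarrow> 'e vfield"
  where "sharp_form M Q \<alpha> = (\<lambda>p. sharp M Q p (\<alpha> p))"

definition bivec_form :: "'e bivec \<Rightarrow> ('e \<Rightarrow> 'e covec) \<Rightarrow> ('e \<Rightarrow> 'e covec) \<Rightarrow> 'e \<Rightarrow> real"
  where "bivec_form Q \<alpha> \<beta> = (\<lambda>p. Q p (\<alpha> p) (\<beta> p))"

lemma sharp_d_eq: "sharp_d M Q f = sharp_form M Q (differential M f)"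
  by (simp add: sharp_d_def sharp_form_def)

lemma bivec_form_Cinf: "Q \<in> bivector_fields M \<Longrightarrow> \<alpha> \<in> one_forms M \<Longrightarrow> \<beta> \<in> one_forms M \<Longrightarrow> bivec_form Q \<alpha> \<beta> \<in> Cinf M"
  by (simp add: bivec_form_def bivector_fields_def)

lemma sharp_form_vfields:
  assumes Q: "Q \<in> bivector_fields M" and \<alpha>: "\<alpha> \<in> one_forms M"
  shows "sharp_form M Q \<alpha> \<in> vfields M"
proof -
  have "lie_fun (sharp_form M Q \<alpha>) f = bivec_form Q \<alpha> (differential M f)" if "f \<in> Cinf M" for f
    using that by (auto simp: lie_fun_def sharp_form_def sharp_def bivec_form_def)
  then show ?thesis
    using sharp_tangent[of Q _ M, OF bivector_at[OF Q] one_forms_cotangent[OF \<alpha>]] bivec_form_Cinf[OF Q \<alpha>]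
    by (auto simp: vfields_def sharp_form_def differential_one_form)
qed

section \<open>Lie brackets\<close>

lemma lie_fun_notin: "X \<in> vfields M \<Longrightarrow> f \<notin> Cinf M \<Longrightarrow> lie_fun X f = 0"
  by (auto simp: lie_fun_def tangent_notin[OF vfields_tangent])

lemma lie_fun_add: "X \<in> vfields M \<Longrightarrow> f \<in> Cinf M \<Longrightarrow> g \<in> Cinf M \<Longrightarrow> lie_fun X (f + g) = lie_fun X f + lie_fun X g"
  by (auto simp: lie_fun_def tangent_add[OF vfields_tangent])

lemma lie_fun_scaleR: "X \<in> vfields M \<Longrightarrow> f \<in> Cinf M \<Longrightarrow> lie_fun X (c *\<^sub>R f) = c *\<^sub>R lie_fun X f"
  by (auto simp: lie_fun_def tangent_scaleR[OF vfields_tangent])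

lemma lie_fun_mult: "X \<in> vfields M \<Longrightarrow> f \<in> Cinf M \<Longrightarrow> g \<in> Cinf M \<Longrightarrow>
    lie_fun X (f * g) = f * lie_fun X g + g * lie_fun X f"
  by (auto simp: lie_fun_def tangent_mult[OF vfields_tangent])

lemma lie_bracket_vfields:
  assumes X: "X \<in> vfields M" and Y: "Y \<in> vfields M"
  shows "lie_bracket X Y \<in> vfields M"
proof -
  note XC = vfields_Cinf[OF X] and YC = vfields_Cinf[OF Y]
  have "lie_bracket X Y p \<in> tangent_space M p" for p
    unfolding tangent_space_def lie_bracket_def
    by (auto simp: lie_fun_add[OF X] lie_fun_add[OF Y] lie_fun_scaleR[OF X] lie_fun_scaleR[OF Y]
        lie_fun_mult[OF X] lie_fun_mult[OF Y] XC YC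
        tangent_add[OF vfields_tangent[OF X]] tangent_add[OF vfields_tangent[OF Y]]
        tangent_scaleR[OF vfields_tangent[OF X]] tangent_scaleR[OF vfields_tangent[OF Y]]
        tangent_mult[OF vfields_tangent[OF X]] tangent_mult[OF vfields_tangent[OF Y]]
        lie_fun_notin[OF X] lie_fun_notin[OF Y]
        tangent_zero[OF vfields_tangent[OF X]] tangent_zero[OF vfields_tangent[OF Y]])
      (auto simp: lie_fun_def algebra_simps)
  moreover have "lie_fun (lie_bracket X Y) f = lie_fun X (lie_fun Y f) - lie_fun Y (lie_fun X f)" for f
    by (auto simp: lie_fun_def lie_bracket_def)
  ultimately show ?thesis using XC YC by (simp add: vfields_def)
qed

lemma lie_bracket_skew: "lie_bracket X Y = - lie_bracket Y X"
  by (auto simp: lie_bracket_def fun_eq_iff)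

lemma lie_bracket_add_right:
  assumes X: "X \<in> vfields M" and Y: "Y \<in> vfields M" and Z: "Z \<in> vfields M"
  shows "lie_bracket X (Y + Z) = lie_bracket X Y + lie_bracket X Z"
proof (intro ext)
  fix p f
  have e: "lie_fun (Y + Z) f = lie_fun Y f + lie_fun Z f" by (auto simp: lie_fun_def)
  show "lie_bracket X (Y + Z) p f = (lie_bracket X Y + lie_bracket X Z) p f"
  proof (cases "f \<in> Cinf M")
    case True
    then show ?thesis
      using vfields_Cinf[OF Y] vfields_Cinf[OF Z]
      by (simp add: lie_bracket_def e tangent_add[OF vfields_tangent[OF X]])
  next
    case False
    then show ?thesis by (simp add: lie_bracket_def e lie_fun_notin[OF Y] lie_fun_notin[OF Z]
          lie_fun_notin[OF X] tangent_zero[OF vfields_tangent[OF X]])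
  qed
qed

lemma lie_bracket_add_left:
  assumes X: "X \<in> vfields M" and Y: "Y \<in> vfields M" and Z: "Z \<in> vfields M"
  shows "lie_bracket (X + Y) Z = lie_bracket X Z + lie_bracket Y Z"
  by (metis lie_bracket_add_right[OF Z X Y] lie_bracket_skew minus_add_distrib)

lemma lie_bracket_fun_right:
  assumes X: "X \<in> vfields M" and Y: "Y \<in> vfields M" and f: "f \<in> Cinf M"
  shows "lie_bracket X (fun_times_vfield f Y) =
    fun_times_vfield f (lie_bracket X Y) + fun_times_vfield (lie_fun X f) Y"
proof (intro ext)
  fix p g
  have e: "lie_fun (fun_times_vfield f Y) g = f * lie_fun Y g"
    by (auto simp: lie_fun_def fun_times_vfield_def)
  have e': "X p (f * lie_fun Y g) = f p * X p (lie_fun Y g) + lie_fun Y g p * X p f"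
  proof (cases "g \<in> Cinf M")
    case True
    then show ?thesis using vfields_Cinf[OF Y] f by (simp add: tangent_mult[OF vfields_tangent[OF X]])
  next
    case False
    then show ?thesis by (simp add: lie_fun_notin[OF Y] tangent_zero[OF vfields_tangent[OF X]])
  qed
  show "lie_bracket X (fun_times_vfield f Y) p g =
      (fun_times_vfield f (lie_bracket X Y) + fun_times_vfield (lie_fun X f) Y) p g"
    by (simp add: lie_bracket_def e e') (simp add: lie_fun_def fun_times_vfield_def algebra_simps)
qed

section \<open>Lie derivative of a bivector field on one-forms\<close>

text \<open>
  The usual formula has the terms \<open>- Q(L\<^sub>Z \<alpha>, \<beta>)\<close> and \<open>- Q(\<alpha>, L\<^sub>Z \<beta>)\<close>. Expressing the Lie derivatives of
  1-forms by their values on \<open>Q\<^sup>\<sharp>\<beta>\<close> and \<open>Q\<^sup>\<sharp>\<alpha>\<close> leaves only Lie brackets of vector fields.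
\<close>

definition lie_bivec_form ::
    "('e, 'm::euclidean_space) atlas \<Rightarrow> 'e vfield \<Rightarrow> 'e bivec \<Rightarrow> 'e \<Rightarrow>
     ('e \<Rightarrow> 'e covec) \<Rightarrow> ('e \<Rightarrow> 'e covec) \<Rightarrow> real"
  where "lie_bivec_form M Z Q p \<alpha> \<beta> =
    \<beta> p (lie_bracket Z (sharp_form M Q \<alpha>) p) - \<alpha> p (lie_bracket Z (sharp_form M Q \<beta>) p)
    - Z p (bivec_form Q \<alpha> \<beta>)"

definition ext_d :: "('e \<Rightarrow> 'e covec) \<Rightarrow> 'e \<Rightarrow> 'e vfield \<Rightarrow> 'e vfield \<Rightarrow> real"
  where "ext_d \<alpha> p X Y = X p (pair_form \<alpha> Y) - Y p (pair_form \<alpha> X) - \<alpha> p (lie_bracket X Y p)"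

context
  fixes M :: "('e::{t2_space, second_countable_topology}, 'm::euclidean_space) atlas"
    and Q :: "'e bivec"
  assumes M: "smooth_manifold M" and Q: "Q \<in> bivector_fields M"
begin

lemma sharp_form_add: "\<alpha> \<in> one_forms M \<Longrightarrow> \<beta> \<in> one_forms M \<Longrightarrow>
    sharp_form M Q (\<alpha> + \<beta>) = sharp_form M Q \<alpha> + sharp_form M Q \<beta>"
  by (rule ext) (simp add: sharp_form_def sharp_add bivector_at[OF Q] one_forms_cotangent)

lemma sharp_form_fun_times: "\<alpha> \<in> one_forms M \<Longrightarrow>
    sharp_form M Q (fun_times_form f \<alpha>) = fun_times_vfield f (sharp_form M Q \<alpha>)"
  by (rule ext)
    (simp add: sharp_form_def fun_times_form_def fun_times_vfield_def sharp_scaleR bivector_at[OF Q] one_forms_cotangent)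

lemma pair_sharp_form: "\<alpha> \<in> one_forms M \<Longrightarrow> \<beta> \<in> one_forms M \<Longrightarrow> pair_form \<beta> (sharp_form M Q \<alpha>) = bivec_form Q \<alpha> \<beta>"
  by (rule ext)
    (simp add: pair_form_def sharp_form_def bivec_form_def pair_sharp[OF M] bivector_at[OF Q] one_forms_cotangent)

lemma bivec_form_add: "\<alpha> \<in> one_forms M \<Longrightarrow> \<beta> \<in> one_forms M \<Longrightarrow> \<theta> \<in> one_forms M \<Longrightarrow>
    bivec_form Q \<theta> (\<alpha> + \<beta>) = bivec_form Q \<theta> \<alpha> + bivec_form Q \<theta> \<beta>"
  by (rule ext) (simp add: bivec_form_def bivector_add_right[OF bivector_at[OF Q]] one_forms_cotangent)

lemma bivec_form_fun_times: "\<alpha> \<in> one_forms M \<Longrightarrow> \<theta> \<in> one_forms M \<Longrightarrow>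
    bivec_form Q \<theta> (fun_times_form f \<alpha>) = f * bivec_form Q \<theta> \<alpha>"
  by (rule ext)
    (simp add: bivec_form_def fun_times_form_def bivector_scaleR_right[OF bivector_at[OF Q]] one_forms_cotangent)

lemma bivec_form_skew: "bivec_form Q \<alpha> \<beta> = - bivec_form Q \<beta> \<alpha>"
  by (rule ext) (metis bivec_form_def bivector_skew[OF bivector_at[OF Q]] uminus_apply)

lemma lie_bivec_form_skew:
  assumes "Z \<in> vfields M" "\<alpha> \<in> one_forms M" "\<beta> \<in> one_forms M"
  shows "lie_bivec_form M Z Q p \<alpha> \<beta> = - lie_bivec_form M Z Q p \<beta> \<alpha>"
  using assms bivec_form_Cinf[OF Q, of \<beta> \<alpha>]
  by (simp add: lie_bivec_form_def bivec_form_skew[of \<alpha> \<beta>] tangent_uminus[OF vfields_tangent])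

lemma lie_bivec_form_add:
  assumes Z: "Z \<in> vfields M" and forms: "\<alpha> \<in> one_forms M" "\<beta> \<in> one_forms M" "\<theta> \<in> one_forms M"
  shows "lie_bivec_form M Z Q p \<theta> (\<alpha> + \<beta>) = lie_bivec_form M Z Q p \<theta> \<alpha> + lie_bivec_form M Z Q p \<theta> \<beta>"
proof -
  note V = sharp_form_vfields[OF Q]
  have "lie_bracket Z (sharp_form M Q (\<alpha> + \<beta>)) =
      lie_bracket Z (sharp_form M Q \<alpha>) + lie_bracket Z (sharp_form M Q \<beta>)"
    using forms by (simp add: sharp_form_add lie_bracket_add_right[OF Z] V)
  moreover have "Z p (bivec_form Q \<theta> (\<alpha> + \<beta>)) = Z p (bivec_form Q \<theta> \<alpha>) + Z p (bivec_form Q \<theta> \<beta>)"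
    using forms by (simp add: bivec_form_add tangent_add[OF vfields_tangent[OF Z]] bivec_form_Cinf[OF Q])
  ultimately show ?thesis
    using forms lie_bracket_vfields[OF Z V]
    by (simp add: lie_bivec_form_def cotangent_add[OF one_forms_cotangent[OF forms(3)]] vfields_tangent)
qed

text \<open>
  The derivatives of \<open>f\<close> from the bracket and from the last term cancel.
\<close>

lemma lie_bivec_form_fun_times:
  assumes Z: "Z \<in> vfields M" and f: "f \<in> Cinf M" and forms: "\<alpha> \<in> one_forms M" "\<theta> \<in> one_forms M"
  shows "lie_bivec_form M Z Q p \<theta> (fun_times_form f \<alpha>) = f p * lie_bivec_form M Z Q p \<theta> \<alpha>"
proof -
  note V = sharp_form_vfields[OF Q]
  have t: "lie_bracket Z (sharp_form M Q \<alpha>) p \<in> tangent_space M p" "sharp_form M Q \<alpha> p \<in> tangent_space M p"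
    by (intro vfields_tangent lie_bracket_vfields[OF Z] V forms(1))+
  have "\<theta> p (lie_bracket Z (sharp_form M Q (fun_times_form f \<alpha>)) p) =
      \<theta> p (f p *\<^sub>R lie_bracket Z (sharp_form M Q \<alpha>) p + Z p f *\<^sub>R sharp_form M Q \<alpha> p)"
    using forms by (simp add: sharp_form_fun_times lie_bracket_fun_right[OF Z V f])
      (simp add: fun_times_vfield_def lie_fun_def)
  also have "\<dots> = f p * \<theta> p (lie_bracket Z (sharp_form M Q \<alpha>) p) + Z p f * pair_form \<theta> (sharp_form M Q \<alpha>) p"
    using t by (simp add: cotangent_add[OF one_forms_cotangent[OF forms(2)]] cotangent_scaleR[OF one_forms_cotangent[OF forms(2)]]
        subspace_scale[OF subspace_tangent_space] pair_form_def)
  finally have 1: "\<theta> p (lie_bracket Z (sharp_form M Q (fun_times_form f \<alpha>)) p) =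
      f p * \<theta> p (lie_bracket Z (sharp_form M Q \<alpha>) p) - Z p f * bivec_form Q \<theta> \<alpha> p"
    using forms by (simp add: pair_sharp_form bivec_form_skew[of \<alpha> \<theta>])
  have 2: "Z p (bivec_form Q \<theta> (fun_times_form f \<alpha>)) = f p * Z p (bivec_form Q \<theta> \<alpha>) + bivec_form Q \<theta> \<alpha> p * Z p f"
    using forms f by (simp add: bivec_form_fun_times tangent_mult[OF vfields_tangent[OF Z]] bivec_form_Cinf[OF Q])
  show ?thesis
    unfolding lie_bivec_form_def 1 2 by (simp add: fun_times_form_def algebra_simps)
qed

lemma lie_bivec_form_exact:
  assumes Z: "Z \<in> vfields M" and f: "f \<in> Cinf M" and g: "g \<in> Cinf M"
  shows "lie_bivec_form M Z Q p (differential M f) (differential M g) = lie_bivec M Z Q f g p"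
proof -
  note V = sharp_form_vfields[OF Q differential_one_form]
  have ap: "lie_fun (sharp_form M Q (differential M f)) g = bivec_d M Q f g" if "f \<in> Cinf M" "g \<in> Cinf M" for f g
    using that by (auto simp: lie_fun_def sharp_form_def sharp_def bivec_d_def)
  have br: "differential M g p (lie_bracket Z (sharp_form M Q (differential M f)) p) =
      Z p (bivec_d M Q f g) - bivec_d M Q f (lie_fun Z g) p" if f: "f \<in> Cinf M" and g: "g \<in> Cinf M" for f g
  proof -
    have "differential M g p (lie_bracket Z (sharp_form M Q (differential M f)) p) =
        Z p (lie_fun (sharp_form M Q (differential M f)) g) - lie_fun (sharp_form M Q (differential M f)) (lie_fun Z g) p"
      using vfields_tangent[OF lie_bracket_vfields[OF Z V[OF f]]]
      by (simp add: differential_apply lie_bracket_def) (simp add: lie_fun_def)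
    then show ?thesis using f g vfields_Cinf[OF Z g] by (simp add: ap)
  qed
  have bd: "bivec_form Q (differential M f) (differential M g) = bivec_d M Q f g" for f g
    by (simp add: bivec_d_def bivec_form_def)
  have sk: "bivec_d M Q g f = - bivec_d M Q f g" for f g
    unfolding bd[symmetric] by (rule bivec_form_skew)
  have C: "bivec_d M Q f g \<in> Cinf M" if f: "f \<in> Cinf M" and g: "g \<in> Cinf M" for f g
    unfolding bd[symmetric] by (intro bivec_form_Cinf[OF Q] differential_one_form f g)
  moreover have "Z p (bivec_d M Q g f) = - Z p (bivec_d M Q f g)"
    unfolding sk[where f = f and g = g] by (rule tangent_uminus[OF vfields_tangent[OF Z] C[OF f g]])
  moreover have "bivec_d M Q g (lie_fun Z f) p = - bivec_d M Q (lie_fun Z f) g p"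
    unfolding sk[where f = "lie_fun Z f" and g = g] by simp
  ultimately show ?thesis
    using f g by (simp add: lie_bivec_form_def bd br lie_bivec_def) (simp add: lie_fun_def)
qed

lemma lie_bivec_form_tensorial:
  assumes Z: "Z \<in> vfields M"
    and forms: "\<alpha> \<in> one_forms M" "\<beta> \<in> one_forms M" "\<alpha>' \<in> one_forms M" "\<beta>' \<in> one_forms M"
    and eq: "\<alpha> p = \<alpha>' p" "\<beta> p = \<beta>' p"
  shows "lie_bivec_form M Z Q p \<alpha> \<beta> = lie_bivec_form M Z Q p \<alpha>' \<beta>'"
  by (rule one_form_bitensorial[OF M _ _ _ forms eq])
    (intro lie_bivec_form_skew[OF Z] lie_bivec_form_add[OF Z] lie_bivec_form_fun_times[OF Z]; assumption)+

text \<open>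
  By tensoriality it is enough to test on exact forms.
\<close>

lemma Poiss_iff:
  assumes Z: "Z \<in> vfields M"
  shows "Z \<in> Poiss M Q \<longleftrightarrow> (\<forall>\<alpha>\<in>one_forms M. \<forall>\<beta>\<in>one_forms M. \<forall>p. lie_bivec_form M Z Q p \<alpha> \<beta> = 0)"
proof
  assume P: "Z \<in> Poiss M Q"
  show "\<forall>\<alpha>\<in>one_forms M. \<forall>\<beta>\<in>one_forms M. \<forall>p. lie_bivec_form M Z Q p \<alpha> \<beta> = 0"
  proof (intro ballI allI)
    fix \<alpha> \<beta> p assume forms: "\<alpha> \<in> one_forms M" "\<beta> \<in> one_forms M"
    obtain f g where fg: "f \<in> Cinf M" "\<alpha> p = differential M f p" "g \<in> Cinf M" "\<beta> p = differential M g p"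
      using cotangent_is_differential[OF M] one_forms_cotangent forms by meson
    have "lie_bivec_form M Z Q p \<alpha> \<beta> = lie_bivec_form M Z Q p (differential M f) (differential M g)"
      using fg forms by (intro lie_bivec_form_tensorial[OF Z] differential_one_form)
    also have "\<dots> = 0" using P fg by (simp add: lie_bivec_form_exact[OF Z] Poiss_def)
    finally show "lie_bivec_form M Z Q p \<alpha> \<beta> = 0" .
  qed
next
  assume "\<forall>\<alpha>\<in>one_forms M. \<forall>\<beta>\<in>one_forms M. \<forall>p. lie_bivec_form M Z Q p \<alpha> \<beta> = 0"
  then show "Z \<in> Poiss M Q"
    using Z lie_bivec_form_exact[OF Z] by (auto simp: Poiss_def fun_eq_iff differential_one_form)
qed

end

lemma pair_form_add_right: "\<alpha> \<in> one_forms M \<Longrightarrow> X \<in> vfields M \<Longrightarrow> Y \<in> vfields M \<Longrightarrow>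
    pair_form \<alpha> (X + Y) = pair_form \<alpha> X + pair_form \<alpha> Y"
  by (rule ext) (simp add: pair_form_def cotangent_add[OF one_forms_cotangent vfields_tangent vfields_tangent])

lemma pair_form_fun_right: "\<alpha> \<in> one_forms M \<Longrightarrow> X \<in> vfields M \<Longrightarrow>
    pair_form \<alpha> (fun_times_vfield f X) = f * pair_form \<alpha> X"
  by (rule ext)
    (simp add: pair_form_def fun_times_vfield_def cotangent_scaleR[OF one_forms_cotangent vfields_tangent])

lemma ext_d_skew:
  assumes "\<alpha> \<in> one_forms M" "X \<in> vfields M" "Y \<in> vfields M"
  shows "ext_d \<alpha> p X Y = - ext_d \<alpha> p Y X"
proof -
  have "\<alpha> p (- lie_bracket Y X p) = - \<alpha> p (lie_bracket Y X p)"
    using assms by (intro cotangent_uminus[OF one_forms_cotangent] vfields_tangent lie_bracket_vfields)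
  then have "\<alpha> p (lie_bracket X Y p) = - \<alpha> p (lie_bracket Y X p)"
    unfolding lie_bracket_skew[of X Y] by simp
  then show ?thesis by (simp add: ext_d_def)
qed

lemma ext_d_add_right:
  assumes \<alpha>: "\<alpha> \<in> one_forms M" and X: "X \<in> vfields M" and Y: "Y \<in> vfields M" and Z: "Z \<in> vfields M"
  shows "ext_d \<alpha> p X (Y + Z) = ext_d \<alpha> p X Y + ext_d \<alpha> p X Z"
proof -
  have "X p (pair_form \<alpha> (Y + Z)) = X p (pair_form \<alpha> Y) + X p (pair_form \<alpha> Z)"
    unfolding pair_form_add_right[OF \<alpha> Y Z]
    by (intro tangent_add[OF vfields_tangent[OF X]] one_forms_Cinf \<alpha> Y Z)
  moreover have "\<alpha> p (lie_bracket X (Y + Z) p) = \<alpha> p (lie_bracket X Y p) + \<alpha> p (lie_bracket X Z p)"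
    unfolding lie_bracket_add_right[OF X Y Z] plus_fun_apply[of "lie_bracket X Y" "lie_bracket X Z" p]
    by (intro cotangent_add[OF one_forms_cotangent[OF \<alpha>]] vfields_tangent lie_bracket_vfields X Y Z)
  ultimately show ?thesis by (simp add: ext_d_def)
qed

lemma ext_d_fun_right:
  assumes \<alpha>: "\<alpha> \<in> one_forms M" and X: "X \<in> vfields M" and Y: "Y \<in> vfields M" and f: "f \<in> Cinf M"
  shows "ext_d \<alpha> p X (fun_times_vfield f Y) = f p * ext_d \<alpha> p X Y"
proof -
  note XY = lie_bracket_vfields[OF X Y]
  have 1: "X p (pair_form \<alpha> (fun_times_vfield f Y)) = f p * X p (pair_form \<alpha> Y) + pair_form \<alpha> Y p * X p f"
    unfolding pair_form_fun_right[OF \<alpha> Y]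
    by (intro tangent_mult[OF vfields_tangent[OF X]] one_forms_Cinf \<alpha> Y f)
  have "\<alpha> p (lie_bracket X (fun_times_vfield f Y) p) =
      \<alpha> p (f p *\<^sub>R lie_bracket X Y p + X p f *\<^sub>R Y p)"
    unfolding lie_bracket_fun_right[OF X Y f] by (simp add: fun_times_vfield_def lie_fun_def)
  also have "\<dots> = f p * \<alpha> p (lie_bracket X Y p) + X p f * pair_form \<alpha> Y p"
    using one_forms_cotangent[OF \<alpha>, of p] vfields_tangent[OF XY, of p] vfields_tangent[OF Y, of p]
    by (simp add: cotangent_add cotangent_scaleR subspace_scale[OF subspace_tangent_space] pair_form_def)
  finally show ?thesis
    unfolding ext_d_def 1 by (simp add: fun_times_vfield_def algebra_simps)
qed

text \<open>
  Both sides are tensorial in \<open>\<mu>\<close> and \<open>\<nu>\<close>, so these may be taken to be \<open>df\<close> and \<open>dg\<close>. With the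
  Hamiltonian fields \<open>X\<^sub>f\<close> one has \<open>Z u = - \<alpha>(X\<^sub>u)\<close>, and the left-hand side becomes
  \<open>- \<alpha>(X\<^sub>h) + X\<^sub>f(\<alpha>(X\<^sub>g)) - X\<^sub>g(\<alpha>(X\<^sub>f))\<close> for \<open>h\<close> the bracket of \<open>f\<close> and \<open>g\<close>. The Jacobi identity says
  \<open>X\<^sub>h = [X\<^sub>f, X\<^sub>g]\<close>.
\<close>

lemma lie_bivec_form_sharp_form:
  fixes M :: "('e::{t2_space, second_countable_topology}, 'm::euclidean_space) atlas"
  assumes M: "smooth_manifold M" and poisson: "poisson_tensor M Q"
    and \<alpha>: "\<alpha> \<in> one_forms M" and \<mu>: "\<mu> \<in> one_forms M" and \<nu>: "\<nu> \<in> one_forms M"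
  shows "lie_bivec_form M (sharp_form M Q \<alpha>) Q p \<mu> \<nu> = ext_d \<alpha> p (sharp_form M Q \<mu>) (sharp_form M Q \<nu>)"
proof -
  have Q: "Q \<in> bivector_fields M" using poisson by (simp add: poisson_tensor_def)
  define Z where "Z = sharp_form M Q \<alpha>"
  have V: "sharp_form M Q \<theta> \<in> vfields M" if "\<theta> \<in> one_forms M" for \<theta>
    using that by (rule sharp_form_vfields[OF Q])
  have Z: "Z \<in> vfields M" unfolding Z_def by (rule V[OF \<alpha>])
  define G where "G = (\<lambda>\<mu> \<nu>. lie_bivec_form M Z Q p \<mu> \<nu> - ext_d \<alpha> p (sharp_form M Q \<mu>) (sharp_form M Q \<nu>))"
  obtain f where f: "f \<in> Cinf M" "\<mu> p = differential M f p"
    using cotangent_is_differential[OF M one_forms_cotangent[OF \<mu>]] by blast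
  obtain g where g: "g \<in> Cinf M" "\<nu> p = differential M g p"
    using cotangent_is_differential[OF M one_forms_cotangent[OF \<nu>]] by blast
  have "G \<mu> \<nu> = G (differential M f) (differential M g)"
  proof (rule one_form_bitensorial[OF M _ _ _ \<mu> \<nu> differential_one_form[OF f(1)] differential_one_form[OF g(1)] f(2) g(2)])
    fix \<mu> \<nu> assume fm: "\<mu> \<in> one_forms M" "\<nu> \<in> one_forms M"
    show "G \<mu> \<nu> = - G \<nu> \<mu>"
      unfolding G_def lie_bivec_form_skew[OF M Q Z fm] ext_d_skew[OF \<alpha> V[OF fm(1)] V[OF fm(2)]] by simp
  next
    fix \<mu> \<nu> \<theta> assume fm: "\<mu> \<in> one_forms M" "\<nu> \<in> one_forms M" "\<theta> \<in> one_forms M"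
    show "G \<theta> (\<mu> + \<nu>) = G \<theta> \<mu> + G \<theta> \<nu>"
      unfolding G_def lie_bivec_form_add[OF M Q Z fm] sharp_form_add[OF M Q fm(1,2)]
        ext_d_add_right[OF \<alpha> V[OF fm(3)] V[OF fm(1)] V[OF fm(2)]] by simp
  next
    fix h \<mu> \<theta> assume h: "h \<in> Cinf M" and fm: "\<mu> \<in> one_forms M" "\<theta> \<in> one_forms M"
    show "G \<theta> (fun_times_form h \<mu>) = h p * G \<theta> \<mu>"
      unfolding G_def lie_bivec_form_fun_times[OF M Q Z h fm] sharp_form_fun_times[OF M Q fm(1)]
        ext_d_fun_right[OF \<alpha> V[OF fm(2)] V[OF fm(1)] h] by (simp add: algebra_simps)
  qed
  also have "\<dots> = 0"
  proof -
    define X where "X = (\<lambda>f. sharp_form M Q (differential M f))"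
    note f = f(1) and g = g(1)
    have XV: "X f \<in> vfields M" if "f \<in> Cinf M" for f unfolding X_def by (intro V differential_one_form that)
    have Xap: "X f p u = bivec_d M Q f u p" if "u \<in> Cinf M" for f u p
      using that by (simp add: X_def sharp_form_def sharp_def bivec_d_def)
    have bC: "bivec_d M Q f g \<in> Cinf M" if "f \<in> Cinf M" "g \<in> Cinf M" for f g
      using bivec_form_Cinf[OF Q differential_one_form[OF that(1)] differential_one_form[OF that(2)]]
      by (simp add: bivec_form_def bivec_d_def)
    have sk: "bivec_d M Q f g = - bivec_d M Q g f" for f g
      using bivec_form_skew[OF M Q, of "differential M f" "differential M g"]
      by (simp add: bivec_form_def bivec_d_def)
    have lX: "lie_fun (X f) u = bivec_d M Q f u" if "u \<in> Cinf M" for f u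
      using Xap[OF that] by (auto simp: lie_fun_def)
    have neg: "bivec_d M Q f (- u) = - bivec_d M Q f u" if "f \<in> Cinf M" "u \<in> Cinf M" for f u
      using that tangent_uminus[OF vfields_tangent[OF XV[OF that(1)]] that(2)]
      by (intro ext) (simp add: Xap[symmetric])
    \<comment> \<open>the Jacobi identity\<close>
    have hom: "X (bivec_d M Q f g) p = lie_bracket (X f) (X g) p"
    proof (rule tangent_eqI[OF vfields_tangent[OF XV[OF bC[OF f g]]] vfields_tangent[OF lie_bracket_vfields[OF XV[OF f] XV[OF g]]]])
      fix h assume h: "h \<in> Cinf M"
      have j: "bivec_d M Q (bivec_d M Q f g) h + bivec_d M Q (bivec_d M Q g h) f + bivec_d M Q (bivec_d M Q h f) g = 0"
      proof
        fix p
        have "schouten M Q Q f g h p = 0" using poisson f g h by (simp add: poisson_tensor_def)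
        then show "(bivec_d M Q (bivec_d M Q f g) h + bivec_d M Q (bivec_d M Q g h) f + bivec_d M Q (bivec_d M Q h f) g) p = 0 p"
          by (simp add: schouten_def)
      qed
      have 1: "bivec_d M Q (bivec_d M Q g h) f = - bivec_d M Q f (bivec_d M Q g h)" by (rule sk)
      have 2: "bivec_d M Q (bivec_d M Q h f) g = bivec_d M Q g (bivec_d M Q f h)"
        using sk[of "bivec_d M Q h f" g] sk[of h f] neg[OF g bC[OF f h]] by simp
      show "X (bivec_d M Q f g) p h = lie_bracket (X f) (X g) p h"
        using fun_cong[OF j, of p] h bC[OF f h] bC[OF g h]
        by (simp add: 1 2 Xap lie_bracket_def lX)
    qed
    have Zap: "lie_fun Z u = - pair_form \<alpha> (X u)" if u: "u \<in> Cinf M" for u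
    proof -
      have "lie_fun Z u = bivec_form Q \<alpha> (differential M u)"
        using u by (auto simp: lie_fun_def Z_def sharp_form_def sharp_def bivec_form_def)
      also have "\<dots> = - bivec_form Q (differential M u) \<alpha>" by (rule bivec_form_skew[OF M Q])
      also have "bivec_form Q (differential M u) \<alpha> = pair_form \<alpha> (X u)"
        unfolding X_def by (rule pair_sharp_form[OF M Q differential_one_form[OF u] \<alpha>, symmetric])
      finally show ?thesis .
    qed
    have aC: "pair_form \<alpha> (X u) \<in> Cinf M" if "u \<in> Cinf M" for u
      by (rule one_forms_Cinf[OF \<alpha> XV[OF that]])
    have "lie_bivec M Z Q f g p = - \<alpha> p (X (bivec_d M Q f g) p) - X g p (pair_form \<alpha> (X f)) + X f p (pair_form \<alpha> (X g))"
      unfolding lie_bivec_def Zap[OF f] Zap[OF g] Zap[OF bC[OF f g]] sk[of "- pair_form \<alpha> (X f)" g]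
        neg[OF g aC[OF f]] neg[OF f aC[OF g]]
      by (simp add: Xap[OF aC[OF f]] Xap[OF aC[OF g]]) (simp add: pair_form_def)
    also have "\<dots> = ext_d \<alpha> p (X f) (X g)" by (simp add: hom ext_d_def)
    finally show ?thesis
      unfolding G_def lie_bivec_form_exact[OF M Q Z f g] by (simp add: X_def)
  qed
  finally show ?thesis by (simp add: G_def Z_def)
qed

section \<open>Submersions\<close>

text \<open>
  \<open>C\<^sup>\<infinity>(B)\<close>-linear maps from vector fields on the base to functions on the total space: horizontal
  1-forms, but also \<open>u \<mapsto> (hor u) f\<close> and the contractions of a horizontal 2-form.
\<close>

definition module_map ::
    "('e, 'm::euclidean_space) atlas \<Rightarrow> ('b, 'n::euclidean_space) atlas \<Rightarrow> ('e \<Rightarrow> 'b) \<Rightarrow>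
     ('b vfield \<Rightarrow> 'e \<Rightarrow> real) \<Rightarrow> bool"
  where "module_map M N \<pi> \<beta> \<longleftrightarrow>
    (\<forall>u\<in>vfields N. \<beta> u \<in> Cinf M) \<and>
    (\<forall>u\<in>vfields N. \<forall>v\<in>vfields N. \<beta> (u + v) = \<beta> u + \<beta> v) \<and>
    (\<forall>f\<in>Cinf N. \<forall>u\<in>vfields N. \<beta> (fun_times_vfield f u) = (f \<circ> \<pi>) * \<beta> u)"

text \<open>
  The 1-form \<open>\<pi>\<^sup>*\<beta>\<close>, with the same choice of extensions as in \<open>pull_back\<close>.
\<close>

definition pullback_form ::
    "('e, 'm::euclidean_space) atlas \<Rightarrow> ('b, 'n::euclidean_space) atlas \<Rightarrow> ('e \<Rightarrow> 'b) \<Rightarrow>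
     ('b vfield \<Rightarrow> 'e \<Rightarrow> real) \<Rightarrow> 'e \<Rightarrow> 'e covec"
  where "pullback_form M N \<pi> \<beta> e = (\<lambda>X. if X \<in> tangent_space M e
    then \<beta> (SOME u. u \<in> vfields N \<and> u (\<pi> e) = push N \<pi> X) e else 0)"

lemma push_add: "push N \<pi> (v + w) = push N \<pi> v + push N \<pi> w"
  by (auto simp: push_def)

lemma push_scaleR: "push N \<pi> (c *\<^sub>R v) = c *\<^sub>R push N \<pi> v"
  by (auto simp: push_def)

lemma subspace_vertical: "subspace (vertical M N \<pi> e)"
  by (auto simp: subspace_def vertical_def push_add push_scaleR subspace_0[OF subspace_tangent_space]
      subspace_add[OF subspace_tangent_space] subspace_scale[OF subspace_tangent_space])
    (auto simp: push_def)

lemma subspace_annihilator: "subspace (annihilator M e W)"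
  by (auto simp: subspace_def annihilator_def subspace_0[OF subspace_cotangent_space]
      subspace_add[OF subspace_cotangent_space] subspace_scale[OF subspace_cotangent_space])

context
  fixes M :: "('e::{t2_space, second_countable_topology}, 'm::euclidean_space) atlas"
    and N :: "('b::{t2_space, second_countable_topology}, 'n::euclidean_space) atlas"
    and \<pi> :: "'e \<Rightarrow> 'b"
  assumes fb: "fiber_bundle M N \<pi>"
begin

lemma total_manifold: "smooth_manifold M" and base_manifold: "smooth_manifold N"
  using fb by (simp_all add: fiber_bundle_def)

lemma comp_Cinf: "g \<in> Cinf N \<Longrightarrow> g \<circ> \<pi> \<in> Cinf M"
  using fb Cinf_pullback[OF total_manifold base_manifold] by (simp add: fiber_bundle_def)

lemma push_tangent: "v \<in> tangent_space M e \<Longrightarrow> push N \<pi> v \<in> tangent_space N (\<pi> e)"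
  using fb unfolding fiber_bundle_def by blast

lemma push_surj: "w \<in> tangent_space N (\<pi> e) \<Longrightarrow> \<exists>v\<in>tangent_space M e. push N \<pi> v = w"
  using fb unfolding fiber_bundle_def by (metis imageE)

lemma extend_push:
  assumes "X \<in> tangent_space M e"
  shows "\<exists>u\<in>vfields N. u (\<pi> e) = push N \<pi> X"
  using extend_tangent[OF base_manifold push_tangent[OF assms]] .

text \<open>
  The expansion of \<open>\<kappa> u\<close> in a frame of the base is an identity of global vector fields, to which
  \<open>\<beta>\<close> can be applied.
\<close>

lemma module_map_frame:
  assumes \<beta>: "module_map M N \<pi> \<beta>"
    and fr: "finite (I :: 'n set)" "\<kappa> \<in> Cinf N"
    "\<And>i. i \<in> I \<Longrightarrow> x i \<in> Cinf N" "\<And>i. i \<in> I \<Longrightarrow> E i \<in> vfields N"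
    "\<And>q v. v \<in> tangent_space N q \<Longrightarrow> \<kappa> q *\<^sub>R v = (\<Sum>i\<in>I. v (x i) *\<^sub>R E i q)"
    and u: "u \<in> vfields N"
  shows "\<kappa> (\<pi> e) * \<beta> u e = (\<Sum>i\<in>I. u (\<pi> e) (x i) * \<beta> (E i) e)"
proof -
  have badd: "\<beta> (u + v) = \<beta> u + \<beta> v" if "u \<in> vfields N" "v \<in> vfields N" for u v
    using \<beta> that by (simp add: module_map_def)
  have bmult: "\<beta> (fun_times_vfield f u) = (f \<circ> \<pi>) * \<beta> u" if "f \<in> Cinf N" "u \<in> vfields N" for f u
    using \<beta> that by (simp add: module_map_def)
  have sum: "\<beta> (\<Sum>i\<in>J. \<theta> i) = (\<Sum>i\<in>J. \<beta> (\<theta> i))" if "finite J" "\<And>i. i \<in> J \<Longrightarrow> \<theta> i \<in> vfields N"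
    for J :: "'n set" and \<theta>
    using that
  proof (induction J rule: finite_induct)
    case empty
    have "\<beta> (fun_times_vfield (\<lambda>_. 0) u) = 0"
      unfolding bmult[OF Cinf_const u] by (auto simp: fun_eq_iff)
    moreover have "fun_times_vfield (\<lambda>_. 0) u = 0" by (auto simp: fun_times_vfield_def)
    ultimately show ?case by (simp only: sum.empty)
  next
    case (insert i J)
    then have "\<beta> (\<theta> i + (\<Sum>i\<in>J. \<theta> i)) = \<beta> (\<theta> i) + \<beta> (\<Sum>i\<in>J. \<theta> i)"
      by (intro badd subspace_sum[OF subspace_vfields]) auto
    moreover have "\<beta> (sum \<theta> J) = (\<Sum>i\<in>J. \<beta> (\<theta> i))" by (rule insert.IH) (simp add: insert.prems)
    ultimately show ?case by (simp only: sum.insert[OF insert.hyps])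
  qed
  have "fun_times_vfield \<kappa> u = (\<Sum>i\<in>I. fun_times_vfield (lie_fun u (x i)) (E i))"
    using fr(5)[OF vfields_tangent[OF u]]
    by (auto simp: fun_times_vfield_def lie_fun_def sum_fun_apply)
  then have "(\<kappa> \<circ> \<pi>) * \<beta> u = (\<Sum>i\<in>I. (lie_fun u (x i) \<circ> \<pi>) * \<beta> (E i))"
    using bmult[OF fr(2) u] sum[OF fr(1), of "\<lambda>i. fun_times_vfield (lie_fun u (x i)) (E i)"]
      fr(3,4) vfields_Cinf[OF u] by (simp add: fun_times_vfield_vfields bmult)
  from fun_cong[OF this, of e] show ?thesis by (simp add: sum_fun_apply lie_fun_def)
qed

lemma module_map_tensorial:
  assumes \<beta>: "module_map M N \<pi> \<beta>" and u: "u \<in> vfields N" "u' \<in> vfields N" "u (\<pi> e) = u' (\<pi> e)"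
  shows "\<beta> u e = \<beta> u' e"
proof -
  obtain I \<kappa> x E where fr: "finite (I :: 'n set)" "\<kappa> \<in> Cinf N" "\<kappa> (\<pi> e) \<noteq> 0"
    "\<And>i. i \<in> I \<Longrightarrow> x i \<in> Cinf N" "\<And>i. i \<in> I \<Longrightarrow> E i \<in> vfields N"
    "\<And>q v. v \<in> tangent_space N q \<Longrightarrow> \<kappa> q *\<^sub>R v = (\<Sum>i\<in>I. v (x i) *\<^sub>R E i q)"
    using local_frame[OF base_manifold, of "\<pi> e"] by blast
  have "\<kappa> (\<pi> e) * \<beta> u e = \<kappa> (\<pi> e) * \<beta> u' e"
    using module_map_frame[OF \<beta> fr(1,2,4,5,6) u(1), where e = e]
      module_map_frame[OF \<beta> fr(1,2,4,5,6) u(2), where e = e] u(3) by simp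
  with fr(3) show ?thesis by simp
qed

lemma pullback_form_apply:
  assumes \<beta>: "module_map M N \<pi> \<beta>" and X: "X \<in> tangent_space M e"
    and u: "u \<in> vfields N" "u (\<pi> e) = push N \<pi> X"
  shows "pullback_form M N \<pi> \<beta> e X = \<beta> u e"
proof -
  let ?u = "SOME u. u \<in> vfields N \<and> u (\<pi> e) = push N \<pi> X"
  have "?u \<in> vfields N \<and> ?u (\<pi> e) = push N \<pi> X" by (rule someI[of _ u]) (use u in simp)
  then show ?thesis using X u module_map_tensorial[OF \<beta>, of ?u u e] by (simp add: pullback_form_def)
qed

lemma pullback_form_cotangent:
  assumes \<beta>: "module_map M N \<pi> \<beta>"
  shows "pullback_form M N \<pi> \<beta> e \<in> cotangent_space M e"
proof -
  note ap = pullback_form_apply[OF \<beta>]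
  have "pullback_form M N \<pi> \<beta> e (X + Y) = pullback_form M N \<pi> \<beta> e X + pullback_form M N \<pi> \<beta> e Y"
    if X: "X \<in> tangent_space M e" and Y: "Y \<in> tangent_space M e" for X Y
  proof -
    obtain u where u: "u \<in> vfields N" "u (\<pi> e) = push N \<pi> X" using extend_push[OF X] by blast
    obtain v where v: "v \<in> vfields N" "v (\<pi> e) = push N \<pi> Y" using extend_push[OF Y] by blast
    have "pullback_form M N \<pi> \<beta> e (X + Y) = \<beta> (u + v) e"
      by (rule ap[OF subspace_add[OF subspace_tangent_space X Y] subspace_add[OF subspace_vfields u(1) v(1)]])
        (simp add: push_add u v)
    also have "\<dots> = \<beta> u e + \<beta> v e" using \<beta> u v by (simp add: module_map_def)
    finally show ?thesis by (simp add: ap[OF X u] ap[OF Y v])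
  qed
  moreover have "pullback_form M N \<pi> \<beta> e (c *\<^sub>R X) = c * pullback_form M N \<pi> \<beta> e X"
    if X: "X \<in> tangent_space M e" for X c
  proof -
    obtain u where u: "u \<in> vfields N" "u (\<pi> e) = push N \<pi> X" using extend_push[OF X] by blast
    have "pullback_form M N \<pi> \<beta> e (c *\<^sub>R X) = \<beta> (fun_times_vfield (\<lambda>_. c) u) e"
      by (rule ap[OF subspace_scale[OF subspace_tangent_space X] fun_times_vfield_vfields[OF Cinf_const u(1)]])
        (simp add: push_scaleR u fun_times_vfield_def)
    also have "\<dots> = c * \<beta> u e"
    proof -
      have "\<beta> (fun_times_vfield (\<lambda>_. c) u) = ((\<lambda>_. c) \<circ> \<pi>) * \<beta> u"
        using \<beta> u(1) Cinf_const[of c N] unfolding module_map_def by blast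
      then show ?thesis by simp
    qed
    finally show ?thesis by (simp add: ap[OF X u])
  qed
  ultimately show ?thesis by (auto simp: cotangent_space_def pullback_form_def)
qed

text \<open>
  On a vector field \<open>X\<close>, the function \<open>(\<kappa> \<circ> \<pi>) (\<pi>\<^sup>*\<beta>)(X)\<close> is the finite sum of the products of
  \<open>X(x i \<circ> \<pi>)\<close> and \<open>\<beta>(E i)\<close>.
\<close>

lemma pullback_form_one_form:
  assumes \<beta>: "module_map M N \<pi> \<beta>"
  shows "pullback_form M N \<pi> \<beta> \<in> one_forms M"
  unfolding one_forms_def
proof (intro CollectI conjI allI ballI)
  show "pullback_form M N \<pi> \<beta> e \<in> cotangent_space M e" for e by (rule pullback_form_cotangent[OF \<beta>])
  fix X assume X: "X \<in> vfields M"
  let ?F = "\<lambda>e. pullback_form M N \<pi> \<beta> e (X e)"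
  show "?F \<in> Cinf M"
  proof (rule Cinf_local)
    fix e0
    obtain I \<kappa> x E where fr: "finite (I :: 'n set)" "\<kappa> \<in> Cinf N" "\<kappa> (\<pi> e0) \<noteq> 0"
      "\<And>i. i \<in> I \<Longrightarrow> x i \<in> Cinf N" "\<And>i. i \<in> I \<Longrightarrow> E i \<in> vfields N"
      "\<And>q v. v \<in> tangent_space N q \<Longrightarrow> \<kappa> q *\<^sub>R v = (\<Sum>i\<in>I. v (x i) *\<^sub>R E i q)"
      using local_frame[OF base_manifold, of "\<pi> e0"] by blast
    have "(\<kappa> \<circ> \<pi>) * ?F = (\<Sum>i\<in>I. lie_fun X (x i \<circ> \<pi>) * \<beta> (E i))"
    proof
      fix e
      obtain u where u: "u \<in> vfields N" "u (\<pi> e) = push N \<pi> (X e)"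
        using extend_push[OF vfields_tangent[OF X]] by blast
      have "((\<kappa> \<circ> \<pi>) * ?F) e = \<kappa> (\<pi> e) * \<beta> u e"
        by (simp add: pullback_form_apply[OF \<beta> vfields_tangent[OF X] u])
      also have "\<dots> = (\<Sum>i\<in>I. u (\<pi> e) (x i) * \<beta> (E i) e)"
        by (rule module_map_frame[OF \<beta> fr(1,2,4,5,6) u(1)])
      also have "\<dots> = (\<Sum>i\<in>I. lie_fun X (x i \<circ> \<pi>) * \<beta> (E i)) e"
        using fr(4) by (simp add: sum_fun_apply lie_fun_def u(2) push_def)
      finally show "((\<kappa> \<circ> \<pi>) * ?F) e = (\<Sum>i\<in>I. lie_fun X (x i \<circ> \<pi>) * \<beta> (E i)) e" .
    qed
    also have "\<dots> \<in> Cinf M"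
      using \<beta> fr(4,5) by (intro Cinf_sum Cinf_mult vfields_Cinf[OF X] comp_Cinf) (auto simp: module_map_def)
    finally show "\<exists>\<kappa>\<in>Cinf M. \<kappa> e0 \<noteq> 0 \<and> \<kappa> * ?F \<in> Cinf M"
      using fr(2,3) comp_Cinf by (intro bexI[of _ "\<kappa> \<circ> \<pi>"]) auto
  qed
qed

lemma pullback_form_annihilator:
  assumes \<beta>: "module_map M N \<pi> \<beta>"
  shows "pullback_form M N \<pi> \<beta> e \<in> annihilator M e (vertical M N \<pi> e)"
proof -
  have z: "0 \<in> vfields N" by (rule subspace_0[OF subspace_vfields])
  have "\<beta> (0 + 0) = \<beta> 0 + \<beta> 0" using \<beta> z unfolding module_map_def by blast
  then have "\<beta> 0 = 0" by simp
  then have "pullback_form M N \<pi> \<beta> e w = 0" if "w \<in> vertical M N \<pi> e" for w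
    using that pullback_form_apply[OF \<beta> _ z, of w e] by (simp add: vertical_def)
  then show ?thesis by (simp add: annihilator_def pullback_form_cotangent[OF \<beta>])
qed

lemma push_lie_bracket:
  assumes X: "X \<in> vfields M" "\<And>e. push N \<pi> (X e) = u (\<pi> e)" and u: "u \<in> vfields N"
    and Y: "Y \<in> vfields M" "\<And>e. push N \<pi> (Y e) = v (\<pi> e)" and v: "v \<in> vfields N"
  shows "push N \<pi> (lie_bracket X Y e) = lie_bracket u v (\<pi> e)"
proof
  fix g
  show "push N \<pi> (lie_bracket X Y e) g = lie_bracket u v (\<pi> e) g"
  proof (cases "g \<in> Cinf N")
    case True
    have rel: "W e (h \<circ> \<pi>) = w (\<pi> e) h" if "\<And>e. push N \<pi> (W e) = w (\<pi> e)" "h \<in> Cinf N" for W w h e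
      using fun_cong[OF that(1), of e h] that(2) by (simp add: push_def)
    have "lie_fun Y (g \<circ> \<pi>) = lie_fun v g \<circ> \<pi>" "lie_fun X (g \<circ> \<pi>) = lie_fun u g \<circ> \<pi>"
      using rel[of Y v, OF Y(2) True] rel[of X u, OF X(2) True] by (auto simp: lie_fun_def)
    then show ?thesis
      using True rel[of X u, OF X(2) vfields_Cinf[OF v True]] rel[of Y v, OF Y(2) vfields_Cinf[OF u True]]
      by (simp add: push_def lie_bracket_def)
  next
    case False
    then show ?thesis
      using tangent_notin[OF vfields_tangent[OF lie_bracket_vfields[OF u v]] False] by (simp add: push_def)
  qed
qed

lemma lie_bracket_vertical:
  assumes X: "X \<in> vfields M" "\<And>e. push N \<pi> (X e) = u (\<pi> e)" and u: "u \<in> vfields N"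
    and Y: "Y \<in> vfields M" "\<And>e. Y e \<in> vertical M N \<pi> e"
  shows "lie_bracket X Y e \<in> vertical M N \<pi> e"
proof -
  have "push N \<pi> (lie_bracket X Y e) = lie_bracket u 0 (\<pi> e)"
    using Y(2) by (intro push_lie_bracket[OF X u Y(1)] subspace_0[OF subspace_vfields]) (simp add: vertical_def)
  also have "\<dots> = 0"
  proof
    fix g :: "'b \<Rightarrow> real"
    have "lie_fun 0 g = 0" by (auto simp: lie_fun_def)
    then show "lie_bracket u 0 (\<pi> e) g = 0 g"
      using tangent_zero[OF vfields_tangent[OF u]] by (simp add: lie_bracket_def)
  qed
  finally show ?thesis using vfields_tangent[OF lie_bracket_vfields[OF X(1) Y(1)]] by (simp add: vertical_def)
qed

end

section \<open>Horizontal forms of degree one and two\<close>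

lemma hforms_1_iff:
  "\<beta> \<in> hforms N \<pi> 1 A \<longleftrightarrow>
    (\<forall>u\<in>vfields N. \<beta> [u] \<in> A) \<and>
    (\<forall>u\<in>vfields N. \<forall>v\<in>vfields N. \<beta> [u + v] = \<beta> [u] + \<beta> [v]) \<and>
    (\<forall>f\<in>Cinf N. \<forall>u\<in>vfields N. \<beta> [fun_times_vfield f u] = (f \<circ> \<pi>) * \<beta> [u]) \<and>
    (\<forall>us. \<not> (\<exists>u\<in>vfields N. us = [u]) \<longrightarrow> \<beta> us = 0)"
proof -
  have len: "length us = 1 \<and> set us \<subseteq> vfields N \<longleftrightarrow> (\<exists>u\<in>vfields N. us = [u])" for us
    by (auto simp: length_Suc_conv)
  have all: "(\<forall>us. (\<exists>u\<in>vfields N. us = [u]) \<longrightarrow> R us) \<longleftrightarrow> (\<forall>u\<in>vfields N. R [u])" for R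
    by blast
  have z: "0 \<in> vfields N" by (rule subspace_0[OF subspace_vfields])
  show ?thesis
    unfolding hforms_def len mem_Collect_eq all using z by auto
qed

lemma hforms_1_module_map:
  assumes "\<beta> \<in> hforms N \<pi> 1 A" "A \<subseteq> Cinf M"
  shows "module_map M N \<pi> (\<lambda>u. \<beta> [u])"
  using assms unfolding hforms_1_iff module_map_def by blast

lemma subspace_hforms_1:
  assumes A: "subspace A"
  shows "subspace (hforms N \<pi> 1 A)"
proof (rule subspaceI)
  show "0 \<in> hforms N \<pi> 1 A"
    unfolding hforms_1_iff using subspace_0[OF A] by simp
next
  fix \<beta> \<eta> assume "\<beta> \<in> hforms N \<pi> 1 A" "\<eta> \<in> hforms N \<pi> 1 A"
  then show "\<beta> + \<eta> \<in> hforms N \<pi> 1 A"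
    unfolding hforms_1_iff using subspace_add[OF A] by (simp add: distrib_left)
next
  fix c \<beta> assume "\<beta> \<in> hforms N \<pi> 1 A"
  then show "c *\<^sub>R \<beta> \<in> hforms N \<pi> 1 A"
    unfolding hforms_1_iff using subspace_scale[OF A] by (simp add: scaleR_add_right) (simp add: fun_eq_iff)
qed

text \<open>
  The contractions of a 2-form in either argument, and skew symmetry by polarization.
\<close>

lemma hforms_2:
  assumes \<sigma>: "\<sigma> \<in> hforms N \<pi> 2 A" and A: "A \<subseteq> Cinf M" and u: "u \<in> vfields N"
  shows "module_map M N \<pi> (\<lambda>v. \<sigma> [u, v])" and "module_map M N \<pi> (\<lambda>v. \<sigma> [v, u])"
    and "v \<in> vfields N \<Longrightarrow> \<sigma> [u, v] = - \<sigma> [v, u]"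
proof -
  have s: "length us = 2 \<Longrightarrow> set us \<subseteq> vfields N \<Longrightarrow>
      \<sigma> us \<in> A \<and>
      (\<forall>i<2. \<forall>u\<in>vfields N. \<forall>v\<in>vfields N. \<sigma> (us[i := u + v]) = \<sigma> (us[i := u]) + \<sigma> (us[i := v])) \<and>
      (\<forall>i<2. \<forall>f\<in>Cinf N. \<forall>u\<in>vfields N.
        \<sigma> (us[i := fun_times_vfield f u]) = (f \<circ> \<pi>) * \<sigma> (us[i := u])) \<and>
      (\<forall>i<2. \<forall>j<2. i \<noteq> j \<and> us ! i = us ! j \<longrightarrow> \<sigma> us = 0)" for us
    using \<sigma> by (simp add: hforms_def)
  have C: "\<sigma> [u, v] \<in> A" if "u \<in> vfields N" "v \<in> vfields N" for u v
    using s[of "[u, v]"] that by simp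
  have a1: "\<sigma> [u + w, v] = \<sigma> [u, v] + \<sigma> [w, v]" and a2: "\<sigma> [v, u + w] = \<sigma> [v, u] + \<sigma> [v, w]"
    and m1: "f \<in> Cinf N \<Longrightarrow> \<sigma> [fun_times_vfield f u, v] = (f \<circ> \<pi>) * \<sigma> [u, v]"
    and m2: "f \<in> Cinf N \<Longrightarrow> \<sigma> [v, fun_times_vfield f u] = (f \<circ> \<pi>) * \<sigma> [v, u]"
    and d: "\<sigma> [u, u] = 0"
    if "u \<in> vfields N" "v \<in> vfields N" "w \<in> vfields N" for u v w f
    using s[of "[u, v]", THEN conjunct2, THEN conjunct1, rule_format, of 0 u w]
      s[of "[v, u]", THEN conjunct2, THEN conjunct1, rule_format, of 1 u w]
      s[of "[u, v]", THEN conjunct2, THEN conjunct2, THEN conjunct1, rule_format, of 0 f u]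
      s[of "[v, u]", THEN conjunct2, THEN conjunct2, THEN conjunct1, rule_format, of 1 f u]
      s[of "[u, u]", THEN conjunct2, THEN conjunct2, THEN conjunct2, rule_format, of 0 1] that
    by simp_all
  show "module_map M N \<pi> (\<lambda>v. \<sigma> [u, v])" "module_map M N \<pi> (\<lambda>v. \<sigma> [v, u])"
    unfolding module_map_def
    using subsetD[OF A C] u a2[OF _ u] a1[OF _ u] m1[OF _ u] m2[OF _ u] by simp_all
  assume v: "v \<in> vfields N"
  have uv: "u + v \<in> vfields N" by (rule subspace_add[OF subspace_vfields u v])
  have "0 = \<sigma> [u + v, u + v]" using d[OF uv uv uv] by simp
  also have "\<dots> = \<sigma> [u, v] + \<sigma> [v, u]"
    by (simp add: a1[OF u uv v] a2[OF u u v] a2[OF u v v] d[OF u u u] d[OF v v v])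
  finally show "\<sigma> [u, v] = - \<sigma> [v, u]" by (simp add: eq_neg_iff_add_eq_0)
qed

lemma cov_ext_deriv_pair:
  assumes "u \<in> vfields N" "v \<in> vfields N"
  shows "cov_ext_deriv M N \<pi> \<gamma> \<beta> [u, v] =
    lie_fun (hor_lift M N \<pi> \<gamma> u) (\<beta> [v]) - lie_fun (hor_lift M N \<pi> \<gamma> v) (\<beta> [u]) - \<beta> [lie_bracket u v]"
proof -
  have "{(i, j). i < j \<and> j < Suc (Suc 0)} = {(0, 1::nat)}" by auto
  then show ?thesis using assms by (simp add: cov_ext_deriv_def remove_nth_def lessThan_Suc)
qed

text \<open>
  With \<open>cov_ext_deriv_pair\<close>, this reduces identities between 2-forms to lists of length two.
\<close>

lemma cov_ext_deriv_not_pair: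
  assumes \<beta>: "\<And>us. length us \<noteq> 1 \<Longrightarrow> \<beta> us = 0"
    and h: "\<And>u. u \<in> vfields N \<Longrightarrow> hor_lift M N \<pi> \<gamma> u \<in> vfields M"
    and us: "\<not> (\<exists>u\<in>vfields N. \<exists>v\<in>vfields N. us = [u, v])"
  shows "cov_ext_deriv M N \<pi> \<gamma> \<beta> us = 0"
proof (cases "set us \<subseteq> vfields N")
  case True
  with us have l: "length us \<noteq> 2" by (auto simp: length_Suc_conv numeral_2_eq_2)
  have 1: "lie_fun (hor_lift M N \<pi> \<gamma> (us ! i)) (\<beta> (remove_nth i us)) = 0" if i: "i < length us" for i
  proof -
    have "\<beta> (remove_nth i us) = 0" using l i by (intro \<beta>) (auto simp: remove_nth_def)
    moreover have "hor_lift M N \<pi> \<gamma> (us ! i) \<in> vfields M" using True i by (intro h) auto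
    ultimately show ?thesis by (auto simp: lie_fun_def tangent_zero[OF vfields_tangent])
  qed
  have 2: "\<beta> (lie_bracket (us ! i) (us ! j) # remove_nth i (remove_nth j us)) = 0"
    if "i < j" "j < length us" for i j
    using l that by (intro \<beta>) (auto simp: remove_nth_def)
  have "(\<Sum>i<length us. (-1) ^ i *\<^sub>R lie_fun (hor_lift M N \<pi> \<gamma> (us ! i)) (\<beta> (remove_nth i us))) = 0"
    by (rule sum.neutral) (simp add: 1)
  moreover have "(\<Sum>(i, j) | i < j \<and> j < length us.
         (-1) ^ (i + j) *\<^sub>R \<beta> (lie_bracket (us ! i) (us ! j) # remove_nth i (remove_nth j us))) = 0"
    by (rule sum.neutral) (auto simp: 2)
  ultimately show ?thesis by (simp add: cov_ext_deriv_def)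
qed (simp add: cov_ext_deriv_def)

section \<open>Splitting a space of pairs\<close>

text \<open>
  The projection of \<open>W\<close> to the second factor has a linear section \<open>s\<close>, and \<open>(a, b) \<mapsto> (a - fst(s b), b)\<close>
  straightens \<open>W\<close> to the product of the kernel and the image.
\<close>

lemma vs_isomorphic_split:
  fixes W :: "('a::real_vector \<times> 'b::real_vector) set" and S :: "'c::real_vector set"
  assumes W: "subspace W" and S: "subspace S" and bij: "bij_betw \<Psi> W S"
    and add: "\<And>x y. x \<in> W \<Longrightarrow> y \<in> W \<Longrightarrow> \<Psi> (x + y) = \<Psi> x + \<Psi> y"
    and scale: "\<And>c x. x \<in> W \<Longrightarrow> \<Psi> (c *\<^sub>R x) = c *\<^sub>R \<Psi> x"
  shows "vs_isomorphic S ({a. (a, 0) \<in> W} \<times> snd ` W)"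
proof -
  let ?K = "{a. (a, 0) \<in> W}" and ?R = "snd ` W"
  have K: "subspace ?K"
    using subspace_0[OF W] subspace_add[OF W] subspace_scale[OF W]
    by (fastforce simp: subspace_def zero_prod_def)
  have lsnd: "linear (snd :: 'a \<times> 'b \<Rightarrow> 'b)" by (simp add: linear_iff)
  obtain s where s: "range s \<subseteq> W" "linear s" "\<And>v. v \<in> ?R \<Longrightarrow> snd (s v) = v"
    using real_vector.linear_exists_right_inverse_on[OF lsnd W] by blast
  \<comment> \<open>the straightening and its inverse\<close>
  define \<Theta> where "\<Theta> = (\<lambda>w. (fst w - fst (s (snd w)), snd w))"
  define \<Xi> where "\<Xi> = (\<lambda>z. s (snd z) + (fst z, 0))"
  have \<Theta>W: "\<Theta> w \<in> ?K \<times> ?R" "\<Xi> (\<Theta> w) = w" if w: "w \<in> W" for w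
  proof -
    have e: "snd (s (snd w)) = snd w" using s(3) w by blast
    have "w - s (snd w) \<in> W" using s(1) w by (intro subspace_diff[OF W]) auto
    moreover have "w - s (snd w) = (fst w - fst (s (snd w)), 0)" using e by (simp add: prod_eq_iff)
    ultimately show "\<Theta> w \<in> ?K \<times> ?R" using w by (simp add: \<Theta>_def)
    show "\<Xi> (\<Theta> w) = w" using e by (simp add: \<Xi>_def \<Theta>_def prod_eq_iff)
  qed
  have \<Xi>W: "\<Xi> z \<in> W" "\<Theta> (\<Xi> z) = z" if z: "z \<in> ?K \<times> ?R" for z
  proof -
    have "s (snd z) \<in> W" "(fst z, 0) \<in> W" using s(1) z by auto
    then show "\<Xi> z \<in> W" unfolding \<Xi>_def by (rule subspace_add[OF W])
    have "snd (s (snd z)) = snd z" using s(3) z by (simp add: mem_Times_iff)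
    then show "\<Theta> (\<Xi> z) = z" by (simp add: \<Xi>_def \<Theta>_def prod_eq_iff)
  qed
  have b\<Theta>: "bij_betw \<Theta> W (?K \<times> ?R)"
    by (rule bij_betw_byWitness[where f' = \<Xi>])
      (intro ballI image_subsetI, erule \<Theta>W \<Xi>W)+
  define \<Phi> where "\<Phi> = \<Theta> \<circ> inv_into W \<Psi>"
  have inv: "inv_into W \<Psi> x \<in> W" "\<Psi> (inv_into W \<Psi> x) = x" if "x \<in> S" for x
    using that bij by (auto simp: bij_betw_def inv_into_into f_inv_into_f)
  have inj: "inv_into W \<Psi> (\<Psi> w) = w" if "w \<in> W" for w
    using that bij by (simp add: bij_betw_def)
  have iadd: "inv_into W \<Psi> (x + y) = inv_into W \<Psi> x + inv_into W \<Psi> y" if "x \<in> S" "y \<in> S" for x y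
    using inj[of "inv_into W \<Psi> x + inv_into W \<Psi> y"] inv that by (simp add: add subspace_add[OF W])
  have iscale: "inv_into W \<Psi> (c *\<^sub>R x) = c *\<^sub>R inv_into W \<Psi> x" if "x \<in> S" for x c
    using inj[of "c *\<^sub>R inv_into W \<Psi> x"] inv that by (simp add: scale subspace_scale[OF W])
  have "bij_betw \<Phi> S (?K \<times> ?R)"
    unfolding \<Phi>_def by (rule bij_betw_trans[OF bij_betw_inv_into[OF bij] b\<Theta>])
  moreover have "\<Phi> (x + y) = \<Phi> x + \<Phi> y" if "x \<in> S" "y \<in> S" for x y
    using that by (simp add: \<Phi>_def iadd \<Theta>_def linear_add[OF s(2)])
  moreover have "\<Phi> (c *\<^sub>R x) = c *\<^sub>R \<Phi> x" if "x \<in> S" for x c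
    using that by (simp add: \<Phi>_def iscale \<Theta>_def linear_scale[OF s(2)] scaleR_diff_right)
  moreover have "subspace (?K \<times> ?R)"
    by (intro subspace_Times K linear_subspace_image[OF lsnd W])
  ultimately show ?thesis unfolding vs_isomorphic_def using S by blast
qed

section \<open>Linearity in the vector field\<close>

text \<open>
  Differences are what occurs in \<open>Z = Y - Q\<^sup>\<sharp>(\<pi>\<^sup>*\<beta>)\<close>.
\<close>

lemma lie_bivec_form_diff_field:
  fixes M :: "('e::{t2_space, second_countable_topology}, 'm::euclidean_space) atlas"
  assumes Q: "Q \<in> bivector_fields M" and X: "X \<in> vfields M" and Y: "Y \<in> vfields M"
    and \<alpha>: "\<alpha> \<in> one_forms M" and \<beta>: "\<beta> \<in> one_forms M"
  shows "lie_bivec_form M (Y - X) Q p \<alpha> \<beta> = lie_bivec_form M Y Q p \<alpha> \<beta> - lie_bivec_form M X Q p \<alpha> \<beta>"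
proof -
  have br: "\<theta> p (lie_bracket (Y - X) Z p) = \<theta> p (lie_bracket Y Z p) - \<theta> p (lie_bracket X Z p)"
    if "\<theta> \<in> one_forms M" "Z \<in> vfields M" for \<theta> Z
  proof -
    have YX: "Y - X \<in> vfields M" by (rule subspace_diff[OF subspace_vfields Y X])
    have "lie_bracket (Y - X + X) Z = lie_bracket (Y - X) Z + lie_bracket X Z"
      by (rule lie_bracket_add_left[OF YX X that(2)])
    then have "lie_bracket Y Z p = lie_bracket (Y - X) Z p + lie_bracket X Z p" by simp
    then show ?thesis
      using cotangent_add[OF one_forms_cotangent[OF that(1)]
          vfields_tangent[OF lie_bracket_vfields[OF YX that(2)]] vfields_tangent[OF lie_bracket_vfields[OF X that(2)]], of p]
      by simp
  qed
  show ?thesis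
    unfolding lie_bivec_form_def br[OF \<alpha> sharp_form_vfields[OF Q \<beta>]] br[OF \<beta> sharp_form_vfields[OF Q \<alpha>]] by simp
qed

lemma subspace_Poiss:
  fixes M :: "('e::{t2_space, second_countable_topology}, 'm::euclidean_space) atlas"
  assumes M: "smooth_manifold M" and Q: "Q \<in> bivector_fields M"
  shows "subspace (Poiss M Q)"
proof -
  have V: "Z \<in> vfields M" if "Z \<in> Poiss M Q" for Z using that by (simp add: Poiss_def)
  have D: "lie_bivec_form M Z Q p \<alpha> \<beta> = 0" if "Z \<in> Poiss M Q" "\<alpha> \<in> one_forms M" "\<beta> \<in> one_forms M" for Z p \<alpha> \<beta>
    using that Poiss_iff[OF M Q V] by blast
  have I: "Z \<in> Poiss M Q"
    if "Z \<in> vfields M" "\<And>\<alpha> \<beta> p. \<alpha> \<in> one_forms M \<Longrightarrow> \<beta> \<in> one_forms M \<Longrightarrow> lie_bivec_form M Z Q p \<alpha> \<beta> = 0" for Z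
    using that Poiss_iff[OF M Q] by blast
  have z: "0 \<in> vfields M" by (rule subspace_0[OF subspace_vfields])
  have z': "0 \<in> Poiss M Q"
    using lie_bivec_form_diff_field[OF Q z z] by (intro I z) simp
  have diff: "Y - X \<in> Poiss M Q" if "X \<in> Poiss M Q" "Y \<in> Poiss M Q" for X Y
  proof (rule I[OF subspace_diff[OF subspace_vfields V[OF that(2)] V[OF that(1)]]])
    show "lie_bivec_form M (Y - X) Q p \<alpha> \<beta> = 0" if "\<alpha> \<in> one_forms M" "\<beta> \<in> one_forms M" for \<alpha> \<beta> p
      unfolding lie_bivec_form_diff_field[OF Q V[OF \<open>X \<in> Poiss M Q\<close>] V[OF \<open>Y \<in> Poiss M Q\<close>] that]
      using D[OF \<open>X \<in> Poiss M Q\<close> that] D[OF \<open>Y \<in> Poiss M Q\<close> that] by simp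
  qed
  show ?thesis
  proof (rule subspaceI)
    show "0 \<in> Poiss M Q" by (rule z')
    show "X + Y \<in> Poiss M Q" if "X \<in> Poiss M Q" "Y \<in> Poiss M Q" for X Y
      using diff[OF diff[OF that(1) z'] that(2)] by (simp add: add.commute)
    fix c X assume X: "X \<in> Poiss M Q"
    have cX: "c *\<^sub>R X \<in> vfields M" by (rule subspace_scale[OF subspace_vfields V[OF X]])
    show "c *\<^sub>R X \<in> Poiss M Q"
    proof (rule I[OF cX])
      fix \<alpha> \<beta> p assume forms: "\<alpha> \<in> one_forms M" "\<beta> \<in> one_forms M"
      have "lie_bracket (c *\<^sub>R X) Y p = c *\<^sub>R lie_bracket X Y p" if Y: "Y \<in> vfields M" for Y
      proof
        fix f
        have "lie_fun (c *\<^sub>R X) f = c *\<^sub>R lie_fun X f" by (auto simp: lie_fun_def)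
        moreover have "Y p (c *\<^sub>R lie_fun X f) = c * Y p (lie_fun X f)"
        proof (cases "f \<in> Cinf M")
          case True
          then show ?thesis by (intro tangent_scaleR[OF vfields_tangent[OF Y]] vfields_Cinf[OF V[OF X]])
        next
          case False
          then show ?thesis using lie_fun_notin[OF V[OF X] False] tangent_zero[OF vfields_tangent[OF Y]] by simp
        qed
        ultimately show "lie_bracket (c *\<^sub>R X) Y p f = (c *\<^sub>R lie_bracket X Y p) f"
          by (simp add: lie_bracket_def right_diff_distrib)
      qed
      then have "\<theta> p (lie_bracket (c *\<^sub>R X) Y p) = c * \<theta> p (lie_bracket X Y p)"
        if "\<theta> \<in> one_forms M" "Y \<in> vfields M" for \<theta> Y
        using that lie_bracket_vfields[OF V[OF X] that(2)]
        by (simp add: cotangent_scaleR[OF one_forms_cotangent vfields_tangent])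
      then have "lie_bivec_form M (c *\<^sub>R X) Q p \<alpha> \<beta> = c * lie_bivec_form M X Q p \<alpha> \<beta>"
        using forms sharp_form_vfields[OF Q] by (simp add: lie_bivec_form_def right_diff_distrib)
      then show "lie_bivec_form M (c *\<^sub>R X) Q p \<alpha> \<beta> = 0" using D[OF X forms] by simp
    qed
  qed
qed

lemma sharp_d_add:
  assumes "P \<in> bivector_fields M" "f \<in> Cinf M" "g \<in> Cinf M"
  shows "sharp_d M P (f + g) = sharp_d M P f + sharp_d M P g"
  by (rule ext) (simp add: sharp_d_def differential_add assms(2,3) sharp_add[of P, OF bivector_at[OF assms(1)]] differential_cotangent)

lemma sharp_d_scaleR:
  assumes "P \<in> bivector_fields M" "f \<in> Cinf M"
  shows "sharp_d M P (c *\<^sub>R f) = c *\<^sub>R sharp_d M P f"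
  by (rule ext) (simp add: sharp_d_def differential_scaleR assms(2) sharp_scaleR[of P, OF bivector_at[OF assms(1)]] differential_cotangent)

lemma subspace_Casim:
  assumes "P \<in> bivector_fields M"
  shows "subspace (Casim M P)"
proof (rule subspaceI)
  show "0 \<in> Casim M P" using sharp_d_scaleR[OF assms Cinf_zero, of 0] by (simp add: Casim_def)
qed (auto simp: Casim_def sharp_d_add[OF assms] sharp_d_scaleR[OF assms])

section \<open>Horizontal and vertical parts for a coupling tensor\<close>

locale coupling_data =
  fixes M :: "('e::{t2_space, second_countable_topology}, 'm::euclidean_space) atlas"
    and N :: "('b::{t2_space, second_countable_topology}, 'n::euclidean_space) atlas"
    and \<pi> :: "'e \<Rightarrow> 'b"
    and Q Q20 P :: "'e bivec"
    and \<gamma> :: "'e \<Rightarrow> 'e tvec \<Rightarrow> 'e tvec"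
    and \<sigma> :: "('b, 'e) hform"
  assumes fb: "fiber_bundle M N \<pi>"
    and poisson: "poisson_tensor M Q"
    and coup: "coupling M N \<pi> Q"
    and gd: "geometric_data M N \<pi> Q Q20 \<gamma> \<sigma> P"
begin

abbreviation "Vert e \<equiv> vertical M N \<pi> e"
abbreviation "Hor e \<equiv> horizontal M N \<pi> Q e"
abbreviation "Vert0 e \<equiv> annihilator M e (Vert e)"
abbreviation "hor u \<equiv> hor_lift M N \<pi> \<gamma> u"

lemma M: "smooth_manifold M" and N: "smooth_manifold N"
  using fb by (simp_all add: fiber_bundle_def)

lemma Q: "Q \<in> bivector_fields M" using poisson by (simp add: poisson_tensor_def)

lemma Q20: "Q20 \<in> bivector_fields M" and P: "P \<in> bivector_fields M"
  and Q_eq: "Q e = Q20 e + P e"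
  and \<sigma>: "\<sigma> \<in> hforms N \<pi> 2 (Cinf M)"
  using gd by (simp_all add: geometric_data_def)

lemma Vert0_cotangent: "\<alpha> \<in> Vert0 e \<Longrightarrow> \<alpha> \<in> cotangent_space M e"
  by (simp add: annihilator_def)

lemma P_annihilates: "\<alpha> \<in> Vert0 e \<Longrightarrow> \<beta> \<in> cotangent_space M e \<Longrightarrow> P e \<alpha> \<beta> = 0"
  using gd by (simp add: geometric_data_def wedge2_def)

lemma Q20_annihilates: "\<alpha> \<in> annihilator M e (Hor e) \<Longrightarrow> \<beta> \<in> cotangent_space M e \<Longrightarrow> Q20 e \<alpha> \<beta> = 0"
  using gd by (simp add: geometric_data_def wedge2_def)

lemma sharp_Q: "sharp M Q e \<alpha> = sharp M Q20 e \<alpha> + sharp M P e \<alpha>"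
  by (auto simp: sharp_def Q_eq)

lemma sharp_Q_Vert0: "\<alpha> \<in> Vert0 e \<Longrightarrow> sharp M Q e \<alpha> = sharp M Q20 e \<alpha>"
  using P_annihilates[of \<alpha> e] by (auto simp: sharp_def Q_eq differential_cotangent)

lemma comp_differential_Vert0: "g \<in> Cinf N \<Longrightarrow> differential M (g \<circ> \<pi>) e \<in> Vert0 e"
  by (auto simp: annihilator_def differential_cotangent vertical_def differential_apply push_def fun_eq_iff)

lemma sharp_P_vertical:
  assumes \<alpha>: "\<alpha> \<in> cotangent_space M e"
  shows "sharp M P e \<alpha> \<in> Vert e"
proof -
  have "push N \<pi> (sharp M P e \<alpha>) g = 0" for g
  proof (cases "g \<in> Cinf N")
    case True
    have "P e \<alpha> (differential M (g \<circ> \<pi>) e) = - P e (differential M (g \<circ> \<pi>) e) \<alpha>"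
      by (rule bivector_skew[OF bivector_at[OF P]])
    then show ?thesis
      using P_annihilates[OF comp_differential_Vert0[OF True] \<alpha>]
      by (simp add: push_def sharp_def)
  qed (simp add: push_def)
  then show ?thesis
    using sharp_tangent[of P e M \<alpha>, OF bivector_at[OF P] \<alpha>] by (auto simp: vertical_def)
qed

lemma Hor_tangent: "h \<in> Hor e \<Longrightarrow> h \<in> tangent_space M e"
  unfolding horizontal_def
  using sharp_tangent[of Q e M, OF bivector_at[OF Q] Vert0_cotangent] by auto

lemma Vert_tangent: "v \<in> Vert e \<Longrightarrow> v \<in> tangent_space M e"
  by (simp add: vertical_def)

lemma subspace_Hor: "subspace (Hor e)"
proof (rule subspaceI)
  note bQ = bivector_at[OF Q, of e]
  show "0 \<in> Hor e" unfolding horizontal_def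
  proof (rule image_eqI)
    have "sharp M Q e (0 *\<^sub>R 0) = 0 *\<^sub>R sharp M Q e 0"
      by (rule sharp_scaleR[of Q, OF bQ subspace_0[OF subspace_cotangent_space]])
    then show "0 = sharp M Q e 0" by simp
    show "0 \<in> Vert0 e" by (rule subspace_0[OF subspace_annihilator])
  qed
next
  fix x y assume "x \<in> Hor e" "y \<in> Hor e"
  then obtain \<alpha> \<beta> where ab: "\<alpha> \<in> Vert0 e" "\<beta> \<in> Vert0 e" "x = sharp M Q e \<alpha>" "y = sharp M Q e \<beta>"
    unfolding horizontal_def by (elim imageE)
  show "x + y \<in> Hor e" unfolding horizontal_def
    by (rule image_eqI[OF _ subspace_add[OF subspace_annihilator ab(1,2)]])
      (simp add: ab sharp_add[of Q, OF bivector_at[OF Q]] Vert0_cotangent)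
next
  fix c x assume "x \<in> Hor e"
  then obtain \<alpha> where a: "\<alpha> \<in> Vert0 e" "x = sharp M Q e \<alpha>"
    unfolding horizontal_def by (elim imageE)
  show "c *\<^sub>R x \<in> Hor e" unfolding horizontal_def
    by (rule image_eqI[OF _ subspace_scale[OF subspace_annihilator a(1), of c]])
      (simp add: a sharp_scaleR[of Q, OF bivector_at[OF Q]] Vert0_cotangent)
qed

lemma Hor_Vert_decomp:
  assumes "X \<in> tangent_space M e"
  obtains h v where "h \<in> Hor e" "v \<in> Vert e" "X = h + v"
proof -
  have "tangent_space M e = {h + v |h v. h \<in> Hor e \<and> v \<in> Vert e}"
    using coup unfolding coupling_def by (elim allE[of _ e] conjE)
  with assms show thesis by (auto intro: that)
qed

lemma Hor_Vert_zero: "X \<in> Hor e \<Longrightarrow> X \<in> Vert e \<Longrightarrow> X = 0"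
  using coup unfolding coupling_def by blast

text \<open>
  By skew symmetry \<open>\<alpha>(Q\<^sup>\<sharp>\<beta>) = - \<beta>(Q\<^sup>\<sharp>\<alpha>) = 0\<close>, so \<open>\<alpha>\<close> vanishes on the horizontal space; it vanishes on
  the vertical space by assumption, and the two span.
\<close>

lemma sharp_inj:
  assumes \<alpha>: "\<alpha> \<in> Vert0 e" and z: "sharp M Q e \<alpha> = 0"
  shows "\<alpha> = 0"
proof (rule cotangent_eqI[OF Vert0_cotangent[OF \<alpha>] subspace_0[OF subspace_cotangent_space]])
  fix X assume "X \<in> tangent_space M e"
  then obtain h v where hv: "h \<in> Hor e" "v \<in> Vert e" "X = h + v" by (rule Hor_Vert_decomp)
  obtain \<beta> where \<beta>: "\<beta> \<in> Vert0 e" "h = sharp M Q e \<beta>" using hv(1) unfolding horizontal_def by blast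
  have "\<alpha> h = Q e \<beta> \<alpha>"
    unfolding \<beta>(2) by (rule pair_sharp[of M Q, OF M bivector_at[OF Q] Vert0_cotangent[OF \<beta>(1)] Vert0_cotangent[OF \<alpha>]])
  also have "\<dots> = - Q e \<alpha> \<beta>" by (rule bivector_skew[OF bivector_at[OF Q]])
  also have "Q e \<alpha> \<beta> = \<beta> (sharp M Q e \<alpha>)"
    by (rule pair_sharp[of M Q, OF M bivector_at[OF Q] Vert0_cotangent[OF \<alpha>] Vert0_cotangent[OF \<beta>(1)], symmetric])
  also have "\<dots> = 0" unfolding z by (rule cotangent_zero[OF Vert0_cotangent[OF \<beta>(1)]])
  finally have "\<alpha> h = 0" by simp
  moreover have "\<alpha> v = 0" using \<alpha> hv(2) by (simp add: annihilator_def)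
  ultimately show "\<alpha> X = 0 X"
    using cotangent_add[OF Vert0_cotangent[OF \<alpha>] Hor_tangent[OF hv(1)] Vert_tangent[OF hv(2)]] hv(3) by simp
qed

abbreviation "flat_H e \<equiv> inv_into (Vert0 e) (sharp M Q20 e)"

lemma flat_H:
  assumes "h \<in> Hor e"
  shows "flat_H e h \<in> Vert0 e" and "sharp M Q e (flat_H e h) = h"
proof -
  have im: "h \<in> sharp M Q20 e ` Vert0 e"
    using assms sharp_Q_Vert0 unfolding horizontal_def by force
  show *: "flat_H e h \<in> Vert0 e" by (rule inv_into_into[OF im])
  show "sharp M Q e (flat_H e h) = h"
    unfolding sharp_Q_Vert0[OF *] by (rule f_inv_into_f[OF im])
qed

lemma sharp_Vert0_Hor: "\<alpha> \<in> Vert0 e \<Longrightarrow> sharp M Q e \<alpha> \<in> Hor e"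
  by (simp add: horizontal_def)

lemma sharp_inj':
  assumes "\<alpha> \<in> Vert0 e" "\<beta> \<in> Vert0 e" "sharp M Q e \<alpha> = sharp M Q e \<beta>"
  shows "\<alpha> = \<beta>"
proof -
  have m: "(-1) *\<^sub>R \<beta> \<in> Vert0 e" using assms(2) by (rule subspace_scale[OF subspace_annihilator])
  have "sharp M Q e (\<alpha> + (-1) *\<^sub>R \<beta>) = sharp M Q e \<alpha> + (-1) *\<^sub>R sharp M Q e \<beta>"
    using sharp_add[of Q, OF bivector_at[OF Q] Vert0_cotangent[OF assms(1)] Vert0_cotangent[OF m]]
      sharp_scaleR[of Q, OF bivector_at[OF Q] Vert0_cotangent[OF assms(2)], of "-1"] by simp
  also have "\<dots> = 0" using assms(3) by simp
  finally have "\<alpha> + (-1) *\<^sub>R \<beta> = 0"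
    by (rule sharp_inj[OF subspace_add[OF subspace_annihilator assms(1) m]])
  then show ?thesis by simp
qed

lemma flat_H_sharp: "\<alpha> \<in> Vert0 e \<Longrightarrow> flat_H e (sharp M Q e \<alpha>) = \<alpha>"
  using sharp_inj' flat_H sharp_Vert0_Hor by blast

lemma hor_lift_unique:
  assumes "h \<in> Hor e" "h' \<in> Hor e" "push N \<pi> h = push N \<pi> h'"
  shows "h = h'"
proof -
  have d: "h - h' \<in> Hor e" using assms by (intro subspace_diff[OF subspace_Hor])
  have "push N \<pi> (h - h' + h') = push N \<pi> (h - h') + push N \<pi> h'" by (rule push_add)
  then have "push N \<pi> (h - h') = 0" using assms(3) by simp
  then have "h - h' \<in> Vert e" using Hor_tangent[OF d] by (simp add: vertical_def)
  from Hor_Vert_zero[OF d this] show ?thesis by simp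
qed

lemma exists_hor_lift:
  assumes "w \<in> tangent_space N (\<pi> e)"
  shows "\<exists>h\<in>Hor e. push N \<pi> h = w"
proof -
  obtain X where X: "X \<in> tangent_space M e" "push N \<pi> X = w" using push_surj[OF fb assms] by blast
  obtain h v where hv: "h \<in> Hor e" "v \<in> Vert e" "X = h + v" by (rule Hor_Vert_decomp[OF X(1)])
  have "push N \<pi> h = w" using X(2) hv(2,3) by (simp add: push_add vertical_def)
  with hv(1) show ?thesis by blast
qed

lemma \<gamma>_zero_iff:
  assumes "X \<in> tangent_space M e"
  shows "\<gamma> e X = 0 \<longleftrightarrow> X \<in> Hor e"
proof -
  obtain h v where hv: "h \<in> Hor e" "v \<in> Vert e" "X = h + v" by (rule Hor_Vert_decomp[OF assms])
  have g: "\<gamma> e (h + v) = v" if "h \<in> Hor e" "v \<in> Vert e" for h v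
    using gd that unfolding geometric_data_def by blast
  have z: "0 \<in> Vert e" by (rule subspace_0[OF subspace_vertical])
  show ?thesis using g[OF hv(1,2)] g[OF _ z, of X] hv by auto
qed

lemma hor_lift:
  assumes u: "u \<in> vfields N"
  shows "hor u e \<in> Hor e" and "push N \<pi> (hor u e) = u (\<pi> e)"
    and "h \<in> Hor e \<Longrightarrow> push N \<pi> h = u (\<pi> e) \<Longrightarrow> hor u e = h"
proof -
  obtain h0 where h0: "h0 \<in> Hor e" "push N \<pi> h0 = u (\<pi> e)"
    using exists_hor_lift[OF vfields_tangent[OF u]] by blast
  have "hor u e = h" if "h \<in> Hor e" "push N \<pi> h = u (\<pi> e)" for h
    unfolding hor_lift_def
  proof (rule the_equality)
    show "h \<in> tangent_space M e \<and> \<gamma> e h = 0 \<and> push N \<pi> h = u (\<pi> e)"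
      using that Hor_tangent \<gamma>_zero_iff by blast
    show "h' = h" if "h' \<in> tangent_space M e \<and> \<gamma> e h' = 0 \<and> push N \<pi> h' = u (\<pi> e)" for h'
      using hor_lift_unique \<gamma>_zero_iff that \<open>h \<in> Hor e\<close> \<open>push N \<pi> h = u (\<pi> e)\<close> by metis
  qed
  then show "h \<in> Hor e \<Longrightarrow> push N \<pi> h = u (\<pi> e) \<Longrightarrow> hor u e = h" "hor u e \<in> Hor e" "push N \<pi> (hor u e) = u (\<pi> e)"
    using h0 by auto
qed

lemma sigma_module_map: "u \<in> vfields N \<Longrightarrow> module_map M N \<pi> (\<lambda>v. \<sigma> [u, v])"
  and sigma_module_map': "u \<in> vfields N \<Longrightarrow> module_map M N \<pi> (\<lambda>v. \<sigma> [v, u])"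
  and sigma_skew: "u \<in> vfields N \<Longrightarrow> v \<in> vfields N \<Longrightarrow> \<sigma> [u, v] = - \<sigma> [v, u]"
  by (rule hforms_2[OF \<sigma> subset_refl]; assumption)+

section \<open>The adapted coframe\<close>

text \<open>
  The form \<open>\<alpha>\<^sub>u = \<pi>\<^sup>*\<sigma>(\<cdot>, u)\<close>. It is smooth because \<open>\<sigma>\<close> is, before anything is known about the
  smoothness of horizontal lifts.
\<close>

definition lift_form :: "'b vfield \<Rightarrow> 'e \<Rightarrow> 'e covec"
  where "lift_form u = pullback_form M N \<pi> (\<lambda>v. \<sigma> [v, u])"

lemma lift_form_one_form: "u \<in> vfields N \<Longrightarrow> lift_form u \<in> one_forms M"
  unfolding lift_form_def by (rule pullback_form_one_form[OF fb sigma_module_map'])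

lemma lift_form_Vert0: "u \<in> vfields N \<Longrightarrow> lift_form u e \<in> Vert0 e"
  unfolding lift_form_def by (rule pullback_form_annihilator[OF fb sigma_module_map'])

lemma lift_form_apply: "u \<in> vfields N \<Longrightarrow> X \<in> tangent_space M e \<Longrightarrow> w \<in> vfields N \<Longrightarrow> w (\<pi> e) = push N \<pi> X \<Longrightarrow>
    lift_form u e X = \<sigma> [w, u] e"
  unfolding lift_form_def by (rule pullback_form_apply[OF fb sigma_module_map'])

text \<open>
  The definition of the coupling form by \<open>- (Q20\<^sup>\<sharp>)\<close> inverted, evaluated on \<open>hor u\<close>; skew symmetry of
  \<open>\<sigma>\<close> absorbs the sign.
\<close>

lemma lift_form_eq_flat:
  assumes u: "u \<in> vfields N"
  shows "lift_form u e = flat_H e (hor u e)"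
proof (rule cotangent_eqI)
  note h = hor_lift(1)[OF u, of e]
  show "lift_form u e \<in> cotangent_space M e" by (rule Vert0_cotangent[OF lift_form_Vert0[OF u]])
  show "flat_H e (hor u e) \<in> cotangent_space M e" by (rule Vert0_cotangent[OF flat_H(1)[OF h]])
  fix X assume X: "X \<in> tangent_space M e"
  let ?u = "SOME w. w \<in> vfields N \<and> w (\<pi> e) = push N \<pi> (hor u e)"
  let ?x = "SOME w. w \<in> vfields N \<and> w (\<pi> e) = push N \<pi> X"
  have u': "?u \<in> vfields N \<and> ?u (\<pi> e) = push N \<pi> (hor u e)"
    by (rule someI[of _ u]) (simp add: u hor_lift(2)[OF u])
  obtain x0 where x0: "x0 \<in> vfields N" "x0 (\<pi> e) = push N \<pi> X" using extend_push[OF fb X] by blast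
  have x': "?x \<in> vfields N \<and> ?x (\<pi> e) = push N \<pi> X" by (rule someI[of _ x0]) (simp add: x0)
  have "pull_back N \<pi> \<sigma> e [hor u e, X] = - flat_H e (hor u e) X"
    using gd h X unfolding geometric_data_def by blast
  then have "flat_H e (hor u e) X = - \<sigma> [?u, ?x] e" by (simp add: pull_back_def)
  also have "\<sigma> [?u, ?x] e = \<sigma> [u, ?x] e"
    by (rule module_map_tensorial[OF fb sigma_module_map'])
      (use u u' x' hor_lift(2)[OF u] in auto)
  also have "- \<sigma> [u, ?x] e = \<sigma> [?x, u] e" using sigma_skew[OF u, of ?x] x' by simp
  also have "\<dots> = lift_form u e X" using lift_form_apply[OF u X, of ?x] x' by simp
  finally show "lift_form u e X = flat_H e (hor u e) X" by simp
qed

lemma sharp_form_lift_form: "u \<in> vfields N \<Longrightarrow> sharp_form M Q (lift_form u) = hor u"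
  by (rule ext) (simp add: sharp_form_def lift_form_eq_flat flat_H(2) hor_lift(1))

text \<open>
  Smoothness of the horizontal lift is inherited from \<open>\<alpha>\<^sub>u\<close> and \<open>Q\<close>.
\<close>

lemma hor_vfields: "u \<in> vfields N \<Longrightarrow> hor u \<in> vfields M"
  using sharp_form_vfields[OF Q lift_form_one_form] sharp_form_lift_form by metis

lemma lift_form_hor:
  assumes "u \<in> vfields N" "v \<in> vfields N"
  shows "lift_form u e (hor v e) = \<sigma> [v, u] e"
  using lift_form_apply[OF assms(1) Hor_tangent[OF hor_lift(1)[OF assms(2)]] assms(2)] hor_lift(2)[OF assms(2)] by simp

lemma exists_lift_form:
  assumes "\<alpha> \<in> Vert0 e"
  shows "\<exists>u\<in>vfields N. lift_form u e = \<alpha>"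
proof -
  have h: "sharp M Q e \<alpha> \<in> Hor e" by (rule sharp_Vert0_Hor[OF assms])
  obtain u where u: "u \<in> vfields N" "u (\<pi> e) = push N \<pi> (sharp M Q e \<alpha>)"
    using extend_push[OF fb Hor_tangent[OF h]] by blast
  have "hor u e = sharp M Q e \<alpha>" by (rule hor_lift(3)[OF u(1) h]) (simp add: u(2))
  then show ?thesis using u(1) lift_form_eq_flat[OF u(1)] flat_H_sharp[OF assms] by (intro bexI[of _ u]) simp_all
qed

lemma exists_hor:
  assumes "h \<in> Hor e"
  shows "\<exists>u\<in>vfields N. hor u e = h"
proof -
  obtain u where u: "u \<in> vfields N" "u (\<pi> e) = push N \<pi> h"
    using extend_push[OF fb Hor_tangent[OF assms]] by blast
  have "hor u e = h" by (rule hor_lift(3)[OF u(1) assms]) (simp add: u(2))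
  with u(1) show ?thesis by blast
qed

lemma hor_add: "u \<in> vfields N \<Longrightarrow> v \<in> vfields N \<Longrightarrow> hor (u + v) = hor u + hor v"
  by (rule ext, rule hor_lift(3))
    (simp_all add: subspace_add[OF subspace_vfields] subspace_add[OF subspace_Hor] hor_lift push_add)

lemma hor_fun_times: "f \<in> Cinf N \<Longrightarrow> u \<in> vfields N \<Longrightarrow>
    hor (fun_times_vfield f u) = fun_times_vfield (f \<circ> \<pi>) (hor u)"
  by (rule ext, rule hor_lift(3))
    (simp_all add: fun_times_vfield_vfields fun_times_vfield_def[of "f \<circ> \<pi>"] subspace_scale[OF subspace_Hor] hor_lift push_scaleR,
     simp add: fun_times_vfield_def)

lemma hor_module_map:
  assumes f: "f \<in> Cinf M"
  shows "module_map M N \<pi> (\<lambda>u. lie_fun (hor u) f)"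
  unfolding module_map_def
proof (intro conjI ballI)
  show "lie_fun (hor u) f \<in> Cinf M" if "u \<in> vfields N" for u
    by (rule vfields_Cinf[OF hor_vfields[OF that] f])
  show "lie_fun (hor (u + v)) f = lie_fun (hor u) f + lie_fun (hor v) f"
    if "u \<in> vfields N" "v \<in> vfields N" for u v
    by (auto simp: lie_fun_def hor_add that)
  show "lie_fun (hor (fun_times_vfield g u)) f = (g \<circ> \<pi>) * lie_fun (hor u) f"
    if "g \<in> Cinf N" "u \<in> vfields N" for g u
    by (simp add: fun_eq_iff lie_fun_def hor_fun_times that) (simp add: fun_times_vfield_def)
qed

text \<open>
  The differential of \<open>f\<close> composed with the projection to the vertical space, written as \<open>df\<close> minus its
  horizontal part, which is visibly a smooth 1-form.
\<close>

definition vert_d :: "('e \<Rightarrow> real) \<Rightarrow> 'e \<Rightarrow> 'e covec"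
  where "vert_d f = differential M f - pullback_form M N \<pi> (\<lambda>u. lie_fun (hor u) f)"

lemma vert_d_one_form: "f \<in> Cinf M \<Longrightarrow> vert_d f \<in> one_forms M"
  unfolding vert_d_def
  by (intro subspace_diff[OF subspace_one_forms] differential_one_form pullback_form_one_form[OF fb] hor_module_map)

lemma vert_d_vertical: 
  assumes "f \<in> Cinf M" "v \<in> Vert e" shows "vert_d f e v = v f"
proof -
  have "pullback_form M N \<pi> (\<lambda>u. lie_fun (hor u) f) e v = 0"
    using pullback_form_annihilator[OF fb hor_module_map[OF assms(1)], of e] assms(2) by (simp add: annihilator_def)
  then show ?thesis by (simp add: vert_d_def differential_apply[OF Vert_tangent[OF assms(2)]])
qed

lemma vert_d_hor: 
  assumes f: "f \<in> Cinf M" and u: "u \<in> vfields N" shows "vert_d f e (hor u e) = 0"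
proof -
  note t = Hor_tangent[OF hor_lift(1)[OF u, of e]]
  have "pullback_form M N \<pi> (\<lambda>u. lie_fun (hor u) f) e (hor u e) = lie_fun (hor u) f e"
    by (rule pullback_form_apply[OF fb hor_module_map[OF f] t u]) (simp add: hor_lift(2)[OF u])
  then show ?thesis by (simp add: vert_d_def differential_apply[OF t] lie_fun_def)
qed

lemma vert_d_annihilator: "f \<in> Cinf M \<Longrightarrow> vert_d f e \<in> annihilator M e (Hor e)"
  using vert_d_hor exists_hor one_forms_cotangent[OF vert_d_one_form] by (fastforce simp: annihilator_def)

text \<open>
  \<open>Q20\<close> kills the annihilator of the horizontal space, and \<open>P\<close> does not see the horizontal part of \<open>df\<close>.
\<close>

lemma sharp_form_vert_d:
  assumes f: "f \<in> Cinf M"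
  shows "sharp_form M Q (vert_d f) = sharp_d M P f"
proof
  fix e
  let ?h = "pullback_form M N \<pi> (\<lambda>u. lie_fun (hor u) f) e"
  note c = one_forms_cotangent[OF vert_d_one_form[OF f], of e]
  have h: "?h \<in> Vert0 e" by (rule pullback_form_annihilator[OF fb hor_module_map[OF f]])
  have "sharp M Q20 e (vert_d f e) = 0"
    using Q20_annihilates[OF vert_d_annihilator[OF f]] by (auto simp: sharp_def differential_cotangent)
  moreover have "sharp M P e (vert_d f e + ?h) = sharp M P e (vert_d f e) + sharp M P e ?h"
    by (rule sharp_add[of P, OF bivector_at[OF P] c Vert0_cotangent[OF h]])
  moreover have "sharp M P e ?h = 0"
    using P_annihilates[OF h] by (auto simp: sharp_def differential_cotangent)
  moreover have "vert_d f e + ?h = differential M f e" by (simp add: vert_d_def)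
  ultimately show "sharp_form M Q (vert_d f) e = sharp_d M P f e"
    by (simp add: sharp_form_def sharp_d_def sharp_Q)
qed

lemma covector_split:
  assumes f: "f \<in> Cinf M"
  shows "\<exists>u\<in>vfields N. differential M f e = lift_form u e + vert_d f e"
proof -
  obtain u where "u \<in> vfields N" "lift_form u e = pullback_form M N \<pi> (\<lambda>u. lie_fun (hor u) f) e"
    using exists_lift_form[OF pullback_form_annihilator[OF fb hor_module_map[OF f]]] by blast
  then show ?thesis by (intro bexI[of _ u]) (auto simp: vert_d_def)
qed

text \<open>
  At each point the forms \<open>\<alpha>\<^sub>u\<close> and \<open>\<nu>\<^sub>f\<close> span the cotangent space, and the Lie derivative of \<open>Q\<close> is
  tensorial.
\<close>

lemma Poiss_iff_split:
  assumes Z: "Z \<in> vfields M"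
  shows "Z \<in> Poiss M Q \<longleftrightarrow>
    (\<forall>u\<in>vfields N. \<forall>v\<in>vfields N. \<forall>p. lie_bivec_form M Z Q p (lift_form u) (lift_form v) = 0) \<and>
    (\<forall>u\<in>vfields N. \<forall>f\<in>Cinf M. \<forall>p. lie_bivec_form M Z Q p (lift_form u) (vert_d f) = 0) \<and>
    (\<forall>f\<in>Cinf M. \<forall>g\<in>Cinf M. \<forall>p. lie_bivec_form M Z Q p (vert_d f) (vert_d g) = 0)"
    (is "_ \<longleftrightarrow> ?aa \<and> ?an \<and> ?nn")
proof
  assume "Z \<in> Poiss M Q"
  then show "?aa \<and> ?an \<and> ?nn"
    using Poiss_iff[OF M Q Z] lift_form_one_form vert_d_one_form by blast
next
  assume as: "?aa \<and> ?an \<and> ?nn"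
  have "lie_bivec M Z Q f g p = 0" if f: "f \<in> Cinf M" and g: "g \<in> Cinf M" for f g p
  proof -
    let ?L = "lie_bivec_form M Z Q p"
    obtain u where u: "u \<in> vfields N" "differential M f p = lift_form u p + vert_d f p" using covector_split[OF f] by blast
    obtain v where v: "v \<in> vfields N" "differential M g p = lift_form v p + vert_d g p" using covector_split[OF g] by blast
    note o = lift_form_one_form[OF u(1)] lift_form_one_form[OF v(1)] vert_d_one_form[OF f] vert_d_one_form[OF g]
    have "lie_bivec M Z Q f g p = ?L (differential M f) (differential M g)"
      by (rule lie_bivec_form_exact[OF M Q Z f g, symmetric])
    also have "\<dots> = ?L (lift_form u + vert_d f) (lift_form v + vert_d g)"
      by (rule lie_bivec_form_tensorial[OF M Q Z])
        (simp_all add: u v differential_one_form f g one_forms_add o)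
    also have "\<dots> = ?L (lift_form u + vert_d f) (lift_form v) + ?L (lift_form u + vert_d f) (vert_d g)"
      by (intro lie_bivec_form_add[OF M Q Z] one_forms_add o)
    also have "?L (lift_form u + vert_d f) (lift_form v) = - ?L (lift_form v) (lift_form u + vert_d f)"
      by (intro lie_bivec_form_skew[OF M Q Z] one_forms_add o)
    also have "?L (lift_form v) (lift_form u + vert_d f) = ?L (lift_form v) (lift_form u) + ?L (lift_form v) (vert_d f)"
      by (intro lie_bivec_form_add[OF M Q Z] o)
    also have "?L (lift_form u + vert_d f) (vert_d g) = - ?L (vert_d g) (lift_form u + vert_d f)"
      by (intro lie_bivec_form_skew[OF M Q Z] one_forms_add o)
    also have "?L (vert_d g) (lift_form u + vert_d f) = ?L (vert_d g) (lift_form u) + ?L (vert_d g) (vert_d f)"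
      by (intro lie_bivec_form_add[OF M Q Z] o)
    also have "?L (vert_d g) (lift_form u) = - ?L (lift_form u) (vert_d g)"
      by (intro lie_bivec_form_skew[OF M Q Z] o)
    finally show ?thesis using as u(1) v(1) f g by simp
  qed
  then show "Z \<in> Poiss M Q" using Z by (auto simp: Poiss_def fun_eq_iff)
qed

lemma lie_bracket_hor_vertical:
  assumes u: "u \<in> vfields N" and Y: "Y \<in> vfields M" "\<And>e. Y e \<in> Vert e"
  shows "lie_bracket (hor u) Y e \<in> Vert e" and "lie_bracket Y (hor u) e \<in> Vert e"
proof -
  show *: "lie_bracket (hor u) Y e \<in> Vert e"
    by (rule lie_bracket_vertical[OF fb hor_vfields[OF u] hor_lift(2)[OF u] u Y])
  have "lie_bracket Y (hor u) e = - lie_bracket (hor u) Y e"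
    unfolding lie_bracket_skew[of Y "hor u"] by simp
  then show "lie_bracket Y (hor u) e \<in> Vert e" using subspace_neg[OF subspace_vertical *] by simp
qed

lemma lie_bracket_vertical_vertical:
  assumes X: "X \<in> vfields M" "\<And>e. X e \<in> Vert e" and Y: "Y \<in> vfields M" "\<And>e. Y e \<in> Vert e"
  shows "lie_bracket X Y e \<in> Vert e"
  using X(2) by (intro lie_bracket_vertical[OF fb X(1) _ subspace_0[OF subspace_vfields] Y]) (simp add: vertical_def)

lemma sharp_d_P:
  assumes f: "f \<in> Cinf M"
  shows "sharp_d M P f \<in> vfields M" "sharp_d M P f e \<in> Vert e"
  using sharp_form_vfields[OF P differential_one_form[OF f]] sharp_P_vertical[OF differential_cotangent]
  by (simp_all add: sharp_d_eq) (simp add: sharp_form_def)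

lemma lift_form_vertical: "u \<in> vfields N \<Longrightarrow> v \<in> Vert e \<Longrightarrow> lift_form u e v = 0"
  using lift_form_Vert0[of u e] by (simp add: annihilator_def)

section \<open>The Lie derivative on the adapted coframe\<close>

abbreviation "base_form \<beta> \<equiv> pullback_form M N \<pi> (\<lambda>u. \<beta> [u])"
abbreviation "hforms1 \<equiv> hforms N \<pi> 1 (Cinf M)"

lemma base_form:
  assumes \<beta>: "\<beta> \<in> hforms1"
  shows "module_map M N \<pi> (\<lambda>u. \<beta> [u])" "base_form \<beta> \<in> one_forms M" "base_form \<beta> e \<in> Vert0 e"
    "u \<in> vfields N \<Longrightarrow> X \<in> tangent_space M e \<Longrightarrow> push N \<pi> X = u (\<pi> e) \<Longrightarrow> base_form \<beta> e X = \<beta> [u] e"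
proof -
  show m: "module_map M N \<pi> (\<lambda>u. \<beta> [u])" by (rule hforms_1_module_map[OF \<beta> subset_refl])
  show "base_form \<beta> \<in> one_forms M" by (rule pullback_form_one_form[OF fb m])
  show "base_form \<beta> e \<in> Vert0 e" by (rule pullback_form_annihilator[OF fb m])
  show "u \<in> vfields N \<Longrightarrow> X \<in> tangent_space M e \<Longrightarrow> push N \<pi> X = u (\<pi> e) \<Longrightarrow> base_form \<beta> e X = \<beta> [u] e"
    by (rule pullback_form_apply[OF fb m]) auto
qed

lemma base_form_hor:
  assumes "\<beta> \<in> hforms1" "u \<in> vfields N"
  shows "pair_form (base_form \<beta>) (hor u) = \<beta> [u]"
  by (rule ext) (simp add: pair_form_def base_form(4)[OF assms Hor_tangent] hor_lift assms(2))

lemma base_form_vertical: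
  assumes "\<beta> \<in> hforms1" "\<And>e. Y e \<in> Vert e"
  shows "pair_form (base_form \<beta>) Y = 0"
  using base_form(3)[OF assms(1)] assms(2) by (auto simp: pair_form_def annihilator_def)

text \<open>
  The horizontal lift of \<open>[u, v]\<close> and the bracket of the lifts differ by a vertical field, to which
  \<open>\<pi>\<^sup>*\<beta>\<close> is insensitive; so the exterior derivative of \<open>\<pi>\<^sup>*\<beta>\<close> on lifts is the covariant one of \<open>\<beta>\<close>.
\<close>

lemma ext_d_hor_hor:
  assumes \<beta>: "\<beta> \<in> hforms1" and u: "u \<in> vfields N" and v: "v \<in> vfields N"
  shows "ext_d (base_form \<beta>) p (hor u) (hor v) = cov_ext_deriv M N \<pi> \<gamma> \<beta> [u, v] p"
proof -
  note h = hor_vfields[OF u] hor_vfields[OF v]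
  have "base_form \<beta> p (lie_bracket (hor u) (hor v) p) = \<beta> [lie_bracket u v] p"
    by (intro base_form(4)[OF \<beta> lie_bracket_vfields[OF u v] vfields_tangent[OF lie_bracket_vfields[OF h]]]
        push_lie_bracket[OF fb h(1) _ u h(2) _ v] hor_lift(2) u v)
  then show ?thesis
    by (simp add: ext_d_def base_form_hor[OF \<beta>] u v cov_ext_deriv_pair) (simp add: lie_fun_def)
qed

lemma ext_d_hor_vertical:
  assumes \<beta>: "\<beta> \<in> hforms1" and u: "u \<in> vfields N" and Y: "Y \<in> vfields M" "\<And>e. Y e \<in> Vert e"
  shows "ext_d (base_form \<beta>) p (hor u) Y = - Y p (\<beta> [u])"
proof -
  have "base_form \<beta> p (lie_bracket (hor u) Y p) = 0"
    using base_form(3)[OF \<beta>, of p] lie_bracket_hor_vertical(1)[OF u Y, of p] by (simp add: annihilator_def)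
  then show ?thesis
    by (simp add: ext_d_def base_form_hor[OF \<beta> u] base_form_vertical[OF \<beta> Y(2)] tangent_zero[OF vfields_tangent[OF hor_vfields[OF u]]])
qed

lemma ext_d_vertical_vertical:
  assumes \<beta>: "\<beta> \<in> hforms1" and X: "X \<in> vfields M" "\<And>e. X e \<in> Vert e" and Y: "Y \<in> vfields M" "\<And>e. Y e \<in> Vert e"
  shows "ext_d (base_form \<beta>) p X Y = 0"
proof -
  have "base_form \<beta> p (lie_bracket X Y p) = 0"
    using base_form(3)[OF \<beta>, of p] lie_bracket_vertical_vertical[OF X Y, of p] by (simp add: annihilator_def)
  then show ?thesis
    by (simp add: ext_d_def base_form_vertical[OF \<beta> X(2)] base_form_vertical[OF \<beta> Y(2)]
        tangent_zero[OF vfields_tangent[OF X(1)]] tangent_zero[OF vfields_tangent[OF Y(1)]])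
qed

text \<open>
  Brackets of a vertical field with horizontal lifts are vertical, so the forms \<open>\<alpha>\<^sub>u\<close> and \<open>\<alpha>\<^sub>v\<close> vanish on
  them, and only the derivative of \<open>Q(\<alpha>\<^sub>u, \<alpha>\<^sub>v) = \<sigma>(u, v)\<close> remains.
\<close>

lemma lie_vertical_lift_form_lift_form:
  assumes Y: "Y \<in> vfields M" "\<And>e. Y e \<in> Vert e" and u: "u \<in> vfields N" and v: "v \<in> vfields N"
  shows "lie_bivec_form M Y Q p (lift_form u) (lift_form v) = - Y p (\<sigma> [u, v])"
proof -
  have "bivec_form Q (lift_form u) (lift_form v) = pair_form (lift_form v) (hor u)"
    using pair_sharp_form[OF M Q lift_form_one_form[OF u] lift_form_one_form[OF v]] by (simp add: sharp_form_lift_form[OF u])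
  also have "\<dots> = \<sigma> [u, v]" by (rule ext) (simp add: pair_form_def lift_form_hor u v)
  finally show ?thesis
    using lie_bracket_hor_vertical(2)[OF u Y, of p] lie_bracket_hor_vertical(2)[OF v Y, of p]
    by (simp add: lie_bivec_form_def sharp_form_lift_form u v lift_form_vertical)
qed

lemma lie_vertical_lift_form_vert_d:
  assumes Y: "Y \<in> vfields M" "\<And>e. Y e \<in> Vert e" and u: "u \<in> vfields N" and f: "f \<in> Cinf M"
  shows "lie_bivec_form M Y Q p (lift_form u) (vert_d f) = - lie_bracket (hor u) Y p f"
proof -
  have "bivec_form Q (lift_form u) (vert_d f) = pair_form (vert_d f) (hor u)"
    using pair_sharp_form[OF M Q lift_form_one_form[OF u] vert_d_one_form[OF f]] by (simp add: sharp_form_lift_form[OF u])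
  also have "\<dots> = 0" by (rule ext) (simp add: pair_form_def vert_d_hor u f)
  finally have "lie_bivec_form M Y Q p (lift_form u) (vert_d f) = lie_bracket Y (hor u) p f"
    using lie_bracket_hor_vertical(2)[OF u Y, of p]
      lie_bracket_vertical_vertical[OF Y sharp_d_P[OF f], of p]
    by (simp add: lie_bivec_form_def sharp_form_lift_form sharp_form_vert_d u f lift_form_vertical vert_d_vertical tangent_zero[OF vfields_tangent[OF Y(1)]])
  then show ?thesis by (simp add: lie_bracket_def)
qed

text \<open>
  The brackets of \<open>Y\<close> with \<open>P\<^sup>\<sharp>df\<close> and \<open>P\<^sup>\<sharp>dg\<close> are vertical, and on vertical vectors \<open>\<nu>\<^sub>f\<close> agrees
  with \<open>df\<close>.
\<close>

lemma lie_vertical_vert_d_vert_d: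
  assumes Y: "Y \<in> vfields M" "\<And>e. Y e \<in> Vert e" and f: "f \<in> Cinf M" and g: "g \<in> Cinf M"
  shows "lie_bivec_form M Y Q p (vert_d f) (vert_d g) = lie_bivec M Y P f g p"
proof -
  have br: "vert_d g p (lie_bracket Y (sharp_d M P f) p) = differential M g p (lie_bracket Y (sharp_d M P f) p)"
    if "f \<in> Cinf M" "g \<in> Cinf M" for f g
    using lie_bracket_vertical_vertical[OF Y sharp_d_P[OF that(1)], of p] that(2)
    by (simp add: vert_d_vertical differential_apply Vert_tangent)
  have "bivec_form Q (vert_d f) (vert_d g) = pair_form (vert_d g) (sharp_d M P f)"
    using pair_sharp_form[OF M Q vert_d_one_form[OF f] vert_d_one_form[OF g]] by (simp add: sharp_form_vert_d[OF f])
  also have "\<dots> = bivec_form P (differential M f) (differential M g)"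
    using g by (intro ext) (simp add: pair_form_def vert_d_vertical[OF g sharp_d_P(2)[OF f]] bivec_form_def,
      simp add: sharp_d_def sharp_def)
  finally have "lie_bivec_form M Y Q p (vert_d f) (vert_d g) =
      lie_bivec_form M Y P p (differential M f) (differential M g)"
    by (simp add: lie_bivec_form_def sharp_form_vert_d f g br flip: sharp_d_eq)
  also have "\<dots> = lie_bivec M Y P f g p" by (rule lie_bivec_form_exact[OF M P Y(1) f g])
  finally show ?thesis .
qed

text \<open>
  The correspondence between pairs \<open>(\<beta>, Y)\<close> and vector fields. With the minus sign, the conditions on
  the pair are exactly those in the definitions of \<open>admissible_beta\<close> and \<open>tau\<close>.
\<close>

definition field_of :: "('b, 'e) hform \<times> 'e vfield \<Rightarrow> 'e vfield"
  where "field_of w = snd w - sharp_form M Q (base_form (fst w))"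

lemma tau_not_pair:
  assumes \<beta>: "\<beta> \<in> hforms1" and Y: "Y \<in> vfields M" and us: "\<not> (\<exists>u\<in>vfields N. \<exists>v\<in>vfields N. us = [u, v])"
  shows "cov_ext_deriv M N \<pi> \<gamma> \<beta> us = 0" and "lie_fun Y (\<sigma> us) = 0"
proof -
  have "\<beta> us = 0" if "length us \<noteq> 1" for us
    using \<beta> that by (simp add: hforms_def)
  then show "cov_ext_deriv M N \<pi> \<gamma> \<beta> us = 0"
    by (intro cov_ext_deriv_not_pair[OF _ hor_vfields us])
  have "\<not> (length us = 2 \<and> set us \<subseteq> vfields N)"
    using us by (auto simp: length_Suc_conv numeral_2_eq_2)
  moreover have "\<forall>us. \<not> (length us = 2 \<and> set us \<subseteq> vfields N) \<longrightarrow> \<sigma> us = 0"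
    using \<sigma> unfolding hforms_def mem_Collect_eq by (rule conjunct2)
  ultimately have "\<sigma> us = 0" by simp
  then show "lie_fun Y (\<sigma> us) = 0" by (auto simp: lie_fun_def tangent_zero[OF vfields_tangent[OF Y]])
qed

lemma field_of_Poiss_iff:
  assumes \<beta>: "\<beta> \<in> hforms1" and Y: "Y \<in> vfields M" "\<And>e. Y e \<in> Vert e"
  shows "field_of (\<beta>, Y) \<in> Poiss M Q \<longleftrightarrow>
    Y \<in> Poiss M P \<and> \<beta> \<in> admissible_beta M N \<pi> \<gamma> P Y \<and> tau M N \<pi> \<gamma> \<sigma> Y \<beta> = 0"
proof -
  define X where "X = sharp_form M Q (base_form \<beta>)"
  note b1 = base_form(2)[OF \<beta>]
  have X: "X \<in> vfields M" unfolding X_def by (rule sharp_form_vfields[OF Q b1])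
  have Z: "Y - X \<in> vfields M" by (rule subspace_diff[OF subspace_vfields Y(1) X])
  have D: "lie_bivec_form M (Y - X) Q p \<mu> \<nu> =
      lie_bivec_form M Y Q p \<mu> \<nu> - ext_d (base_form \<beta>) p (sharp_form M Q \<mu>) (sharp_form M Q \<nu>)"
    if "\<mu> \<in> one_forms M" "\<nu> \<in> one_forms M" for p \<mu> \<nu>
    unfolding lie_bivec_form_diff_field[OF Q X Y(1) that]
    by (simp add: X_def lie_bivec_form_sharp_form[OF M poisson b1 that])
  have aa: "lie_bivec_form M (Y - X) Q p (lift_form u) (lift_form v) = - tau M N \<pi> \<gamma> \<sigma> Y \<beta> [u, v] p"
    if u: "u \<in> vfields N" and v: "v \<in> vfields N" for u v p
    by (simp add: D lift_form_one_form u v lie_vertical_lift_form_lift_form[OF Y u v] sharp_form_lift_form ext_d_hor_hor[OF \<beta> u v] tau_def lie_fun_def)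
  have an: "lie_bivec_form M (Y - X) Q p (lift_form u) (vert_d f) =
      - (lie_bracket (hor u) Y p f + sharp_d M P (\<beta> [u]) p f)"
    if u: "u \<in> vfields N" and f: "f \<in> Cinf M" for u f p
  proof -
    have bC: "\<beta> [u] \<in> Cinf M" using \<beta> u by (simp only: hforms_1_iff)
    have "sharp_d M P f p (\<beta> [u]) = - sharp_d M P (\<beta> [u]) p f"
      using f bC bivector_skew[OF bivector_at[OF P], of p "differential M f p"]
      by (simp add: sharp_d_def sharp_def)
    then show ?thesis
      by (simp add: D lift_form_one_form vert_d_one_form u f lie_vertical_lift_form_vert_d[OF Y u f] sharp_form_lift_form sharp_form_vert_d
          ext_d_hor_vertical[OF \<beta> u sharp_d_P[OF f]])
  qed
  have nn: "lie_bivec_form M (Y - X) Q p (vert_d f) (vert_d g) = lie_bivec M Y P f g p"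
    if f: "f \<in> Cinf M" and g: "g \<in> Cinf M" for f g p
    by (simp add: D vert_d_one_form f g lie_vertical_vert_d_vert_d[OF Y f g] sharp_form_vert_d
        ext_d_vertical_vertical[OF \<beta> sharp_d_P[OF f] sharp_d_P[OF g]])
  have "(\<forall>u\<in>vfields N. \<forall>v\<in>vfields N. \<forall>p. lie_bivec_form M (Y - X) Q p (lift_form u) (lift_form v) = 0) \<longleftrightarrow>
      tau M N \<pi> \<gamma> \<sigma> Y \<beta> = 0"
  proof
    assume "\<forall>u\<in>vfields N. \<forall>v\<in>vfields N. \<forall>p. lie_bivec_form M (Y - X) Q p (lift_form u) (lift_form v) = 0"
    then have p0: "tau M N \<pi> \<gamma> \<sigma> Y \<beta> [u, v] p = 0" if "u \<in> vfields N" "v \<in> vfields N" for u v p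
      using aa that by simp
    show "tau M N \<pi> \<gamma> \<sigma> Y \<beta> = 0"
    proof (intro ext)
      fix us p
      show "tau M N \<pi> \<gamma> \<sigma> Y \<beta> us p = 0 us p"
      proof (cases "\<exists>u\<in>vfields N. \<exists>v\<in>vfields N. us = [u, v]")
        case True
        then show ?thesis using p0 by auto
      next
        case False
        show ?thesis using tau_not_pair[OF \<beta> Y(1) False] by (simp add: tau_def)
      qed
    qed
  qed (simp add: aa)
  moreover have "(\<forall>u\<in>vfields N. \<forall>f\<in>Cinf M. \<forall>p. lie_bivec_form M (Y - X) Q p (lift_form u) (vert_d f) = 0) \<longleftrightarrow>
      \<beta> \<in> admissible_beta M N \<pi> \<gamma> P Y"
  proof -
    have eq: "(\<forall>f\<in>Cinf M. \<forall>p. lie_bivec_form M (Y - X) Q p (lift_form u) (vert_d f) = 0) \<longleftrightarrow>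
        lie_bracket (hor u) Y = - sharp_d M P (\<beta> [u])" if u: "u \<in> vfields N" for u
    proof
      assume as: "\<forall>f\<in>Cinf M. \<forall>p. lie_bivec_form M (Y - X) Q p (lift_form u) (vert_d f) = 0"
      show "lie_bracket (hor u) Y = - sharp_d M P (\<beta> [u])"
      proof (intro ext)
        fix p f
        show "lie_bracket (hor u) Y p f = (- sharp_d M P (\<beta> [u])) p f"
        proof (cases "f \<in> Cinf M")
          case True
          then have "lie_bivec_form M (Y - X) Q p (lift_form u) (vert_d f) = 0" using as by blast
          then show ?thesis unfolding an[OF u True] by simp
        next
          case False
          then show ?thesis
            using tangent_notin[OF vfields_tangent[OF lie_bracket_vfields[OF hor_vfields[OF u] Y(1)]]]
            by (simp add: sharp_d_def sharp_def)
        qed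
      qed
    qed (simp add: an[OF u])
    show ?thesis
      unfolding admissible_beta_def mem_Collect_eq using \<beta> eq by blast
  qed
  moreover have "(\<forall>f\<in>Cinf M. \<forall>g\<in>Cinf M. \<forall>p. lie_bivec_form M (Y - X) Q p (vert_d f) (vert_d g) = 0) \<longleftrightarrow> Y \<in> Poiss M P"
    using Y(1) by (simp add: nn Poiss_def fun_eq_iff)
  moreover have "field_of (\<beta>, Y) = Y - X" by (simp add: field_of_def X_def)
  ultimately show ?thesis using Poiss_iff_split[OF Z] by (simp add: conj_ac)
qed

section \<open>Automorphisms as pairs\<close>

text \<open>
  The pairs that correspond to infinitesimal automorphisms of \<open>Q\<close>.
\<close>

definition autom_pairs :: "(('b, 'e) hform \<times> 'e vfield) set"
  where "autom_pairs = {(\<beta>, Y). \<beta> \<in> admissible_beta M N \<pi> \<gamma> P Y \<and> Y \<in> Poiss_V M N \<pi> P \<and> tau M N \<pi> \<gamma> \<sigma> Y \<beta> = 0}"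

text \<open>
  The pairs that correspond to arbitrary vector fields.
\<close>

definition vertical_pairs :: "(('b, 'e) hform \<times> 'e vfield) set"
  where "vertical_pairs = hforms1 \<times> {Y \<in> vfields M. \<forall>e. Y e \<in> Vert e}"

lemma autom_pairs_iff: "w \<in> autom_pairs \<longleftrightarrow> w \<in> vertical_pairs \<and> field_of w \<in> Poiss M Q"
proof (cases w)
  case (Pair \<beta> Y)
  have "\<beta> \<in> hforms1 \<and> Y \<in> vfields M" if "w \<in> autom_pairs"
    using that Pair by (simp add: autom_pairs_def admissible_beta_def Poiss_V_def Poiss_def)
  then show ?thesis
    using Pair field_of_Poiss_iff[of \<beta> Y] by (auto simp: autom_pairs_def vertical_pairs_def Poiss_V_def)
qed

lemma subspace_hforms1: "subspace hforms1"
  by (rule subspace_hforms_1) (simp add: subspace_def)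

lemma subspace_vertical_pairs: "subspace vertical_pairs"
proof -
  have "subspace {Y \<in> vfields M. \<forall>e. Y e \<in> Vert e}"
    using subspace_vfields[of M]
    by (simp add: subspace_def[of "vfields M"])
      (simp add: subspace_def subspace_0[OF subspace_vertical] subspace_add[OF subspace_vertical]
        subspace_scale[OF subspace_vertical])
  then show ?thesis unfolding vertical_pairs_def by (intro subspace_Times subspace_hforms1)
qed

lemma field_of_add:
  assumes "w \<in> vertical_pairs" "z \<in> vertical_pairs"
  shows "field_of (w + z) = field_of w + field_of z"
proof -
  have "base_form (fst w + fst z) = base_form (fst w) + base_form (fst z)"
    by (intro ext) (simp add: pullback_form_def)
  then show ?thesis
    using assms sharp_form_add[OF M Q, of "base_form (fst w)" "base_form (fst z)"] base_form(2)
    by (auto simp: field_of_def vertical_pairs_def algebra_simps)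
qed

lemma field_of_scaleR:
  assumes "w \<in> vertical_pairs"
  shows "field_of (c *\<^sub>R w) = c *\<^sub>R field_of w"
proof -
  have "base_form (c *\<^sub>R fst w) = fun_times_form (\<lambda>_. c) (base_form (fst w))"
    by (intro ext) (simp add: pullback_form_def fun_times_form_def)
  moreover have "base_form (fst w) \<in> one_forms M" using assms base_form(2) by (auto simp: vertical_pairs_def)
  ultimately have "sharp_form M Q (base_form (c *\<^sub>R fst w)) = fun_times_vfield (\<lambda>_. c) (sharp_form M Q (base_form (fst w)))"
    using sharp_form_fun_times[OF M Q] by metis
  then show ?thesis by (auto simp: field_of_def fun_times_vfield_def algebra_simps)
qed

lemma subspace_autom_pairs: "subspace autom_pairs"
proof (rule subspaceI)
  note S = subspace_Poiss[OF M Q]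
  have z: "0 \<in> vertical_pairs" by (rule subspace_0[OF subspace_vertical_pairs])
  show "0 \<in> autom_pairs" using field_of_scaleR[OF z, of 0] subspace_0[OF S] z by (simp add: autom_pairs_iff)
  show "x + y \<in> autom_pairs" if "x \<in> autom_pairs" "y \<in> autom_pairs" for x y
    using that subspace_add[OF S] subspace_add[OF subspace_vertical_pairs] by (simp add: autom_pairs_iff field_of_add)
  show "c *\<^sub>R x \<in> autom_pairs" if "x \<in> autom_pairs" for c x
    using that subspace_scale[OF S] subspace_scale[OF subspace_vertical_pairs] by (simp add: autom_pairs_iff field_of_scaleR)
qed

text \<open>
  Equality of the fields puts the difference of the \<open>Y\<close> into the horizontal and the vertical space.
\<close>

lemma inj_on_field_of: "inj_on field_of vertical_pairs"
proof (rule inj_onI)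
  fix w z assume w: "w \<in> vertical_pairs" and z: "z \<in> vertical_pairs" and eq: "field_of w = field_of z"
  obtain \<beta> Y \<eta> X where p: "w = (\<beta>, Y)" "z = (\<eta>, X)" by (cases w, cases z) auto
  have b: "\<beta> \<in> hforms1" "\<eta> \<in> hforms1" and YX: "\<And>e. Y e \<in> Vert e" "\<And>e. X e \<in> Vert e"
    using w z by (auto simp: p vertical_pairs_def)
  have e: "Y e - X e = sharp M Q e (base_form \<beta> e) - sharp M Q e (base_form \<eta> e)" for e
    using fun_cong[OF eq, of e] by (simp add: field_of_def p sharp_form_def algebra_simps)
  have "Y e - X e = 0" for e
  proof (rule Hor_Vert_zero)
    show "Y e - X e \<in> Vert e" using YX by (intro subspace_diff[OF subspace_vertical])
    show "Y e - X e \<in> Hor e" unfolding e by (intro subspace_diff[OF subspace_Hor] sharp_Vert0_Hor base_form(3) b)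
  qed
  with e have s: "Y e = X e" "sharp M Q e (base_form \<beta> e) = sharp M Q e (base_form \<eta> e)" for e by (auto simp: algebra_simps)
  have "base_form \<beta> e = base_form \<eta> e" for e by (rule sharp_inj'[OF base_form(3)[OF b(1)] base_form(3)[OF b(2)] s(2)])
  then have hu: "\<beta> [u] = \<eta> [u]" if "u \<in> vfields N" for u
    using base_form_hor[OF b(1) that] base_form_hor[OF b(2) that] by (simp add: pair_form_def)
  have "\<beta> us = \<eta> us" for us
  proof (cases "\<exists>u\<in>vfields N. us = [u]")
    case True
    then show ?thesis using hu by auto
  next
    case False
    then show ?thesis using b unfolding hforms_1_iff by metis
  qed
  with s(1) show "w = z" by (auto simp: p)
qed

text \<open>
  The horizontal part \<open>X\<close> of \<open>Z\<close> must be \<open>- Q\<^sup>\<sharp>(\<pi>\<^sup>*\<beta>)\<close>. Pairing with \<open>\<alpha>\<^sub>u\<close> gives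
  \<open>\<alpha>\<^sub>u(X) = Q(\<alpha>\<^sub>u, \<pi>\<^sup>*\<beta>) = (\<pi>\<^sup>*\<beta>)(hor u) = \<beta>(u)\<close>, and \<open>\<alpha>\<^sub>u(X) = \<alpha>\<^sub>u(Z)\<close>. This determines \<open>\<beta>\<close> without
  projecting \<open>Z\<close>.
\<close>

lemma field_of_surj:
  assumes Z: "Z \<in> vfields M"
  shows "Z \<in> field_of ` vertical_pairs"
proof -
  \<comment> \<open>\<open>\<beta>(u) = \<alpha>\<^sub>u(Z)\<close>, with the default value 0 off the lists of length one\<close>
  define \<beta> where "\<beta> = (\<lambda>us. if \<exists>u\<in>vfields N. us = [u] then pair_form (lift_form (hd us)) Z else 0)"
  have \<beta>u: "\<beta> [u] = pair_form (lift_form u) Z" if "u \<in> vfields N" for u using that by (simp add: \<beta>_def)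
  have \<beta>: "\<beta> \<in> hforms1"
    unfolding hforms_1_iff
  proof (intro conjI ballI allI impI)
    show "\<beta> [u] \<in> Cinf M" if "u \<in> vfields N" for u
      unfolding \<beta>u[OF that] by (rule one_forms_Cinf[OF lift_form_one_form[OF that] Z])
    have ex: "\<exists>w\<in>vfields N. \<forall>u\<in>vfields N. pair_form (lift_form u) Z e = \<sigma> [w, u] e" for e
      using extend_push[OF fb vfields_tangent[OF Z, of e]] lift_form_apply[OF _ vfields_tangent[OF Z]]
      unfolding pair_form_def by metis
    show "\<beta> [u + v] = \<beta> [u] + \<beta> [v]" if u: "u \<in> vfields N" and v: "v \<in> vfields N" for u v
    proof
      fix e
      obtain w where w: "w \<in> vfields N" "\<forall>u\<in>vfields N. pair_form (lift_form u) Z e = \<sigma> [w, u] e" using ex by blast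
      have "\<sigma> [w, u + v] = \<sigma> [w, u] + \<sigma> [w, v]"
        using sigma_module_map[OF w(1)] u v by (simp add: module_map_def)
      then show "\<beta> [u + v] e = (\<beta> [u] + \<beta> [v]) e"
        using w(2) u v subspace_add[OF subspace_vfields u v] by (simp add: \<beta>u)
    qed
    show "\<beta> [fun_times_vfield f u] = (f \<circ> \<pi>) * \<beta> [u]" if f: "f \<in> Cinf N" and u: "u \<in> vfields N" for f u
    proof
      fix e
      obtain w where w: "w \<in> vfields N" "\<forall>u\<in>vfields N. pair_form (lift_form u) Z e = \<sigma> [w, u] e" using ex by blast
      have "\<sigma> [w, fun_times_vfield f u] = (f \<circ> \<pi>) * \<sigma> [w, u]"
        using sigma_module_map[OF w(1)] f u by (simp add: module_map_def)
      then show "\<beta> [fun_times_vfield f u] e = ((f \<circ> \<pi>) * \<beta> [u]) e"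
        using w(2) u fun_times_vfield_vfields[OF f u] by (simp add: \<beta>u)
    qed
    show "\<beta> us = 0" if "\<not> (\<exists>u\<in>vfields N. us = [u])" for us using that by (simp only: \<beta>_def if_False)
  qed
  define Y where "Y = Z + sharp_form M Q (base_form \<beta>)"
  have Y: "Y \<in> vfields M"
    unfolding Y_def by (intro subspace_add[OF subspace_vfields] Z sharp_form_vfields[OF Q] base_form(2)[OF \<beta>])
  have "Y e \<in> Vert e" for e
  proof -
    have "push N \<pi> (Y e) g = 0" for g
    proof (cases "g \<in> Cinf N")
      case True
      \<comment> \<open>covectors pulled back from the base are some \<open>\<alpha>\<^sub>u\<close>, so verticality follows from the definition of \<open>\<beta>\<close>\<close>
      obtain u where u: "u \<in> vfields N" "lift_form u e = differential M (g \<circ> \<pi>) e"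
        using exists_lift_form[OF comp_differential_Vert0[OF True]] by blast
      have "sharp M Q e (base_form \<beta> e) (g \<circ> \<pi>) = Q e (base_form \<beta> e) (lift_form u e)"
        using comp_Cinf[OF fb True] by (simp add: sharp_def u(2))
      also have "\<dots> = - Q e (lift_form u e) (base_form \<beta> e)" by (rule bivector_skew[OF bivector_at[OF Q]])
      also have "Q e (lift_form u e) (base_form \<beta> e) = pair_form (base_form \<beta>) (sharp_form M Q (lift_form u)) e"
        using pair_sharp_form[OF M Q lift_form_one_form[OF u(1)] base_form(2)[OF \<beta>]] by (simp add: bivec_form_def)
      also have "\<dots> = lift_form u e (Z e)"
        by (simp add: sharp_form_lift_form[OF u(1)] base_form_hor[OF \<beta> u(1)] \<beta>u[OF u(1)]) (simp add: pair_form_def)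
      also have "\<dots> = Z e (g \<circ> \<pi>)" by (simp add: u(2) differential_apply[OF vfields_tangent[OF Z]])
      finally have "sharp M Q e (base_form \<beta> e) (g \<circ> \<pi>) = - Z e (g \<circ> \<pi>)" .
      moreover have "push N \<pi> (Y e) g = Z e (g \<circ> \<pi>) + sharp M Q e (base_form \<beta> e) (g \<circ> \<pi>)"
        using True by (simp add: push_def Y_def sharp_form_def)
      ultimately show ?thesis by simp
    qed (simp add: push_def)
    then show ?thesis using vfields_tangent[OF Y] by (auto simp: vertical_def)
  qed
  then have "(\<beta>, Y) \<in> vertical_pairs" using \<beta> Y by (simp add: vertical_pairs_def)
  moreover have "Z = field_of (\<beta>, Y)" by (simp add: field_of_def Y_def)
  ultimately show ?thesis by (rule image_eqI[rotated])
qed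

lemma bij_betw_field_of: "bij_betw field_of autom_pairs (Poiss M Q)"
proof -
  have "inj_on field_of autom_pairs" by (rule inj_on_subset[OF inj_on_field_of]) (auto simp: autom_pairs_iff)
  moreover have "field_of ` autom_pairs = Poiss M Q"
    using field_of_surj by (force simp: autom_pairs_iff Poiss_def)
  ultimately show ?thesis by (simp add: bij_betw_def)
qed

section \<open>Cocycles and the kernel of \<open>\<rho>\<close>\<close>

lemma cov_ext_deriv_add:
  assumes \<beta>: "\<beta> \<in> hforms1" and \<eta>: "\<eta> \<in> hforms1"
  shows "cov_ext_deriv M N \<pi> \<gamma> (\<beta> + \<eta>) = cov_ext_deriv M N \<pi> \<gamma> \<beta> + cov_ext_deriv M N \<pi> \<gamma> \<eta>"
proof
  fix us
  show "cov_ext_deriv M N \<pi> \<gamma> (\<beta> + \<eta>) us = (cov_ext_deriv M N \<pi> \<gamma> \<beta> + cov_ext_deriv M N \<pi> \<gamma> \<eta>) us"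
  proof (cases "\<exists>u\<in>vfields N. \<exists>v\<in>vfields N. us = [u, v]")
    case True
    then obtain u v where uv: "u \<in> vfields N" "v \<in> vfields N" "us = [u, v]" by blast
    have C: "\<beta> [w] \<in> Cinf M" "\<eta> [w] \<in> Cinf M" if "w \<in> vfields N" for w
      using \<beta> \<eta> that unfolding hforms_1_iff by blast+
    show ?thesis
      using uv by (simp add: cov_ext_deriv_pair lie_fun_add[OF hor_vfields] C)
  next
    case False
    have z: "0 \<in> vfields M" by (rule subspace_0[OF subspace_vfields])
    show ?thesis
      using tau_not_pair(1)[OF \<beta> z False] tau_not_pair(1)[OF \<eta> z False]
        tau_not_pair(1)[OF subspace_add[OF subspace_hforms1 \<beta> \<eta>] z False] by simp
  qed
qed

lemma cov_ext_deriv_diff: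
  assumes \<beta>: "\<beta> \<in> hforms1" and \<eta>: "\<eta> \<in> hforms1"
  shows "cov_ext_deriv M N \<pi> \<gamma> (\<beta> - \<eta>) = cov_ext_deriv M N \<pi> \<gamma> \<beta> - cov_ext_deriv M N \<pi> \<gamma> \<eta>"
  using cov_ext_deriv_add[OF subspace_diff[OF subspace_hforms1 \<beta> \<eta>] \<eta>] by simp

lemma cochains_1_iff: "\<eta> \<in> casimir_cochains M N \<pi> P 1 \<longleftrightarrow> \<eta> \<in> hforms1 \<and> (\<forall>u\<in>vfields N. sharp_d M P (\<eta> [u]) = 0)"
  unfolding casimir_cochains_def hforms_1_iff Casim_def by blast

lemma admissible_iff: "\<beta> \<in> admissible_beta M N \<pi> \<gamma> P Y \<longleftrightarrow>
    \<beta> \<in> hforms1 \<and> (\<forall>u\<in>vfields N. lie_bracket (hor u) Y = - sharp_d M P (\<beta> [u]))"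
  by (simp add: admissible_beta_def)

lemma admissible_add:
  assumes \<beta>: "\<beta> \<in> admissible_beta M N \<pi> \<gamma> P Y" and \<eta>: "\<eta> \<in> casimir_cochains M N \<pi> P 1"
  shows "\<beta> + \<eta> \<in> admissible_beta M N \<pi> \<gamma> P Y"
proof -
  have f: "\<beta> \<in> hforms1" "\<eta> \<in> hforms1" using \<beta> \<eta> by (simp_all only: admissible_iff cochains_1_iff)
  have "sharp_d M P ((\<beta> + \<eta>) [u]) = sharp_d M P (\<beta> [u])" if u: "u \<in> vfields N" for u
  proof -
    have "\<beta> [u] \<in> Cinf M" "\<eta> [u] \<in> Cinf M" using f u unfolding hforms_1_iff by blast+
    then show ?thesis using \<eta> u sharp_d_add[OF P, of "\<beta> [u]" "\<eta> [u]"] unfolding cochains_1_iff by simp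
  qed
  then show ?thesis
    using \<beta> subspace_add[OF subspace_hforms1 f] by (simp add: admissible_iff)
qed

text \<open>
  Two admissible forms for the same \<open>Y\<close> differ by a Casimir-valued one, whence \<open>\<rho>\<close> does not depend on
  the choice.
\<close>

lemma admissible_diff:
  assumes \<beta>: "\<beta> \<in> admissible_beta M N \<pi> \<gamma> P Y" and \<eta>: "\<eta> \<in> admissible_beta M N \<pi> \<gamma> P Y"
  shows "\<beta> - \<eta> \<in> casimir_cochains M N \<pi> P 1"
proof -
  have f: "\<beta> \<in> hforms1" "\<eta> \<in> hforms1" using \<beta> \<eta> by (simp_all only: admissible_iff)
  have "sharp_d M P ((\<beta> - \<eta>) [u]) = 0" if u: "u \<in> vfields N" for u
  proof -
    have "\<beta> [u] \<in> Cinf M" "\<eta> [u] \<in> Cinf M" using f u unfolding hforms_1_iff by blast+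
    then have "sharp_d M P (\<beta> [u] - \<eta> [u] + \<eta> [u]) = sharp_d M P (\<beta> [u] - \<eta> [u]) + sharp_d M P (\<eta> [u])"
      by (intro sharp_d_add[OF P] Cinf_diff)
    moreover have "- sharp_d M P (\<beta> [u]) = - sharp_d M P (\<eta> [u])"
      using \<beta> \<eta> u unfolding admissible_iff by metis
    ultimately show ?thesis by simp
  qed
  then show ?thesis
    unfolding cochains_1_iff using subspace_diff[OF subspace_hforms1 f] by blast
qed

lemma tau_diff:
  assumes "\<beta> \<in> hforms1" "\<eta> \<in> hforms1"
  shows "tau M N \<pi> \<gamma> \<sigma> Y \<beta> = tau M N \<pi> \<gamma> \<sigma> Y \<eta> + cov_ext_deriv M N \<pi> \<gamma> (\<beta> - \<eta>)"
  by (simp add: tau_def cov_ext_deriv_diff[OF assms])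

lemma subspace_cochains_1: "subspace (casimir_cochains M N \<pi> P 1)"
  unfolding casimir_cochains_def by (rule subspace_hforms_1[OF subspace_Casim[OF P]])

lemma coboundaries_2: "casimir_coboundaries M N \<pi> \<gamma> P 2 = cov_ext_deriv M N \<pi> \<gamma> ` casimir_cochains M N \<pi> P 1"
  by (simp add: casimir_coboundaries_def numeral_2_eq_2)

lemma class_0: "casimir_class M N \<pi> \<gamma> P 2 0 = cov_ext_deriv M N \<pi> \<gamma> ` casimir_cochains M N \<pi> P 1"
  by (simp add: casimir_class_def coboundaries_2)

lemma class_coboundary:
  assumes \<eta>: "\<eta> \<in> casimir_cochains M N \<pi> P 1"
  shows "casimir_class M N \<pi> \<gamma> P 2 (cov_ext_deriv M N \<pi> \<gamma> \<eta>) = casimir_class M N \<pi> \<gamma> P 2 0"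
proof -
  let ?d = "cov_ext_deriv M N \<pi> \<gamma>" and ?C = "casimir_cochains M N \<pi> P 1"
  have f: "\<zeta> \<in> hforms1" if "\<zeta> \<in> ?C" for \<zeta> using that unfolding cochains_1_iff by blast
  have "(\<lambda>\<zeta>. ?d \<eta> + \<zeta>) ` ?d ` ?C = ?d ` ?C"
  proof (intro subset_antisym subsetI)
    fix x assume "x \<in> (\<lambda>\<zeta>. ?d \<eta> + \<zeta>) ` ?d ` ?C"
    then obtain \<zeta> where \<zeta>: "\<zeta> \<in> ?C" "x = ?d \<eta> + ?d \<zeta>" by blast
    have "x = ?d (\<eta> + \<zeta>)" unfolding \<zeta>(2) by (rule cov_ext_deriv_add[OF f[OF \<eta>] f[OF \<zeta>(1)], symmetric])
    then show "x \<in> ?d ` ?C" by (rule image_eqI[OF _ subspace_add[OF subspace_cochains_1 \<eta> \<zeta>(1)]])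
  next
    fix x assume "x \<in> ?d ` ?C"
    then obtain \<zeta> where \<zeta>: "\<zeta> \<in> ?C" "x = ?d \<zeta>" by blast
    have "x = ?d \<eta> + ?d (\<zeta> - \<eta>)" unfolding \<zeta>(2) by (simp add: cov_ext_deriv_diff[OF f[OF \<zeta>(1)] f[OF \<eta>]])
    moreover have "\<zeta> - \<eta> \<in> ?C" by (rule subspace_diff[OF subspace_cochains_1 \<zeta>(1) \<eta>])
    ultimately show "x \<in> (\<lambda>\<zeta>. ?d \<eta> + \<zeta>) ` ?d ` ?C" by blast
  qed
  then show ?thesis unfolding class_0 by (simp add: casimir_class_def coboundaries_2)
qed

text \<open>
  If the class of \<open>\<tau>\<close> is zero, then an admissible form can be corrected by a Casimir-valued one such
  that \<open>\<tau>\<close> itself is zero. The kernel condition includes that an admissible form exists: otherwise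
  \<open>\<rho>(Y)\<close> would be the empty set, which is not a coset.
\<close>

lemma ker_rho_eq: "ker_rho M N \<pi> \<gamma> \<sigma> P = snd ` autom_pairs"
proof (intro subset_antisym subsetI)
  fix Y assume Y: "Y \<in> ker_rho M N \<pi> \<gamma> \<sigma> P"
  then have "rho M N \<pi> \<gamma> \<sigma> P Y = cov_ext_deriv M N \<pi> \<gamma> ` casimir_cochains M N \<pi> P 1"
    unfolding ker_rho_def class_0 by blast
  moreover have z: "0 \<in> hforms1" "0 \<in> casimir_cochains M N \<pi> P 1"
    by (rule subspace_0[OF subspace_hforms1], rule subspace_0[OF subspace_cochains_1])
  moreover have "cov_ext_deriv M N \<pi> \<gamma> 0 = 0" using cov_ext_deriv_diff[OF z(1) z(1)] by simp
  ultimately have "0 \<in> rho M N \<pi> \<gamma> \<sigma> P Y" by force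
  then obtain \<beta> \<zeta> where b: "\<beta> \<in> admissible_beta M N \<pi> \<gamma> P Y" "\<zeta> \<in> casimir_cochains M N \<pi> P 1"
    "0 = tau M N \<pi> \<gamma> \<sigma> Y \<beta> + cov_ext_deriv M N \<pi> \<gamma> \<zeta>"
    unfolding rho_def casimir_class_def coboundaries_2 by blast
  have f: "\<beta> \<in> hforms1" "\<zeta> \<in> hforms1" using b(1,2) unfolding admissible_iff cochains_1_iff by blast+
  have "tau M N \<pi> \<gamma> \<sigma> Y (\<beta> + \<zeta>) = 0"
    using tau_diff[OF subspace_add[OF subspace_hforms1 f] f(1), of Y] b(3) by simp
  then have "(\<beta> + \<zeta>, Y) \<in> autom_pairs"
    using admissible_add[OF b(1,2)] Y by (simp add: autom_pairs_def ker_rho_def A_gamma_def)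
  then show "Y \<in> snd ` autom_pairs" by force
next
  fix Y assume "Y \<in> snd ` autom_pairs"
  then obtain \<beta> where b: "\<beta> \<in> admissible_beta M N \<pi> \<gamma> P Y" "Y \<in> Poiss_V M N \<pi> P" "tau M N \<pi> \<gamma> \<sigma> Y \<beta> = 0"
    unfolding autom_pairs_def by auto
  have f: "\<beta> \<in> hforms1" using b(1) unfolding admissible_iff by blast
  have "lie_bracket (hor u) Y \<in> Ham M P" if u: "u \<in> vfields N" for u
  proof -
    have C: "\<beta> [u] \<in> Cinf M" using f u unfolding hforms_1_iff by blast
    have "lie_bracket (hor u) Y = sharp_d M P ((-1) *\<^sub>R \<beta> [u])"
      using b(1) u unfolding admissible_iff sharp_d_scaleR[OF P C] by simp
    then show ?thesis unfolding Ham_def by (rule image_eqI[where f = "sharp_d M P"]) (rule Cinf_scaleR[OF C])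
  qed
  then have A: "Y \<in> A_gamma M N \<pi> \<gamma> P" using b(2) by (simp add: A_gamma_def)
  have "casimir_class M N \<pi> \<gamma> P 2 (tau M N \<pi> \<gamma> \<sigma> Y \<eta>) = casimir_class M N \<pi> \<gamma> P 2 0"
    if \<eta>: "\<eta> \<in> admissible_beta M N \<pi> \<gamma> P Y" for \<eta>
  proof -
    have "\<eta> \<in> hforms1" using \<eta> unfolding admissible_iff by blast
    then have "tau M N \<pi> \<gamma> \<sigma> Y \<eta> = cov_ext_deriv M N \<pi> \<gamma> (\<eta> - \<beta>)"
      using tau_diff[OF _ f, of \<eta> Y] b(3) by simp
    then show ?thesis using class_coboundary[OF admissible_diff[OF \<eta> b(1)]] by simp
  qed
  then have "rho M N \<pi> \<gamma> \<sigma> P Y = casimir_class M N \<pi> \<gamma> P 2 0"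
    unfolding rho_def using b(1) by blast
  then show "Y \<in> ker_rho M N \<pi> \<gamma> \<sigma> P" using A by (simp add: ker_rho_def)
qed

lemma cocycles_eq: "casimir_cocycles M N \<pi> \<gamma> P 1 = {\<beta>. (\<beta>, 0) \<in> autom_pairs}"
proof -
  have zP: "0 \<in> Poiss_V M N \<pi> P"
    using subspace_0[OF subspace_Poiss[OF M P]]
    by (simp add: Poiss_V_def subspace_0[OF subspace_vertical])
  have t: "tau M N \<pi> \<gamma> \<sigma> 0 \<beta> = cov_ext_deriv M N \<pi> \<gamma> \<beta>" for \<beta>
    by (auto simp: tau_def lie_fun_def fun_eq_iff)
  have "lie_bracket (hor u) 0 = 0" if "u \<in> vfields N" for u
  proof (intro ext)
    fix p and f :: "'e \<Rightarrow> real"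
    have "lie_fun 0 f = 0" by (auto simp: lie_fun_def)
    then show "lie_bracket (hor u) 0 p f = 0 p f"
      using tangent_zero[OF vfields_tangent[OF hor_vfields[OF that]]] by (simp add: lie_bracket_def)
  qed
  then have "\<beta> \<in> admissible_beta M N \<pi> \<gamma> P 0 \<longleftrightarrow> \<beta> \<in> casimir_cochains M N \<pi> P 1" for \<beta>
    unfolding admissible_iff cochains_1_iff by auto
  then show ?thesis unfolding casimir_cocycles_def autom_pairs_def using zP by (auto simp: t)
qed

end

section \<open>Infinitesimal automorphisms of a coupling tensor\<close>

theorem theorem1:
  fixes M :: "('e::{t2_space, second_countable_topology}, 'm::euclidean_space) atlas"
    and N :: "('b::{t2_space, second_countable_topology}, 'n::euclidean_space) atlas"
    and \<pi> :: "'e \<Rightarrow> 'b"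
    and Q Q20 P :: "'e bivec"
    and \<gamma> :: "'e \<Rightarrow> 'e tvec \<Rightarrow> 'e tvec"
    and \<sigma> :: "('b, 'e) hform"
  assumes "fiber_bundle M N \<pi>"
    and "poisson_tensor M Q"
    and "coupling M N \<pi> Q"
    and "geometric_data M N \<pi> Q Q20 \<gamma> \<sigma> P"
  shows "vs_isomorphic (Poiss M Q)
    (casimir_cocycles M N \<pi> \<gamma> P 1 \<times> ker_rho M N \<pi> \<gamma> \<sigma> P)"
proof -
  interpret coupling_data M N \<pi> Q Q20 P \<gamma> \<sigma>
    by unfold_locales (fact assms)+
  have "autom_pairs \<subseteq> vertical_pairs" by (auto simp: autom_pairs_iff)
  then show ?thesis
    unfolding ker_rho_eq cocycles_eq
    by (intro vs_isomorphic_split[OF subspace_autom_pairs subspace_Poiss[OF M Q] bij_betw_field_of])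
      (auto intro: field_of_add field_of_scaleR)
qed

end
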